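(* Let $(\Delta,\mathcal V,\xi)$ be a triple consisting of a simplicial multi-fan $\Delta$ in a lattice $L$ of rank $n$, a set $\mathcal V$ of edge vectors for $\Delta$ and a $\mathbb Q$-divisor $\xi\in H_T^2(\Delta,\mathcal V)\otimes\mathbb Q$. Let $f:\Delta'\to\Delta$ be a birational morphism and $\mathcal V'$ a set of edge vectors for the multi-fan $\Delta'$. Then $$\hat\varphi_{st}(\Delta',\mathcal V',f^*(\xi))=\hat\varphi_{st}(\Delta,\mathcal V,\xi).$$
   Context: **Multi-fans.** Let $L$ be a lattice of rank $n$, $L_{\mathbb R}=L\otimes\mathbb R$, $L_{\mathbb C}=L\otimes\mathbb C$. A simplicial multi-fan in $L$ is a triple $\Delta=(\Sigma,C,w^\pm)$: $\Sigma$ is a finite abstract simplicial complex including the empty simplex; $\Sigma^{(k)}$ is the set of simplices with $k$ vertices ($\Sigma^{(1)}$ is identified with the vertex set); $\Sigma=\coprod_{k=0}^n\Sigma^{(k)}$, $\Sigma^{(n)}\ne\emptyset$, and every simplex lies in some $I\in\Sigma^{(n)}$. $C$ assigns to $J\in\Sigma^{(k)}$ a $k$-dimensional strongly convex rational polyhedral cone $C(J)\subset L_{\mathbb R}$, with $C(\emptyset)=\{0\}$, such that for each $I\in\Sigma$ the map $J\mapsto C(J)$ is an isomorphism of ordered sets from the faces of $I$ onto the faces of $C(I)$. $w^\pm:\Sigma^{(n)}\to\mathbb Z_{\ge0}$ are maps and $w=w^+-w^-$. **Edge vectors and divisors.** A set of edge vectors is $\mathcal V=\{v_i\}_{i\in\Sigma^{(1)}}$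 with $0\ne v_i\in L\cap C(i)$ (not necessarily primitive). For $I\in\Sigma^{(n)}$, $L_{I,\mathcal V}\subset L$ is the sublattice generated by $\{v_i\}_{i\in I}$, $\{u_i^I\}_{i\in I}$ is the basis of the dual lattice $L_{I,\mathcal V}^*$ dual to $\{v_i\}_{i\in I}$, and $H_I=L/L_{I,\mathcal V}$. $H_T^*(\Delta,\mathcal V)$ is the Stanley–Reisner ring $\mathbb Z[x_i:i\in\Sigma^{(1)}]/(\prod_{i\in J}x_i:J\notin\Sigma)$, $\deg x_i=2$. A $\mathbb Q$-divisor is an element $\xi=\sum_id_ix_i\in H_T^2(\Delta,\mathcal V)\otimes\mathbb Q$. **Orbifold elliptic genus.** Put $q=e^{2\pi\sqrt{-1}\tau}$ ($\Im\tau>0$), $\zeta=e^{2\pi\sqrt{-1}\sigma}$ ($\sigma\in\mathbb C$), $\zeta^a:=e^{2\pi\sqrt{-1}a\sigma}$, and with $t=e^{2\pi\sqrt{-1}z}$, $$\phi_{st}(z,\tau,\sigma)=\frac{1-\zeta t}{(1-\zeta)(1-t)}\prod_{k\ge1}\frac{(1-q^k)^2(1-\zeta tq^k)(1-\zeta^{-1}t^{-1}q^k)}{(1-\zeta q^k)(1-\zeta^{-1}q^k)(1-tq^k)(1-t^{-1}q^k)}.$$ The (stabilized) orbifold elliptic genus is the function of $w\in L_{\mathbb C}$ $$\hat\varphi_{st}(\Delta,\mathcal V,\xi)(w)=\sum_{I\in\Sigma^{(n)}}\frac{w(I)}{|H_I|}\sum_{(h_1,h_2)\in H_I\times H_I}\prod_{i\in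 I}\zeta^{d_i\langle u_i^I,v(h_1)\rangle}\phi_{st}\bigl(\langle u_i^I,-w+\tau v(h_1)-v(h_2)\rangle,\tau,d_i\sigma\bigr),$$ where $v(h)\in L$ is any representative of $h\in H_I$ (the expression does not depend on the choices). It is understood that $d_i\sigma\notin\mathbb Z+\mathbb Z\tau$ for all coefficients $d_i$ of the divisors involved, so that the expressions are defined. **Birational morphisms.** A birational morphism $f:\Delta'\to\Delta$, where $\Delta'=(\Sigma',C',w'^\pm)$ is a simplicial multi-fan in the same lattice $L$, is given by the following conditions. a) There is an injection $\kappa:\Sigma^{(1)}\to\Sigma'^{(1)}$ satisfying $C(i)=C'(\kappa(i))$ for each $i\in\Sigma^{(1)}$. b) For each $J'\in\Sigma'$ there is a simplex $J\in\Sigma$ such that $C'(J')\subset C(J)$. Moreover, for each $J\in\Sigma$, the collection $\{C'(J')\mid J'\in\Sigma',\ C'(J')\subset C(J)\}$ gives a subdivision of the cone $C(J)$. The minimal simplex $J\in\Sigma$ such that $C'(J')\subset C(J)$ is denoted $f(J')$. c) $w'^\pm(I')=w^\pm(f(I'))$ for $I'\in\Sigma'^{(n)}$. **Pull-back.** For $\mathcal V'=\{v_{i'}\}_{i'\in\Sigma'^{(1)}}$ write uniquely $v_{i'}=\sum_{i\in f(i')}a_{i'i}v_i$ with $a_{i'i}\in\mathbb Q_{>0}$, and put $a_{i'i}=0$ for $i\notin f(i')$. Then $f^*:H_T^2(\Delta,\mathcal V)\otimes\mathbb Q\to H_T^2(\Delta',\mathcal V')\otimes\mathbb Q$ is the linear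 map with $f^*(x_i)=\sum_{i'\in\Sigma'^{(1)}}a_{i'i}x_{i'}$. *)

theory Defs
  imports "HOL-Analysis.Analysis" "HOL-Computational_Algebra.Group_Closure"
begin

section \<open>Lattices and cones\<close>

text \<open>A lattice of rank \<open>n\<close> is the subgroup generated by \<open>n\<close> linearly independent vectors. The
  ambient space may be larger, so that every rank, including \<open>0\<close>, is covered; \<open>span L\<close> plays the
  role of the real vector space spanned by \<open>L\<close>.\<close>

definition lattice_of_rank :: "'a::euclidean_space set \<Rightarrow> nat \<Rightarrow> bool" where
  "lattice_of_rank L n \<longleftrightarrow> (\<exists>B. independent B \<and> card B = n \<and> L = group_closure B)"

definition rational_polyhedral_cone :: "'a::euclidean_space set \<Rightarrow> 'a set \<Rightarrow> bool" where
  "rational_polyhedral_cone L K \<longleftrightarrow> (\<exists>S. finite S \<and> S \<subseteq> L \<and> K = convex_cone hull S)"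

definition strongly_convex :: "'a::euclidean_space set \<Rightarrow> bool" where
  "strongly_convex K \<longleftrightarrow> K \<inter> uminus ` K = {0}"

text \<open>The library regards the empty set as a face of every convex set; in the theory of cones it
  is not one.\<close>

definition cone_faces :: "'a::euclidean_space set \<Rightarrow> 'a set set" where
  "cone_faces K = {F. F face_of K \<and> F \<noteq> {}}"

section \<open>Simplicial multi-fans\<close>

record ('v, 'a) multifan =
  mf_simplices :: "'v set set"
  mf_cone :: "'v set \<Rightarrow> 'a set"
  mf_wplus :: "'v set \<Rightarrow> nat"
  mf_wminus :: "'v set \<Rightarrow> nat"

definition simplices_of_card :: "('v, 'a) multifan \<Rightarrow> nat \<Rightarrow> 'v set set" where
  "simplices_of_card \<Delta> k = {J \<in> mf_simplices \<Delta>. card J = k}"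

definition mf_vertices :: "('v, 'a) multifan \<Rightarrow> 'v set" where
  "mf_vertices \<Delta> = {i. {i} \<in> mf_simplices \<Delta>}"

definition mf_weight :: "('v, 'a) multifan \<Rightarrow> 'v set \<Rightarrow> int" where
  "mf_weight \<Delta> I = int (mf_wplus \<Delta> I) - int (mf_wminus \<Delta> I)"

definition simplicial_multifan ::
  "'a::euclidean_space set \<Rightarrow> nat \<Rightarrow> ('v, 'a) multifan \<Rightarrow> bool" where
  "simplicial_multifan L n \<Delta> \<longleftrightarrow>
     finite (mf_simplices \<Delta>) \<and>
     (\<forall>J\<in>mf_simplices \<Delta>. finite J \<and> card J \<le> n) \<and>
     {} \<in> mf_simplices \<Delta> \<and>
     (\<forall>J\<in>mf_simplices \<Delta>. \<forall>K. K \<subseteq> J \<longrightarrow> K \<in> mf_simplices \<Delta>) \<and>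
     simplices_of_card \<Delta> n \<noteq> {} \<and>
     (\<forall>J\<in>mf_simplices \<Delta>. \<exists>I\<in>simplices_of_card \<Delta> n. J \<subseteq> I) \<and>
     (\<forall>J\<in>mf_simplices \<Delta>.
        rational_polyhedral_cone L (mf_cone \<Delta> J) \<and> strongly_convex (mf_cone \<Delta> J) \<and>
        dim (mf_cone \<Delta> J) = card J) \<and>
     mf_cone \<Delta> {} = {0} \<and>
     (\<forall>I\<in>mf_simplices \<Delta>.
        bij_betw (mf_cone \<Delta>) (Pow I) (cone_faces (mf_cone \<Delta> I)) \<and>
        (\<forall>J\<in>Pow I. \<forall>K\<in>Pow I. J \<subseteq> K \<longleftrightarrow> mf_cone \<Delta> J \<subseteq> mf_cone \<Delta> K))"

definition edge_vectors ::
  "'a::euclidean_space set \<Rightarrow> ('v, 'a) multifan \<Rightarrow> ('v \<Rightarrow> 'a) \<Rightarrow> bool" where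
  "edge_vectors L \<Delta> v \<longleftrightarrow>
     (\<forall>i\<in>mf_vertices \<Delta>. v i \<noteq> 0 \<and> v i \<in> L \<and> v i \<in> mf_cone \<Delta> {i})"

text \<open>For a maximal simplex \<open>I\<close>, the dual basis vector belonging to \<open>i \<in> I\<close> is the coordinate
  function on \<open>span L = span (v ` I)\<close> with respect to the basis vector \<open>v i\<close>.\<close>

definition dual_basis :: "('v \<Rightarrow> 'a::euclidean_space) \<Rightarrow> 'v set \<Rightarrow> 'v \<Rightarrow> 'a \<Rightarrow> real" where
  "dual_basis v I i x = representation (v ` I) x (v i)"

definition quotient_group ::
  "'a::euclidean_space set \<Rightarrow> ('v \<Rightarrow> 'a) \<Rightarrow> 'v set \<Rightarrow> 'a set set" where
  "quotient_group L v I = L // {(x, y). x \<in> L \<and> y \<in> L \<and> x - y \<in> group_closure (v ` I)}"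

definition coset_rep :: "'a set \<Rightarrow> 'a" where
  "coset_rep h = (SOME x. x \<in> h)"

section \<open>The orbifold elliptic genus\<close>

text \<open>A pair \<open>(x, y)\<close> of vectors stands for the vector \<open>x + \<i> y\<close> of the complexification, and
  \<open>ctensor c x\<close> for \<open>c \<otimes> x\<close>.\<close>

definition ctensor :: "complex \<Rightarrow> 'a::real_vector \<Rightarrow> 'a \<times> 'a" where
  "ctensor c x = (Re c *\<^sub>R x, Im c *\<^sub>R x)"

definition cpairing :: "('a \<Rightarrow> real) \<Rightarrow> 'a \<times> 'a \<Rightarrow> complex" where
  "cpairing u w = Complex (u (fst w)) (u (snd w))"

definition cexp :: "complex \<Rightarrow> complex" where
  "cexp z = exp (2 * of_real pi * \<i> * z)"

definition phi_st :: "complex \<Rightarrow> complex \<Rightarrow> complex \<Rightarrow> complex" where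
  "phi_st z \<tau> \<sigma> =
     (let t = cexp z; q = cexp \<tau>; \<zeta> = cexp \<sigma> in
       (1 - \<zeta> * t) / ((1 - \<zeta>) * (1 - t)) *
       prodinf (\<lambda>k.
         (1 - q ^ Suc k)\<^sup>2 * (1 - \<zeta> * t * q ^ Suc k) * (1 - inverse \<zeta> * inverse t * q ^ Suc k) /
         ((1 - \<zeta> * q ^ Suc k) * (1 - inverse \<zeta> * q ^ Suc k) *
          (1 - t * q ^ Suc k) * (1 - inverse t * q ^ Suc k))))"

definition period_lattice :: "complex \<Rightarrow> complex set" where
  "period_lattice \<tau> = {of_int a + of_int b * \<tau> | a b. True}"

text \<open>The divisor with coefficients \<open>d i\<close> at the vertices \<open>i\<close> is given by the function \<open>d\<close>, whose
  values elsewhere are irrelevant: in degree two there are no relations in the Stanley-Reisner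
  ring, so that the generators \<open>x\<^sub>i\<close> form a basis.\<close>

definition orbifold_elliptic_genus ::
  "'a::euclidean_space set \<Rightarrow> nat \<Rightarrow> ('v, 'a) multifan \<Rightarrow> ('v \<Rightarrow> 'a) \<Rightarrow> ('v \<Rightarrow> rat) \<Rightarrow>
   complex \<Rightarrow> complex \<Rightarrow> 'a \<times> 'a \<Rightarrow> complex" where
  "orbifold_elliptic_genus L n \<Delta> v d \<tau> \<sigma> w =
     (\<Sum>I\<in>simplices_of_card \<Delta> n.
        of_int (mf_weight \<Delta> I) / of_nat (card (quotient_group L v I)) *
        (\<Sum>(h1, h2)\<in>quotient_group L v I \<times> quotient_group L v I.
           \<Prod>i\<in>I.
             cexp (of_rat (d i) * of_real (dual_basis v I i (coset_rep h1)) * \<sigma>) *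
             phi_st
               (cpairing (dual_basis v I i)
                  (- w + ctensor \<tau> (coset_rep h1) - ctensor 1 (coset_rep h2)))
               \<tau> (of_rat (d i) * \<sigma>)))"

text \<open>The genus is a meromorphic function of \<open>w\<close>. The following condition says that \<open>w\<close> is not on
  any of the (countably many, locally finite) polar hyperplanes of the individual summands.\<close>

definition genus_regular_at ::
  "'a::euclidean_space set \<Rightarrow> nat \<Rightarrow> ('v, 'a) multifan \<Rightarrow> ('v \<Rightarrow> 'a) \<Rightarrow>
   complex \<Rightarrow> 'a \<times> 'a \<Rightarrow> bool" where
  "genus_regular_at L n \<Delta> v \<tau> w \<longleftrightarrow>
     (\<forall>I\<in>simplices_of_card \<Delta> n. \<forall>i\<in>I. \<forall>a\<in>L. \<forall>b\<in>L.
        cpairing (dual_basis v I i) (- w + ctensor \<tau> a - ctensor 1 b) \<notin> period_lattice \<tau>)"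

section \<open>Birational morphisms and pull-back of divisors\<close>

text \<open>The family of cones is indexed by \<open>S\<close>, and distinct indices have distinct cones: otherwise
  several copies of the same subdivision would be admitted.\<close>

definition subdivides :: "('u set \<Rightarrow> 'a::euclidean_space set) \<Rightarrow> 'u set set \<Rightarrow> 'a set \<Rightarrow> bool" where
  "subdivides C S K \<longleftrightarrow>
     inj_on C S \<and>
     (\<forall>J\<in>S. cone_faces (C J) \<subseteq> C ` S) \<and>
     (\<forall>J1\<in>S. \<forall>J2\<in>S. C J1 \<inter> C J2 \<in> cone_faces (C J1) \<inter> cone_faces (C J2)) \<and>
     (\<Union>J\<in>S. C J) = K"

text \<open>\<open>f J\<close> is the minimal simplex whose cone contains the cone of \<open>J\<close>, that is, the least element
  of the set of all such simplices.\<close>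

definition birational_morphism ::
  "nat \<Rightarrow> ('u, 'a::euclidean_space) multifan \<Rightarrow> ('v, 'a) multifan \<Rightarrow>
   ('v \<Rightarrow> 'u) \<Rightarrow> ('u set \<Rightarrow> 'v set) \<Rightarrow> bool" where
  "birational_morphism n \<Delta>' \<Delta> \<kappa> f \<longleftrightarrow>
     (inj_on \<kappa> (mf_vertices \<Delta>) \<and> \<kappa> ` mf_vertices \<Delta> \<subseteq> mf_vertices \<Delta>' \<and>
      (\<forall>i\<in>mf_vertices \<Delta>. mf_cone \<Delta> {i} = mf_cone \<Delta>' {\<kappa> i})) \<and>
     (\<forall>J'\<in>mf_simplices \<Delta>'.
        f J' \<in> mf_simplices \<Delta> \<and> mf_cone \<Delta>' J' \<subseteq> mf_cone \<Delta> (f J') \<and>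
        (\<forall>J\<in>mf_simplices \<Delta>. mf_cone \<Delta>' J' \<subseteq> mf_cone \<Delta> J \<longrightarrow> f J' \<subseteq> J)) \<and>
     (\<forall>J\<in>mf_simplices \<Delta>.
        subdivides (mf_cone \<Delta>')
          {J' \<in> mf_simplices \<Delta>'. mf_cone \<Delta>' J' \<subseteq> mf_cone \<Delta> J} (mf_cone \<Delta> J)) \<and>
     (\<forall>I'\<in>simplices_of_card \<Delta>' n.
        mf_wplus \<Delta>' I' = mf_wplus \<Delta> (f I') \<and> mf_wminus \<Delta>' I' = mf_wminus \<Delta> (f I'))"

definition pullback_coeffs ::
  "('u set \<Rightarrow> 'v set) \<Rightarrow> ('v \<Rightarrow> 'a::euclidean_space) \<Rightarrow> ('u \<Rightarrow> 'a) \<Rightarrow> 'u \<Rightarrow> 'v \<Rightarrow> rat" where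
  "pullback_coeffs f v v' i' =
     (THE a. v' i' = (\<Sum>i\<in>f {i'}. of_rat (a i) *\<^sub>R v i) \<and>
             (\<forall>i\<in>f {i'}. a i > 0) \<and> (\<forall>i. i \<notin> f {i'} \<longrightarrow> a i = 0))"

definition pullback_divisor ::
  "('v, 'a::euclidean_space) multifan \<Rightarrow> ('u set \<Rightarrow> 'v set) \<Rightarrow> ('v \<Rightarrow> 'a) \<Rightarrow> ('u \<Rightarrow> 'a) \<Rightarrow>
   ('v \<Rightarrow> rat) \<Rightarrow> 'u \<Rightarrow> rat" where
  "pullback_divisor \<Delta> f v v' d i' = (\<Sum>i\<in>mf_vertices \<Delta>. d i * pullback_coeffs f v v' i' i)"

end

theory Submission
  imports Defs "HOL-Complex_Analysis.Complex_Analysis"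
begin

text \<open>By Kronecker's formula, for \<open>|q| < |t| < 1\<close> the function \<open>\<phi>\<^sub>s\<^sub>t\<close> equals
  \<open>\<Sum>\<^sub>k t\<^sup>k / (1 - \<zeta> q\<^sup>k)\<close>, summed over all integers. Write \<open>y = - Im w / Im \<tau>\<close>. If
  \<open>y + L\<close> meets none of the walls of the cones, the representatives of \<open>H\<^sub>I\<close> can be chosen so that
  every factor lies in the region of validity of this formula. Multiplying out and averaging over
  \<open>h\<^sub>2\<close> expresses the summand of \<open>I\<close> as a Fourier series over the dual lattice of \<open>L\<close>, whose
  coefficient at \<open>m\<close> is the generating function of the lattice points of the shifted cone
  \<open>C(I) - y\<close>, evaluated at the character \<open>\<zeta>\<^sup>\<ell> q\<^sup>m\<close>, where \<open>\<ell>\<close> is the linear function with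
  \<open>\<ell>(v\<^sub>i) = d\<^sub>i\<close>. Pulling back the divisor does not change \<open>\<ell>\<close>, and since no lattice point lies on a
  wall, the lattice points of \<open>C(I) - y\<close> are the disjoint union of those of the shifted cones of the
  subdivision. So the coefficients agree, first for characters for which the generating functions
  converge and then for all characters by analytic continuation. The remaining \<open>w\<close> follow by
  continuity.\<close>

text \<open>The summands of different maximal simplices involve different sublattices, groups
  \<open>H_I\<close> and poles, so they cannot be compared factor by factor. Their Fourier series,
  however, all run over the same dual lattice, which leaves one identity for each \<open>m\<close>.
  Since \<open>m\<close> runs through the whole dual lattice, its character is in general not small
  on the cone, and the sums over lattice points diverge. What survives is the rational expression
  \<open>cone_series\<close>: its denominators are \<open>1 - cexp (d_i \<sigma> + k \<tau>)\<close>
  with integral \<open>k\<close>, and they do not vanish because \<open>d_i \<sigma>\<close> is not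
  in \<open>period_lattice \<tau>\<close>. The continuation deforms the linear function in the
  exponent and not \<sigma>: the coefficients of the divisor may have different signs, so there need
  not be a \<sigma> for which all the geometric series converge. The generic shift \<open>y\<close>
  replaces an inclusion-exclusion over the common faces of the subdividing cones. Only the imaginary
  part of \<open>w\<close> decides whether \<open>y\<close> is generic, so moving \<open>w\<close>
  along a real line in an imaginary direction suffices for the last limit.\<close>

text \<open>Absolutely convergent sums are integrals for the counting measure, so Lebesgue's theorem
  applies. Needed for the limit in \<open>kronecker_qpoch\<close>.\<close>

lemma dominated_convergence_infsum:
  fixes F :: "nat \<Rightarrow> 'b \<Rightarrow> complex"
  assumes M: "M summable_on A"
    and bound: "\<And>n x. x \<in> A \<Longrightarrow> norm (F n x) \<le> M x"
    and lim: "\<And>x. x \<in> A \<Longrightarrow> (\<lambda>n. F n x) \<longlonglongrightarrow> G x"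
  shows "(\<lambda>n. infsum (F n) A) \<longlonglongrightarrow> infsum G A"
proof -
  have M0: "M x \<ge> 0" if "x \<in> A" for x
    using bound[OF that, of 0] norm_ge_zero order_trans by blast
  have Gb: "norm (G x) \<le> M x" if "x \<in> A" for x
    by (rule tendsto_upperbound[OF tendsto_norm[OF lim[OF that]]]) (use bound that in auto)
  have intM: "integrable (count_space A) M"
  proof -
    have "(\<lambda>x. norm (M x)) summable_on A"
      using M M0 by (simp cong: summable_on_cong)
    then show ?thesis
      using abs_summable_equivalent[of M A] by (simp add: Infinite_Set_Sum.abs_summable_on_def)
  qed
  have L: "(\<lambda>n. integral\<^sup>L (count_space A) (F n)) \<longlonglongrightarrow> integral\<^sup>L (count_space A) G"
    by (rule integral_dominated_convergence[where w = M]) (use intM bound lim in auto)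
  have conv: "integral\<^sup>L (count_space A) h = infsum h A" if "\<And>x. x \<in> A \<Longrightarrow> norm (h x) \<le> M x"
    for h :: "'b \<Rightarrow> complex"
  proof -
    have "(\<lambda>x. norm (h x)) summable_on A"
      by (rule Infinite_Sum.abs_summable_on_comparison_test'[OF M]) (use that in auto)
    then show ?thesis
      using abs_summable_equivalent[of h A] infsetsum_infsum[of h A] by (simp add: infsetsum_def)
  qed
  show ?thesis
    using L by (simp add: conv[OF Gb] conv[OF bound])
qed

section \<open>Kronecker's formula\<close>

text \<open>As a function of \<open>x\<close> the product has simple poles at the points
  \<open>1 / a k\<close> and tends to \<open>t ^ card S\<close> at infinity; the coefficient of
  \<open>k\<close> is what the remaining factors contribute at \<open>x = 1 / a k\<close>. The
  induction verifies this algebraically.\<close>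

lemma prod_ratio_partial_fractions:
  fixes a :: "'b \<Rightarrow> complex" and t x :: complex
  assumes "finite S" "inj_on a S" "\<And>k. k \<in> S \<Longrightarrow> a k \<noteq> 0" "\<And>k. k \<in> S \<Longrightarrow> 1 - x * a k \<noteq> 0"
  shows "(\<Prod>j\<in>S. (1 - t * x * a j) / (1 - x * a j)) =
    t ^ card S + (\<Sum>k\<in>S. (1 - t) * (\<Prod>j\<in>S-{k}. (a k - t * a j) / (a k - a j)) / (1 - x * a k))"
  using assms
proof (induction S arbitrary: x rule: finite_induct)
  case empty
  then show ?case by simp
next
  case (insert b S)
  define A where "A = (\<lambda>k. (1 - t) * (\<Prod>j\<in>S-{k}. (a k - t * a j) / (a k - a j)))"
  have ab: "a b \<noteq> 0" and xb: "1 - x * a b \<noteq> 0" using insert.prems by auto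
  have kb: "a k - a b \<noteq> 0" "a k \<noteq> 0" "1 - x * a k \<noteq> 0" if "k \<in> S" for k
    using insert.prems insert.hyps that by (auto simp: inj_on_def)
  have IHx: "(\<Prod>j\<in>S. (1 - t * x * a j) / (1 - x * a j)) = t ^ card S + (\<Sum>k\<in>S. A k / (1 - x * a k))"
    unfolding A_def using insert by auto
  \<comment> \<open>The induction hypothesis at \<open>1 / a b\<close> evaluates the old product at
    the new pole, which is the coefficient of \<open>b\<close>. For this reason \<open>x\<close> is
    generalized.\<close>
  have "(\<Prod>j\<in>S. (1 - t * (1 / a b) * a j) / (1 - (1 / a b) * a j)) =
      t ^ card S + (\<Sum>k\<in>S. A k / (1 - (1 / a b) * a k))"
    unfolding A_def
  proof (rule insert.IH)
    show "1 - 1 / a b * a k \<noteq> 0" if "k \<in> S" for k using kb[OF that] ab by (auto simp: field_simps)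
  qed (use insert in auto)
  moreover have "(1 - t * (1 / a b) * a j) / (1 - (1 / a b) * a j) = (a b - t * a j) / (a b - a j)"
    if "j \<in> S" for j using ab kb[OF that] by (simp add: divide_simps)
  moreover have "A k / (1 - (1 / a b) * a k) = A k * a b / (a b - a k)"
    if "k \<in> S" for k using ab kb[OF that] by (simp add: divide_simps)
  ultimately have IHb: "(\<Prod>j\<in>S. (a b - t * a j) / (a b - a j)) =
      t ^ card S + (\<Sum>k\<in>S. A k * a b / (a b - a k))" by (simp cong: prod.cong sum.cong)
  have Ak: "(1 - t) * (\<Prod>j\<in>insert b S-{k}. (a k - t * a j) / (a k - a j)) =
      A k * ((a k - t * a b) / (a k - a b))" if "k \<in> S" for k
  proof -
    have "insert b S - {k} = insert b (S - {k})" using that insert.hyps by auto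
    then show ?thesis using insert.hyps by (simp add: A_def)
  qed
  \<comment> \<open>The new factor times one old fraction has two simple poles; its parts correct
    the coefficient of \<open>k\<close> and contribute to that of \<open>b\<close>.\<close>
  have split: "A k * ((a k - t * a b) / (a k - a b)) / (1 - x * a k)
      + (1 - t) * (A k * a b / (a b - a k)) / (1 - x * a b) =
      (1 - t * x * a b) / (1 - x * a b) * (A k / (1 - x * a k))"
    if "k \<in> S" for k
  proof -
    have e: "A k * a b / (a b - a k) = - (A k * a b / (a k - a b))"
      by (metis minus_diff_eq divide_minus_right)
    show ?thesis unfolding e using kb[OF that] xb
      by (simp add: divide_simps) (simp add: algebra_simps)
  qed
  have "(\<Prod>j\<in>insert b S. (1 - t * x * a j) / (1 - x * a j)) =
     (1 - t * x * a b) / (1 - x * a b) * (t ^ card S + (\<Sum>k\<in>S. A k / (1 - x * a k)))"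
    using insert.hyps IHx by simp
  also have "\<dots> = (t + (1 - t) / (1 - x * a b)) * t ^ card S
      + (\<Sum>k\<in>S. (1 - t * x * a b) / (1 - x * a b) * (A k / (1 - x * a k)))"
  proof -
    have "(1 - t * x * a b) / (1 - x * a b) = t + (1 - t) / (1 - x * a b)"
      using xb by (simp add: divide_simps) (simp add: algebra_simps)
    then show ?thesis by (simp only: distrib_left sum_distrib_left)
  qed
  also have "\<dots> = t ^ Suc (card S) + (1 - t) / (1 - x * a b) * t ^ card S
      + (\<Sum>k\<in>S. A k * ((a k - t * a b) / (a k - a b)) / (1 - x * a k)
      + (1 - t) * (A k * a b / (a b - a k)) / (1 - x * a b))"
    using split by (simp add: distrib_right)
  also have "\<dots> = t ^ Suc (card S) +
      ((1 - t) * (\<Prod>j\<in>S. (a b - t * a j) / (a b - a j)) / (1 - x * a b)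
      + (\<Sum>k\<in>S. A k * ((a k - t * a b) / (a k - a b)) / (1 - x * a k)))"
  proof -
    have "(\<Sum>k\<in>S. (1 - t) * (A k * a b / (a b - a k)) / (1 - x * a b)) =
        (1 - t) * (\<Sum>k\<in>S. A k * a b / (a b - a k)) / (1 - x * a b)"
      by (simp only: sum_distrib_left sum_divide_distrib)
    moreover have e: "(1 - t) / (1 - x * a b) * t ^ card S + (1 - t) * B / (1 - x * a b) =
        (1 - t) * (t ^ card S + B) / (1 - x * a b)" for B
      by (simp add: distrib_left add_divide_distrib)
    ultimately show ?thesis
      unfolding IHb e[symmetric] sum.distrib by (simp only: add_ac)
  qed
  also have "(\<Sum>k\<in>S. A k * ((a k - t * a b) / (a k - a b)) / (1 - x * a k)) =
      (\<Sum>k\<in>S. (1 - t) * (\<Prod>j\<in>insert b S-{k}. (a k - t * a j) / (a k - a j)) / (1 - x * a k))"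
    by (intro sum.cong refl) (simp only: Ak)
  finally show ?case
    using insert.hyps by simp
qed

section \<open>Infinite q-products and the Jacobi theta function\<close>

text \<open>In standard notation this is \<open>(x q; q)_n\<close>. The exponents start at 1, as in
  the product defining \<open>phi_st\<close>, and \<open>x = 1\<close> gives
  \<open>(q; q)_n\<close>.\<close>

definition qpoch :: "complex \<Rightarrow> complex \<Rightarrow> nat \<Rightarrow> complex" where
  "qpoch q x n = (\<Prod>k<n. 1 - x * q ^ Suc k)"

definition qpoch_inf :: "complex \<Rightarrow> complex \<Rightarrow> complex" where
  "qpoch_inf q x = prodinf (\<lambda>k. 1 - x * q ^ Suc k)"

text \<open>The Jacobi triple product without the factor \<open>qpoch_inf q 1\<close> and without a
  monomial in front.\<close>

definition jacobi_theta :: "complex \<Rightarrow> complex \<Rightarrow> complex" where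
  "jacobi_theta q x = (1 - x) * qpoch_inf q x * qpoch_inf q (inverse x)"

context
  fixes q :: complex
  assumes q: "norm q < 1"
begin

lemma convergent_prod_qpoch: "convergent_prod (\<lambda>k. 1 - x * q ^ Suc k)"
proof -
  have "summable (\<lambda>k. norm (1 - x * q ^ Suc k - 1))"
    using summable_mult[OF summable_geometric[of "norm q"], of "norm x * norm q"] q
    by (simp add: norm_mult norm_power mult.assoc)
  then show ?thesis
    by (intro abs_convergent_prod_imp_convergent_prod summable_imp_abs_convergent_prod)
qed

lemma qpoch_LIMSEQ: "qpoch q x \<longlonglongrightarrow> qpoch_inf q x"
  using convergent_prod_LIMSEQ[OF convergent_prod_qpoch]
  unfolding qpoch_def qpoch_inf_def
  by (simp add: LIMSEQ_lessThan_iff_atMost)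

lemma qpoch_inf_shift: "qpoch_inf q x = (1 - x * q) * qpoch_inf q (x * q)"
proof -
  have "(\<lambda>n. qpoch q x (Suc n)) \<longlonglongrightarrow> qpoch_inf q x"
    using qpoch_LIMSEQ by (rule LIMSEQ_Suc)
  moreover have "qpoch q x (Suc n) = (1 - x * q) * qpoch q (x * q) n" for n
    unfolding qpoch_def by (subst prod.lessThan_Suc_shift) (simp add: mult_ac)
  ultimately show ?thesis
    using tendsto_mult[OF tendsto_const[of "1 - x * q"] qpoch_LIMSEQ[of "x * q"]]
    by (simp only: LIMSEQ_unique)
qed

lemma qpoch_inf_nonzero: "(\<And>k. x * q ^ Suc k \<noteq> 1) \<Longrightarrow> qpoch_inf q x \<noteq> 0"
  unfolding qpoch_inf_def by (rule prodinf_nonzero[OF convergent_prod_qpoch]) auto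

text \<open>The shift removes the factor \<open>1 - x\<close> and brings in
  \<open>1 - inverse x\<close>; their quotient is \<open>- 1 / x\<close>.\<close>

lemma jacobi_theta_shift:
  assumes "q \<noteq> 0" "x \<noteq> 0"
  shows "jacobi_theta q (x * q) = - jacobi_theta q x / x"
proof -
  have "jacobi_theta q (x * q) = qpoch_inf q x * qpoch_inf q (inverse (x * q))"
    unfolding jacobi_theta_def using qpoch_inf_shift[of x] by simp
  also have "qpoch_inf q (inverse (x * q)) = (1 - inverse x) * qpoch_inf q (inverse x)"
    using qpoch_inf_shift[of "inverse (x * q)"] assms by (simp add: mult.assoc)
  finally show ?thesis using assms unfolding jacobi_theta_def by (simp add: field_simps)
qed

lemma isCont_qpoch_inf: "isCont (qpoch_inf q) x"
proof -
  \<comment> \<open>The radius makes \<open>x\<close> an interior point. On this ball the M-test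
    gives uniform convergence of the partial products, hence a continuous limit.\<close>
  define A where "A = cball (0::complex) (norm x + 1)"
  have lt: "uniform_limit A (\<lambda>N x. qpoch q x N) (qpoch_inf q) sequentially"
  proof -
    have "uniformly_convergent_on A (\<lambda>N x. \<Sum>k<N. norm (1 - x * q ^ Suc k - 1))"
    proof (rule Weierstrass_m_test'_ev)
      show "\<forall>\<^sub>F k in sequentially. \<forall>x'\<in>A. norm (norm (1 - x' * q ^ Suc k - 1)) \<le> (norm x + 1) * norm q ^ Suc k"
        by (auto simp: A_def norm_mult norm_power intro!: mult_right_mono always_eventually)
      show "summable (\<lambda>k. (norm x + 1) * norm q ^ Suc k)"
        using summable_mult[OF summable_geometric[of "norm q"], of "(norm x + 1) * norm q"] q
        by (simp add: mult.assoc)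
    qed
    then have "uniformly_convergent_on A (\<lambda>N x. \<Prod>k<N. 1 - x * q ^ Suc k)"
      by (intro uniformly_convergent_on_prod') (auto simp: A_def intro!: continuous_intros)
    then have "uniformly_convergent_on A (\<lambda>N x. qpoch q x N)"
      by (simp only: qpoch_def)
    then obtain l where l: "uniform_limit A (\<lambda>N x. qpoch q x N) l sequentially"
      unfolding uniformly_convergent_on_def by blast
    have "l x' = qpoch_inf q x'" if "x' \<in> A" for x'
      using LIMSEQ_unique[OF tendsto_uniform_limitI[OF l that] qpoch_LIMSEQ[of x']] .
    then show ?thesis
      using l uniform_limit_cong'[of A "\<lambda>N x. qpoch q x N" "\<lambda>N x. qpoch q x N" l "qpoch_inf q" sequentially]
      by blast
  qed
  have "continuous_on A (\<lambda>x. qpoch q x N)" for N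
    unfolding qpoch_def by (intro continuous_intros)
  then have "continuous_on A (qpoch_inf q)"
    using uniform_limit_theorem[OF always_eventually[OF allI] lt trivial_limit_sequentially] by blast
  moreover have "x \<in> interior A"
    unfolding A_def interior_cball by simp
  ultimately show ?thesis by (rule continuous_on_interior)
qed

end

section \<open>Partial fractions with poles at powers of q, and their limit\<close>

text \<open>Seen from the pole \<open>k\<close>, the interval from \<open>- N\<close> to
  \<open>N\<close> has \<open>A = N + k\<close> indices below and \<open>B = N - k\<close> above;
  the two products become finite q-products.\<close>

lemma prod_int_interval_remove:
  fixes F :: "int \<Rightarrow> 'b::comm_monoid_mult"
  shows "(\<Prod>j\<in>{k - int A..k + int B} - {k}. F j) =
    (\<Prod>m<B. F (k + int (Suc m))) * (\<Prod>m<A. F (k - int (Suc m)))"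
proof -
  have eq: "{k - int A..k + int B} - {k} = (\<lambda>m. k + int (Suc m)) ` {..<B} \<union> (\<lambda>m. k - int (Suc m)) ` {..<A}"
    (is "?L = ?P \<union> ?M")
  proof
    show "?L \<subseteq> ?P \<union> ?M"
    proof
      fix j assume j: "j \<in> ?L"
      show "j \<in> ?P \<union> ?M"
      proof (cases "j > k")
        case True
        then have "j = k + int (Suc (nat (j - k - 1)))" "nat (j - k - 1) < B" using j by auto
        then show ?thesis by blast
      next
        case False
        then have "j = k - int (Suc (nat (k - j - 1)))" "nat (k - j - 1) < A" using j by auto
        then show ?thesis by blast
      qed
    qed
  qed auto
  have "prod F ?L = prod F ?P * prod F ?M"
    unfolding eq by (rule prod.union_disjoint) auto
  also have "prod F ?P = (\<Prod>m<B. F (k + int (Suc m)))"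
    by (subst prod.reindex) (auto simp: inj_on_def)
  also have "prod F ?M = (\<Prod>m<A. F (k - int (Suc m)))"
    by (subst prod.reindex) (auto simp: inj_on_def)
  finally show ?thesis .
qed

lemma norm_lt_1_power_neq_1:
  fixes q :: complex
  assumes "norm q < 1"
  shows "q ^ Suc m \<noteq> 1"
proof
  assume "q ^ Suc m = 1"
  then have "norm q ^ Suc m = 1" by (metis norm_one norm_power)
  then show False using power_Suc_less_one[of "norm q" m] assms by (cases "q = 0") auto
qed

lemma power_int_inj_lt_1:
  fixes q :: complex
  assumes q: "q \<noteq> 0" "norm q < 1"
  shows "inj (\<lambda>k. q powi k)"
proof (rule injI)
  have aux: "q powi k \<noteq> q powi j" if "k < j" for k j
  proof
    assume e: "q powi k = q powi j"
    have "q powi (j - k) = 1" using q e by (simp add: power_int_diff)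
    moreover have "j - k = int (Suc (nat (j - k - 1)))" using that by simp
    ultimately show False using norm_lt_1_power_neq_1[OF q(2)] by (metis power_int_of_nat)
  qed
  fix k j assume "q powi k = q powi j"
  then show "k = j" using aux[of k j] aux[of j k] by (metis linorder_neqE)
qed

context
  fixes q t \<zeta> :: complex
  assumes q: "q \<noteq> 0" "norm q < 1" and t0: "t \<noteq> 0" and z0: "\<zeta> \<noteq> 0"
    and zq: "\<And>k. \<zeta> * q powi k \<noteq> 1"
begin

lemma zeta_q_power: "\<zeta> * q ^ m \<noteq> 1" "inverse \<zeta> * q ^ m \<noteq> 1"
proof -
  show "\<zeta> * q ^ m \<noteq> 1" using zq[of "int m"] by simp
  show "inverse \<zeta> * q ^ m \<noteq> 1"
    using zq[of "- int m"] q z0 by (auto simp: power_int_minus field_simps)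
qed

text \<open>The partial fraction expansion for the poles \<open>q\<^sup>-\<^sup>k\<close> with \<open>|k| \<le> N\<close>, divided by \<open>t\<^sup>N\<close>; as \<open>N\<close> tends
  to infinity it becomes Kronecker's formula.\<close>

lemma qpoch_partial_fractions:
  "(1 - \<zeta> * t) / (1 - \<zeta>) * (qpoch q (\<zeta> * t) N * qpoch q (inverse (\<zeta> * t)) N) /
      (qpoch q \<zeta> N * qpoch q (inverse \<zeta>) N) =
   t ^ Suc N + (\<Sum>k\<in>{- int N..int N}. (1 - t) * (t powi k / (1 - \<zeta> * q powi k)) *
     (qpoch q t (nat (int N - k)) / qpoch q 1 (nat (int N - k))) *
     (qpoch q (inverse t) (nat (int N + k)) / qpoch q 1 (nat (int N + k))))"
proof -
  let ?S = "{- int N..int N}"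
  define F where "F = (\<lambda>j. (1 - t * \<zeta> * q powi j) / (1 - \<zeta> * q powi j))"
  have z1: "\<zeta> \<noteq> 1" using zq[of 0] by simp
  have L: "(\<Prod>j\<in>?S. F j) = (1 - \<zeta> * t) / (1 - \<zeta>) *
     (qpoch q (\<zeta> * t) N / qpoch q \<zeta> N) * (t ^ N * (qpoch q (inverse (\<zeta> * t)) N / qpoch q (inverse \<zeta>) N))"
  proof -
    have "(\<Prod>j\<in>?S. F j) = F 0 * (\<Prod>j\<in>{0 - int N..0 + int N} - {0}. F j)"
      by (subst prod.remove[of _ 0]) auto
    also have "\<dots> = F 0 * ((\<Prod>m<N. F (int (Suc m))) * (\<Prod>m<N. F (- int (Suc m))))"
      unfolding prod_int_interval_remove by simp
    also have "(\<Prod>m<N. F (int (Suc m))) = qpoch q (\<zeta> * t) N / qpoch q \<zeta> N"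
      unfolding qpoch_def prod_dividef[symmetric] F_def power_int_of_nat by (simp add: mult_ac)
    \<comment> \<open>For negative exponents, numerator and denominator are rewritten in positive
      powers of \<open>q\<close>. Each of the \<open>N\<close> factors then releases one
      \<open>t\<close>.\<close>
    also have "(\<Prod>m<N. F (- int (Suc m))) =
       (\<Prod>m<N. t * ((1 - inverse (\<zeta> * t) * q ^ Suc m) / (1 - inverse \<zeta> * q ^ Suc m)))"
    proof (rule prod.cong[OF refl])
      fix m
      define Q where "Q = q ^ Suc m"
      have Q: "Q \<noteq> 0" using q by (simp add: Q_def)
      moreover have "\<zeta> \<noteq> Q" using zeta_q_power(2)[of "Suc m"] Q unfolding Q_def by (metis left_inverse)
      ultimately have Q: "Q \<noteq> 0" "\<zeta> \<noteq> Q" .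
      have "F (- int (Suc m)) = (1 - t * \<zeta> / Q) / (1 - \<zeta> / Q)"
        unfolding F_def power_int_minus power_int_of_nat Q_def by (simp add: divide_inverse)
      also have "\<dots> = t * ((1 - inverse (\<zeta> * t) * Q) / (1 - inverse \<zeta> * Q))"
        using Q t0 z0 by (simp add: divide_simps) (simp add: algebra_simps)
      finally show "F (- int (Suc m)) = t * ((1 - inverse (\<zeta> * t) * q ^ Suc m) / (1 - inverse \<zeta> * q ^ Suc m))"
        unfolding Q_def .
    qed
    also have "\<dots> = t ^ N * (qpoch q (inverse (\<zeta> * t)) N / qpoch q (inverse \<zeta>) N)"
      unfolding qpoch_def prod.distrib prod_dividef by simp
    finally show ?thesis by (simp add: F_def mult_ac)
  qed
  \<comment> \<open>The indices below \<open>k\<close> release one \<open>t\<close> each. There are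
    \<open>N + k\<close> of them, which produces the power \<open>t powi k\<close> of Kronecker's
    series next to the common factor \<open>t ^ N\<close>.\<close>
  have A: "(\<Prod>j\<in>?S-{k}. (q powi k - t * q powi j) / (q powi k - q powi j)) =
     t ^ N * t powi k *
     (qpoch q t (nat (int N - k)) / qpoch q 1 (nat (int N - k))) *
     (qpoch q (inverse t) (nat (int N + k)) / qpoch q 1 (nat (int N + k)))" if k: "k \<in> ?S" for k
  proof -
    define A where "A = nat (int N + k)"
    define B where "B = nat (int N - k)"
    have AB: "?S = {k - int A..k + int B}" "int A = int N + k"
      using k by (auto simp: A_def B_def)
    have p: "(q powi k - t * q powi (k + int (Suc m))) / (q powi k - q powi (k + int (Suc m))) =
        (1 - t * q ^ Suc m) / (1 - 1 * q ^ Suc m)" for m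
    proof -
      have e: "q powi (k + int (Suc m)) = q powi k * q ^ Suc m"
        using q by (subst power_int_add) (simp_all only: power_int_of_nat simp_thms)
      have "q powi k - t * q powi (k + int (Suc m)) = q powi k * (1 - t * q ^ Suc m)"
           "q powi k - q powi (k + int (Suc m)) = q powi k * (1 - q ^ Suc m)"
        unfolding e by (simp_all add: algebra_simps)
      then show ?thesis using q by simp
    qed
    have m: "(q powi k - t * q powi (k - int (Suc m))) / (q powi k - q powi (k - int (Suc m))) =
        t * ((1 - inverse t * q ^ Suc m) / (1 - 1 * q ^ Suc m))" for m
    proof -
      define Q where "Q = q ^ Suc m"
      have Q: "Q \<noteq> 0" "Q \<noteq> 1" using q norm_lt_1_power_neq_1[OF q(2)] by (auto simp: Q_def)
      have e: "q powi (k - int (Suc m)) = q powi k / Q"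
        unfolding Q_def using q by (subst power_int_diff) (simp_all only: power_int_of_nat simp_thms)
      have "q powi k - t * q powi (k - int (Suc m)) = q powi k * (1 - t / Q)"
           "q powi k - q powi (k - int (Suc m)) = q powi k * (1 - 1 / Q)"
        unfolding e by (simp_all add: algebra_simps)
      then have "(q powi k - t * q powi (k - int (Suc m))) / (q powi k - q powi (k - int (Suc m))) =
          (1 - t / Q) / (1 - 1 / Q)" using q by simp
      also have "\<dots> = t * ((1 - inverse t * Q) / (1 - 1 * Q))"
        using Q t0 by (simp add: divide_simps) (simp add: algebra_simps)
      finally show ?thesis unfolding Q_def .
    qed
    have "(\<Prod>j\<in>?S-{k}. (q powi k - t * q powi j) / (q powi k - q powi j)) =
      (qpoch q t B / qpoch q 1 B) * (t ^ A * (qpoch q (inverse t) A / qpoch q 1 A))"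
      unfolding AB(1) prod_int_interval_remove p m
      unfolding qpoch_def prod.distrib prod_dividef by simp
    moreover have "t ^ A = t ^ N * t powi k"
      using AB(2) t0 by (metis power_int_add power_int_of_nat)
    ultimately show ?thesis by (simp add: A_def B_def mult_ac)
  qed
  have "(\<Prod>j\<in>?S. F j) = t ^ card ?S +
     (\<Sum>k\<in>?S. (1 - t) * (\<Prod>j\<in>?S-{k}. (q powi k - t * q powi j) / (q powi k - q powi j)) / (1 - \<zeta> * q powi k))"
    unfolding F_def
    by (rule prod_ratio_partial_fractions)
      (use q zq power_int_inj_lt_1[OF q] in \<open>auto simp: inj_on_def\<close>)
  also have "\<dots> = t ^ N * t ^ Suc N + t ^ N * (\<Sum>k\<in>?S. (1 - t) * (t powi k / (1 - \<zeta> * q powi k)) *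
     (qpoch q t (nat (int N - k)) / qpoch q 1 (nat (int N - k))) *
     (qpoch q (inverse t) (nat (int N + k)) / qpoch q 1 (nat (int N + k))))"
    unfolding sum_distrib_left
  proof (intro arg_cong2[where f = "(+)"] sum.cong refl)
    \<comment> \<open>The constant term is \<open>t ^ (2 N + 1)\<close>, so after cancelling the
      common factor \<open>t ^ N\<close> there remains \<open>t ^ Suc N\<close>.\<close>
    have "card ?S = N + Suc N" by simp
    then show "t ^ card ?S = t ^ N * t ^ Suc N" by (simp only: power_add)
  qed (simp add: A mult_ac)
  finally have "t ^ N * ((1 - \<zeta> * t) / (1 - \<zeta>) *
     (qpoch q (\<zeta> * t) N / qpoch q \<zeta> N) * (qpoch q (inverse (\<zeta> * t)) N / qpoch q (inverse \<zeta>) N)) =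
     t ^ N * (t ^ Suc N + (\<Sum>k\<in>?S. (1 - t) * (t powi k / (1 - \<zeta> * q powi k)) *
     (qpoch q t (nat (int N - k)) / qpoch q 1 (nat (int N - k))) *
     (qpoch q (inverse t) (nat (int N + k)) / qpoch q 1 (nat (int N + k)))))"
    unfolding L by (simp add: distrib_left mult_ac)
  then show ?thesis using t0 by (simp add: divide_inverse mult_ac)
qed

text \<open>For \<open>k \<ge> 0\<close> the denominators tend to 1 and the terms are comparable to
  \<open>t ^ k\<close>. For negative \<open>k\<close> the denominator grows like
  \<open>q powi k\<close>, and the terms are comparable to powers of \<open>q / t\<close>. The two
  inequalities serve the two halves.\<close>

lemma kronecker_summable:
  assumes t: "norm q < norm t" "norm t < 1"
  shows "(\<lambda>k. norm (t powi k / (1 - \<zeta> * q powi k))) summable_on (UNIV :: int set)"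
proof -
  let ?f = "\<lambda>k. norm (t powi k / (1 - \<zeta> * q powi k))"
  have q0: "(\<lambda>m. q ^ m) \<longlonglongrightarrow> 0" using q(2) by (rule LIMSEQ_power_zero)
  have U: "(UNIV :: int set) = range int \<union> range (\<lambda>m. - int (Suc m))"
  proof -
    have "k \<in> range int \<union> range (\<lambda>m. - int (Suc m))" for k
    proof (cases "k \<ge> 0")
      case True then show ?thesis by (metis UnI1 nonneg_int_cases rangeI)
    next
      case False
      then have "k = - int (Suc (nat (- k - 1)))" by simp
      then show ?thesis by blast
    qed
    then show ?thesis by blast
  qed
  have 1: "?f summable_on range int"
  proof -
    have "(\<lambda>m. inverse (1 - \<zeta> * q ^ m)) \<longlonglongrightarrow> inverse (1 - \<zeta> * 0)"
      by (intro tendsto_intros q0) simp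
    then have "Bseq (\<lambda>m. inverse (1 - \<zeta> * q ^ m))" by (intro convergent_imp_Bseq convergentI)
    then obtain C where C: "\<And>m. norm (inverse (1 - \<zeta> * q ^ m)) \<le> C" unfolding Bseq_def by auto
    have "summable (\<lambda>m. norm t ^ m * C)" using t by (intro summable_mult2 summable_geometric) simp
    then have s: "(\<lambda>m. norm t ^ m * C) summable_on UNIV"
      using C[of 0] order_trans[OF norm_ge_zero C]
      by (intro norm_summable_imp_summable_on) (simp add: norm_mult norm_power)
    have "(\<lambda>m. norm (t ^ m / (1 - \<zeta> * q ^ m))) summable_on UNIV"
      by (rule Infinite_Sum.abs_summable_on_comparison_test'[OF s])
        (auto simp: norm_mult norm_power divide_inverse norm_inverse[symmetric] simp del: norm_inverse intro!: mult_left_mono C)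
    then show ?thesis by (subst summable_on_reindex) (auto simp: o_def)
  qed
  have 2: "?f summable_on range (\<lambda>m. - int (Suc m))"
  proof -
    have "(\<lambda>m. inverse (q ^ Suc m - \<zeta>)) \<longlonglongrightarrow> inverse (0 - \<zeta>)"
      by (intro tendsto_intros LIMSEQ_Suc[OF q0]) (use z0 in simp)
    then have "Bseq (\<lambda>m. inverse (q ^ Suc m - \<zeta>))" by (intro convergent_imp_Bseq convergentI)
    then obtain C where C: "\<And>m. norm (inverse (q ^ Suc m - \<zeta>)) \<le> C" unfolding Bseq_def by auto
    have "summable (\<lambda>m. norm (q / t) ^ Suc m * C)"
      using t t0 by (intro summable_mult2 summable_ignore_initial_segment[of _ 1, simplified] summable_geometric)
         (simp add: norm_divide)
    then have s: "(\<lambda>m. norm (q / t) ^ Suc m * C) summable_on UNIV"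
      using order_trans[OF norm_ge_zero C]
      by (intro norm_summable_imp_summable_on) (simp add: norm_mult norm_power norm_divide)
    have e: "t powi (- int (Suc m)) / (1 - \<zeta> * q powi (- int (Suc m))) = (q / t) ^ Suc m * inverse (q ^ Suc m - \<zeta>)" for m
    proof -
      have "t powi (- int (Suc m)) = inverse (t ^ Suc m)" "q powi (- int (Suc m)) = inverse (q ^ Suc m)"
        by (simp_all only: power_int_minus power_int_of_nat)
      then show ?thesis using q t0 by (simp only: power_divide) (simp add: divide_simps del: power_Suc)
    qed
    have "(\<lambda>m. norm (t powi (- int (Suc m)) / (1 - \<zeta> * q powi (- int (Suc m))))) summable_on UNIV"
      unfolding e
      by (rule Infinite_Sum.abs_summable_on_comparison_test'[OF s])
        (simp only: norm_mult norm_power mult_left_mono[OF C] zero_le_power norm_ge_zero)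
    then show ?thesis by (subst summable_on_reindex) (auto simp: o_def inj_on_def)
  qed
  show ?thesis
    unfolding U by (rule summable_on_Un_disjoint[OF 1 2]) auto
qed

text \<open>The limit of \<open>qpoch_partial_fractions\<close>: for fixed \<open>k\<close> both
  q-quotients converge, and since they are bounded the series of \<open>kronecker_summable\<close>
  is a majorant.\<close>

lemma kronecker_qpoch:
  assumes t: "norm q < norm t" "norm t < 1"
  shows "(1 - \<zeta> * t) / (1 - \<zeta>) * (qpoch_inf q (\<zeta> * t) * qpoch_inf q (inverse (\<zeta> * t))) /
      (qpoch_inf q \<zeta> * qpoch_inf q (inverse \<zeta>)) =
    (1 - t) * (qpoch_inf q t / qpoch_inf q 1) * (qpoch_inf q (inverse t) / qpoch_inf q 1) *
      infsum (\<lambda>k. t powi k / (1 - \<zeta> * q powi k)) (UNIV :: int set)"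
proof -
  define G where "G = (\<lambda>m. qpoch q t m / qpoch q 1 m)"
  define H where "H = (\<lambda>m. qpoch q (inverse t) m / qpoch q 1 m)"
  define c where "c = (\<lambda>k::int. (1 - t) * (t powi k / (1 - \<zeta> * q powi k)))"
  \<comment> \<open>Extension by zero makes the index set independent of \<open>N\<close>, as
    dominated convergence requires.\<close>
  define F where "F = (\<lambda>N k. if k \<in> {- int N..int N} then c k * G (nat (int N - k)) * H (nat (int N + k)) else 0)"
  note lim = qpoch_LIMSEQ[OF q(2)]
  have nz1: "qpoch_inf q 1 \<noteq> 0"
    by (rule qpoch_inf_nonzero[OF q(2)]) (use norm_lt_1_power_neq_1[OF q(2)] in simp)
  have nzz: "qpoch_inf q \<zeta> \<noteq> 0" "qpoch_inf q (inverse \<zeta>) \<noteq> 0"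
    by (rule qpoch_inf_nonzero[OF q(2)], rule zeta_q_power)+
  have GL: "G \<longlonglongrightarrow> qpoch_inf q t / qpoch_inf q 1"
    and HL: "H \<longlonglongrightarrow> qpoch_inf q (inverse t) / qpoch_inf q 1"
    unfolding G_def H_def by (intro tendsto_divide lim nz1)+
  obtain CG where CG: "\<And>m. norm (G m) \<le> CG"
    using convergent_imp_Bseq[OF convergentI[OF GL]] unfolding Bseq_def by auto
  obtain CH where CH: "\<And>m. norm (H m) \<le> CH"
    using convergent_imp_Bseq[OF convergentI[OF HL]] unfolding Bseq_def by auto
  have C0: "CG \<ge> 0" "CH \<ge> 0" using order_trans[OF norm_ge_zero CG] order_trans[OF norm_ge_zero CH] by auto
  have sc: "(\<lambda>k. norm (1 - t) * CG * CH * norm (t powi k / (1 - \<zeta> * q powi k))) summable_on UNIV"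
    by (intro summable_on_cmult_right kronecker_summable t)
  have tends: "(\<lambda>N. infsum (F N) UNIV) \<longlonglongrightarrow>
      infsum (\<lambda>k. c k * (qpoch_inf q t / qpoch_inf q 1) * (qpoch_inf q (inverse t) / qpoch_inf q 1)) UNIV"
  proof (rule dominated_convergence_infsum[OF sc])
    fix N and k :: int
    have "norm (c k) * norm (G a) * norm (H b) \<le> norm (c k) * CG * CH" for a b
      by (intro mult_mono CG CH) (use C0 in auto)
    then have "norm (c k * G a * H b) \<le> norm (c k) * CG * CH" for a b
      by (simp only: norm_mult)
    then have "norm (F N k) \<le> norm (c k) * CG * CH"
      using C0 by (auto simp: F_def)
    then show "norm (F N k) \<le> norm (1 - t) * CG * CH * norm (t powi k / (1 - \<zeta> * q powi k))"
      unfolding c_def norm_mult by (simp only: mult_ac)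
  next
    fix k :: int
    have inf1: "filterlim (\<lambda>N. nat (int N - k)) at_top sequentially"
      unfolding filterlim_at_top
    proof
      fix Z show "\<forall>\<^sub>F N in sequentially. Z \<le> nat (int N - k)"
        using eventually_ge_at_top[of "Z + nat k"] by eventually_elim auto
    qed
    have inf2: "filterlim (\<lambda>N. nat (int N + k)) at_top sequentially"
      unfolding filterlim_at_top
    proof
      fix Z show "\<forall>\<^sub>F N in sequentially. Z \<le> nat (int N + k)"
        using eventually_ge_at_top[of "Z + nat (- k)"] by eventually_elim auto
    qed
    have ev: "\<forall>\<^sub>F N in sequentially. c k * G (nat (int N - k)) * H (nat (int N + k)) = F N k"
      using eventually_ge_at_top[of "nat \<bar>k\<bar>"] by eventually_elim (auto simp: F_def)
    show "(\<lambda>N. F N k) \<longlonglongrightarrow> c k * (qpoch_inf q t / qpoch_inf q 1) * (qpoch_inf q (inverse t) / qpoch_inf q 1)"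
      by (rule Lim_transform_eventually[OF _ ev])
        (intro tendsto_mult tendsto_const filterlim_compose[OF GL inf1] filterlim_compose[OF HL inf2])
  qed
  have Fs: "infsum (F N) UNIV = (\<Sum>k\<in>{- int N..int N}. c k * G (nat (int N - k)) * H (nat (int N + k)))" for N
  proof -
    have "infsum (F N) UNIV = infsum (\<lambda>k. c k * G (nat (int N - k)) * H (nat (int N + k))) {- int N..int N}"
      by (rule infsum_cong_neutral) (auto simp: F_def)
    then show ?thesis by simp
  qed
  have fin: "(1 - \<zeta> * t) / (1 - \<zeta>) * (qpoch q (\<zeta> * t) N * qpoch q (inverse (\<zeta> * t)) N) /
      (qpoch q \<zeta> N * qpoch q (inverse \<zeta>) N) = t ^ Suc N + infsum (F N) UNIV" for N
    unfolding qpoch_partial_fractions Fs c_def G_def H_def ..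
  \<comment> \<open>The term that stems from the value at infinity disappears because
    \<open>norm t < 1\<close>.\<close>
  have "(\<lambda>N. t ^ Suc N + infsum (F N) UNIV) \<longlonglongrightarrow> 0 +
      infsum (\<lambda>k. c k * (qpoch_inf q t / qpoch_inf q 1) * (qpoch_inf q (inverse t) / qpoch_inf q 1)) UNIV"
    by (intro tendsto_add tends LIMSEQ_Suc LIMSEQ_power_zero t)
  moreover have "(\<lambda>N. t ^ Suc N + infsum (F N) UNIV) \<longlonglongrightarrow> (1 - \<zeta> * t) / (1 - \<zeta>) *
      (qpoch_inf q (\<zeta> * t) * qpoch_inf q (inverse (\<zeta> * t))) / (qpoch_inf q \<zeta> * qpoch_inf q (inverse \<zeta>))"
    unfolding fin[symmetric]
    by (intro tendsto_divide tendsto_mult tendsto_const lim) (use nzz in auto)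
  ultimately have "(1 - \<zeta> * t) / (1 - \<zeta>) *
      (qpoch_inf q (\<zeta> * t) * qpoch_inf q (inverse (\<zeta> * t))) / (qpoch_inf q \<zeta> * qpoch_inf q (inverse \<zeta>)) =
      infsum (\<lambda>k. c k * (qpoch_inf q t / qpoch_inf q 1) * (qpoch_inf q (inverse t) / qpoch_inf q 1)) UNIV"
    using LIMSEQ_unique by fastforce
  also have "\<dots> = infsum (\<lambda>k. ((1 - t) * (qpoch_inf q t / qpoch_inf q 1) * (qpoch_inf q (inverse t) / qpoch_inf q 1)) *
      (t powi k / (1 - \<zeta> * q powi k))) UNIV"
    by (simp add: c_def mult_ac)
  finally show ?thesis unfolding infsum_cmult_right' .
qed

end

section \<open>The normalized exponential and the function \<open>phi_st\<close>\<close>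

lemma cexp_add: "cexp (x + y) = cexp x * cexp y"
  by (simp add: cexp_def distrib_left exp_add)

lemma cexp_0 [simp]: "cexp 0 = 1"
  by (simp add: cexp_def)

lemma cexp_nonzero [simp]: "cexp x \<noteq> 0"
  by (simp add: cexp_def)

lemma cexp_minus: "cexp (- x) = inverse (cexp x)"
  by (simp add: cexp_def exp_minus)

lemma cexp_sum: "finite A \<Longrightarrow> cexp (sum g A) = (\<Prod>x\<in>A. cexp (g x))"
  by (induction A rule: finite_induct) (auto simp: cexp_add)

lemma cexp_eq_1_iff: "cexp z = 1 \<longleftrightarrow> z \<in> \<int>"
proof
  assume "cexp z = 1"
  then obtain n :: int where "Re (2 * of_real pi * \<i> * z) = 0" "Im (2 * of_real pi * \<i> * z) = of_int (2 * n) * pi"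
    unfolding cexp_def exp_eq_1 by auto
  then have "z = of_int n"
    by (simp add: complex_eq_iff)
  then show "z \<in> \<int>" by simp
next
  assume "z \<in> \<int>"
  then obtain n where "z = of_int n" by (auto elim: Ints_cases)
  then show "cexp z = 1"
    unfolding cexp_def exp_eq_1 by (simp add: mult_ac) 
qed

lemma cexp_Ints: "z \<in> \<int> \<Longrightarrow> cexp z = 1"
  by (simp add: cexp_eq_1_iff)

lemma norm_cexp: "norm (cexp z) = exp (- (2 * pi * Im z))"
  by (simp add: cexp_def)

lemma cexp_powi: "cexp (of_int k * z) = cexp z powi k"
proof -
  have nat: "cexp (of_nat n * z) = cexp z ^ n" for n
    by (simp add: cexp_def exp_of_nat_mult[symmetric] mult_ac)
  show ?thesis
    by (cases k rule: int_cases2) (simp_all add: nat cexp_minus power_int_minus)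
qed

lemma isCont_cexp: "isCont cexp z"
  unfolding cexp_def[abs_def] by (intro continuous_intros)

context
  fixes \<tau> :: complex
  assumes tau: "Im \<tau> > 0"
begin

lemma norm_cexp_tau: "norm (cexp \<tau>) < 1"
  using tau by (simp add: norm_cexp)

text \<open>Serves two purposes: the denominators of Kronecker's series do not vanish, and
  \<open>phi_st\<close> has no pole at \<open>z\<close>.\<close>

lemma cexp_period_lattice:
  assumes "z \<notin> period_lattice \<tau>"
  shows "cexp z * cexp \<tau> powi k \<noteq> 1"
proof
  assume "cexp z * cexp \<tau> powi k = 1"
  then have "cexp (z + of_int k * \<tau>) = 1" by (simp add: cexp_add cexp_powi)
  then obtain n where "z + of_int k * \<tau> = of_int n"
    by (auto simp: cexp_eq_1_iff elim: Ints_cases)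
  then have "z = of_int n + of_int (- k) * \<tau>" by (simp add: algebra_simps)
  then show False using assms unfolding period_lattice_def by blast
qed

text \<open>The fraction in front of the product in \<open>phi_st\<close> supplies the factors
  \<open>1 - x\<close> of the three theta functions.\<close>

lemma phi_st_theta:
  "phi_st z \<tau> \<sigma> = (qpoch_inf (cexp \<tau>) 1)\<^sup>2 * jacobi_theta (cexp \<tau>) (cexp \<sigma> * cexp z) /
     (jacobi_theta (cexp \<tau>) (cexp \<sigma>) * jacobi_theta (cexp \<tau>) (cexp z))"
proof -
  define q where "q = cexp \<tau>"
  have q: "norm q < 1" unfolding q_def by (rule norm_cexp_tau)
  note c = convergent_prod_qpoch[OF q]
  define f where "f = (\<lambda>x k. 1 - x * q ^ Suc k)"
  have cf: "convergent_prod (f x)" for x unfolding f_def by (rule c)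
  have P: "prodinf (f x) = qpoch_inf q x" for x unfolding f_def qpoch_inf_def ..
  have m: "convergent_prod (\<lambda>k. f x k * f y k)" "prodinf (\<lambda>k. f x k * f y k) = qpoch_inf q x * qpoch_inf q y" for x y
    using convergent_prod_mult[OF cf cf] prodinf_mult[OF cf cf] by (simp_all add: P)
  have m2: "convergent_prod (\<lambda>k. (f x k * f y k) * (f x' k * f y' k))"
     "prodinf (\<lambda>k. (f x k * f y k) * (f x' k * f y' k)) = (qpoch_inf q x * qpoch_inf q y) * (qpoch_inf q x' * qpoch_inf q y')" for x y x' y'
    using convergent_prod_mult[OF m(1) m(1)] prodinf_mult[OF m(1) m(1)] by (simp_all add: m(2))
  let ?t = "cexp z" and ?z = "cexp \<sigma>"
  have "prodinf (\<lambda>k. ((1 - q ^ Suc k)\<^sup>2 * (1 - ?z * ?t * q ^ Suc k) * (1 - inverse ?z * inverse ?t * q ^ Suc k)) /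
          ((1 - ?z * q ^ Suc k) * (1 - inverse ?z * q ^ Suc k) *
          (1 - ?t * q ^ Suc k) * (1 - inverse ?t * q ^ Suc k))) =
     prodinf (\<lambda>k. ((f 1 k * f 1 k) * (f (?z * ?t) k * f (inverse (?z * ?t)) k)) /
         ((f ?z k * f (inverse ?z) k) * (f ?t k * f (inverse ?t) k)))"
    unfolding f_def by (simp add: power2_eq_square mult.assoc)
  also have "\<dots> = (qpoch_inf q 1 * qpoch_inf q 1) * (qpoch_inf q (?z * ?t) * qpoch_inf q (inverse (?z * ?t))) /
      ((qpoch_inf q ?z * qpoch_inf q (inverse ?z)) * (qpoch_inf q ?t * qpoch_inf q (inverse ?t)))"
    using prodinf_divide[OF m2(1) m2(1)] by (simp add: m2(2))
  finally show ?thesis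
    unfolding phi_st_def Let_def jacobi_theta_def q_def[symmetric]
    by (simp add: power2_eq_square mult_ac)
qed

lemma phi_st_add_int: "phi_st (z + of_int n) \<tau> \<sigma> = phi_st z \<tau> \<sigma>"
  by (simp add: phi_st_def cexp_add cexp_Ints)

text \<open>Both theta functions containing \<open>z\<close> are quasi-periodic; in the quotient of
  their multipliers \<open>cexp z\<close> cancels and only \<open>cexp (- \<sigma>)\<close> is
  left.\<close>

lemma phi_st_add_tau: "phi_st (z + \<tau>) \<tau> \<sigma> = cexp (- \<sigma>) * phi_st z \<tau> \<sigma>"
proof -
  have "jacobi_theta (cexp \<tau>) (cexp \<sigma> * cexp (z + \<tau>)) =
      - jacobi_theta (cexp \<tau>) (cexp \<sigma> * cexp z) / (cexp \<sigma> * cexp z)"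
    using jacobi_theta_shift[OF norm_cexp_tau, of "cexp \<sigma> * cexp z"] by (simp add: cexp_add mult.assoc)
  moreover have "jacobi_theta (cexp \<tau>) (cexp (z + \<tau>)) = - jacobi_theta (cexp \<tau>) (cexp z) / cexp z"
    using jacobi_theta_shift[OF norm_cexp_tau, of "cexp z"] by (simp add: cexp_add)
  ultimately show ?thesis
    by (simp only: phi_st_theta cexp_minus) (simp add: divide_simps)
qed

lemma phi_st_add_tau_int: "phi_st (z + of_int n * \<tau>) \<tau> \<sigma> = cexp (- of_int n * \<sigma>) * phi_st z \<tau> \<sigma>"
proof (induction n rule: int_induct[where k = 0])
  case (step1 i)
  have "z + of_int (i + 1) * \<tau> = (z + of_int i * \<tau>) + \<tau>" by (simp add: algebra_simps)
  moreover have "cexp (- of_int (i + 1) * \<sigma>) = cexp (- \<sigma>) * cexp (- of_int i * \<sigma>)"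
    by (simp add: cexp_add[symmetric] algebra_simps)
  ultimately show ?case by (simp only: phi_st_add_tau step1 mult.assoc)
next
  case (step2 i)
  have "z + of_int i * \<tau> = (z + of_int (i - 1) * \<tau>) + \<tau>" by (simp add: algebra_simps)
  then have "cexp (- of_int i * \<sigma>) * phi_st z \<tau> \<sigma> = cexp (- \<sigma>) * phi_st (z + of_int (i - 1) * \<tau>) \<tau> \<sigma>"
    by (simp only: phi_st_add_tau step2(2)[symmetric])
  moreover have "cexp (- of_int i * \<sigma>) = cexp (- of_int (i - 1) * \<sigma>) * cexp (- \<sigma>)"
    by (simp add: cexp_add[symmetric] algebra_simps)
  ultimately show ?case by simp
qed simp

lemma isCont_phi_st:
  assumes z: "z \<notin> period_lattice \<tau>"
  shows "isCont (\<lambda>z. phi_st z \<tau> \<sigma>) z"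
proof -
  let ?q = "cexp \<tau>"
  note pl = cexp_period_lattice[OF z]
  have cQ: "isCont (\<lambda>z. qpoch_inf ?q (g z)) z" if "isCont g z" for g
    using isCont_o2[OF that isCont_qpoch_inf[OF norm_cexp_tau]] .
  have cT: "isCont (\<lambda>z. jacobi_theta ?q (c * cexp z)) z" if "c \<noteq> 0" for c
    unfolding jacobi_theta_def using that
    by (intro continuous_mult continuous_diff continuous_const cQ continuous_at_within_inverse isCont_cexp) auto
  have "jacobi_theta ?q (cexp z) \<noteq> 0"
  proof -
    have "cexp z \<noteq> 1" using pl[of 0] by simp
    moreover have "qpoch_inf ?q (cexp z) \<noteq> 0"
    proof (rule qpoch_inf_nonzero[OF norm_cexp_tau])
      show "cexp z * ?q ^ Suc k \<noteq> 1" for k using pl[of "int (Suc k)"] by (metis power_int_of_nat)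
    qed
    moreover have "qpoch_inf ?q (inverse (cexp z)) \<noteq> 0"
    proof (rule qpoch_inf_nonzero[OF norm_cexp_tau])
      show "inverse (cexp z) * ?q ^ Suc k \<noteq> 1" for k
      proof
        assume "inverse (cexp z) * ?q ^ Suc k = 1"
        then have "inverse (inverse (cexp z) * ?q ^ Suc k) = 1" by simp
        then have "cexp z * ?q powi (- int (Suc k)) = 1"
          by (simp only: power_int_minus power_int_of_nat inverse_mult_distrib inverse_inverse_eq)
        then show False using pl by blast
      qed
    qed
    ultimately show ?thesis by (simp add: jacobi_theta_def)
  qed
  \<comment> \<open>If the theta function vanishes at \<open>cexp \<sigma>\<close>, division by zero
    makes the function constantly 0; otherwise the denominator is nonzero at
    \<open>z\<close>.\<close>
  then show ?thesis
    unfolding phi_st_theta using cT[of 1] cT[of "cexp \<sigma>"]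
    by (cases "jacobi_theta ?q (cexp \<sigma>) = 0") (auto intro!: continuous_divide continuous_mult continuous_const)
qed

text \<open>The strip for \<open>z\<close> is the annulus \<open>norm q < norm t < 1\<close> of
  \<open>kronecker_qpoch\<close>. A shift of \<open>z\<close> by \<tau> leaves it, so the
  representative of \<open>h1\<close> must be chosen with care later on.\<close>

lemma phi_st_kronecker:
  assumes \<sigma>: "\<sigma> \<notin> period_lattice \<tau>" and z: "0 < Im z" "Im z < Im \<tau>"
  shows "(\<lambda>k. norm (cexp (of_int k * z) / (1 - cexp (\<sigma> + of_int k * \<tau>)))) summable_on UNIV"
    and "infsum (\<lambda>k. cexp (of_int k * z) / (1 - cexp (\<sigma> + of_int k * \<tau>))) UNIV = phi_st z \<tau> \<sigma>"
proof -
  let ?q = "cexp \<tau>" and ?t = "cexp z" and ?z = "cexp \<sigma>"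
  have nt: "norm ?q < norm ?t" "norm ?t < 1" using z by (auto simp: norm_cexp)
  note pl = cexp_period_lattice[OF \<sigma>]
  have e: "cexp (of_int k * z) / (1 - cexp (\<sigma> + of_int k * \<tau>)) = ?t powi k / (1 - ?z * ?q powi k)" for k
    by (simp add: cexp_powi cexp_add)
  show "(\<lambda>k. norm (cexp (of_int k * z) / (1 - cexp (\<sigma> + of_int k * \<tau>)))) summable_on UNIV"
    unfolding e by (rule kronecker_summable) (use nt norm_cexp_tau pl in auto)
  have K: "(1 - ?z * ?t) / (1 - ?z) * (qpoch_inf ?q (?z * ?t) * qpoch_inf ?q (inverse (?z * ?t))) /
      (qpoch_inf ?q ?z * qpoch_inf ?q (inverse ?z)) =
    (1 - ?t) * (qpoch_inf ?q ?t / qpoch_inf ?q 1) * (qpoch_inf ?q (inverse ?t) / qpoch_inf ?q 1) *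
      infsum (\<lambda>k. ?t powi k / (1 - ?z * ?q powi k)) (UNIV :: int set)"
    by (rule kronecker_qpoch) (use nt norm_cexp_tau pl in auto)
  have n1: "qpoch_inf ?q 1 \<noteq> 0"
    by (rule qpoch_inf_nonzero[OF norm_cexp_tau]) (use norm_lt_1_power_neq_1[OF norm_cexp_tau] in simp)
  have t1: "?t \<noteq> 1" using nt by auto
  have t2: "qpoch_inf ?q ?t \<noteq> 0"
  proof (rule qpoch_inf_nonzero[OF norm_cexp_tau])
    fix k
    have "norm (?t * ?q ^ Suc k) < 1 * 1"
      unfolding norm_mult norm_power using nt norm_cexp_tau
      by (intro mult_strict_mono power_Suc_less_one) auto
    then show "?t * ?q ^ Suc k \<noteq> 1" by auto
  qed
  have t3: "qpoch_inf ?q (inverse ?t) \<noteq> 0"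
  proof (rule qpoch_inf_nonzero[OF norm_cexp_tau])
    fix k
    have "norm (inverse ?t * ?q ^ Suc k) = (norm ?q / norm ?t) * norm ?q ^ k"
      by (simp add: norm_mult norm_power norm_inverse divide_inverse mult_ac)
    also have "\<dots> \<le> (norm ?q / norm ?t) * 1"
      using norm_cexp_tau by (intro mult_left_mono power_le_one) auto
    also have "\<dots> < 1" using nt by (simp add: divide_simps)
    finally show "inverse ?t * ?q ^ Suc k \<noteq> 1" by auto
  qed
  show "infsum (\<lambda>k. cexp (of_int k * z) / (1 - cexp (\<sigma> + of_int k * \<tau>))) UNIV = phi_st z \<tau> \<sigma>"
  proof -
    \<comment> \<open>Solves Kronecker's identity for the series; the factor divided out is the
      theta function at \<open>cexp z\<close>, nonzero in the annulus, over the square of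
      \<open>qpoch_inf q 1\<close>.\<close>
    have "infsum (\<lambda>k. ?t powi k / (1 - ?z * ?q powi k)) UNIV =
      ((1 - ?t) * (qpoch_inf ?q ?t / qpoch_inf ?q 1) * (qpoch_inf ?q (inverse ?t) / qpoch_inf ?q 1) *
      infsum (\<lambda>k. ?t powi k / (1 - ?z * ?q powi k)) UNIV) *
      ((qpoch_inf ?q 1)\<^sup>2 / ((1 - ?t) * qpoch_inf ?q ?t * qpoch_inf ?q (inverse ?t)))"
      using n1 t1 t2 t3 by (simp add: power2_eq_square)
    then show ?thesis
      unfolding e phi_st_theta jacobi_theta_def K[symmetric] by (simp add: divide_inverse mult_ac)
  qed
qed

end

section \<open>Lattice points of shifted simplicial cones\<close>

lemma has_sum_prod_PiE:
  fixes h :: "'i \<Rightarrow> 'b::countable \<Rightarrow> complex"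
  assumes "finite A" "\<And>i. i \<in> A \<Longrightarrow> (\<lambda>k. norm (h i k)) summable_on UNIV"
  shows "((\<lambda>k. \<Prod>i\<in>A. h i (k i)) has_sum (\<Prod>i\<in>A. infsum (h i) UNIV)) (PiE A (\<lambda>_. UNIV))"
proof -
  have "(\<lambda>k. \<Prod>i\<in>A. h i (k i)) summable_on (PiE A (\<lambda>_. UNIV))"
  proof (rule abs_summable_summable)
    have "Infinite_Set_Sum.abs_summable_on (\<lambda>k. \<Prod>i\<in>A. h i (k i)) (PiE A (\<lambda>_. UNIV))"
      using assms(1)
    proof (rule abs_summable_on_prod_PiE)
      show "Infinite_Set_Sum.abs_summable_on (h i) UNIV" if "i \<in> A" for i
        using assms(2)[OF that] by (simp only: abs_summable_equivalent[symmetric])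
    qed simp
    then show "(\<lambda>k. norm (\<Prod>i\<in>A. h i (k i))) summable_on (PiE A (\<lambda>_. UNIV))"
      by (simp only: abs_summable_equivalent)
  qed
  moreover have "infsum (\<lambda>k. \<Prod>i\<in>A. h i (k i)) (PiE A (\<lambda>_. UNIV)) = (\<Prod>i\<in>A. infsum (h i) UNIV)"
    by (rule infsum_prod_PiE_abs) (rule assms)+
  ultimately show ?thesis using has_sum_infsum by metis
qed

lemma group_closure_scaleR_int:
  fixes x :: "'a::real_vector"
  assumes "x \<in> group_closure S"
  shows "of_int k *\<^sub>R x \<in> group_closure S"
proof -
  have nat: "of_nat n *\<^sub>R x \<in> group_closure S" for n
    by (induction n) (auto simp: scaleR_add_left intro!: group_closure_add assms)
  show ?thesis
    by (cases k rule: int_cases2) (use nat in auto)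
qed

lemma group_closure_sum_in:
  "(\<And>i. i \<in> A \<Longrightarrow> x i \<in> group_closure S) \<Longrightarrow> sum x A \<in> group_closure S"
  by (induction A rule: infinite_finite_induct) (auto intro!: group_closure_add)

text \<open>The dual basis of \<open>v\<close> is represented by vectors \<open>U i\<close> via the inner product.\<close>

locale lattice_cone =
  fixes L :: "'a::euclidean_space set" and I :: "'v set" and v U :: "'v \<Rightarrow> 'a"
  assumes finite_I: "finite I"
    and zero_L: "0 \<in> L" and diff_L: "x \<in> L \<Longrightarrow> x' \<in> L \<Longrightarrow> x - x' \<in> L"
    and discrete_L: "finite (L \<inter> cball 0 r)"
    and v_in_L: "i \<in> I \<Longrightarrow> v i \<in> L"
    and dual: "i \<in> I \<Longrightarrow> j \<in> I \<Longrightarrow> U i \<bullet> v j = (if i = j then 1 else 0)"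
    and U_span: "i \<in> I \<Longrightarrow> U i \<in> span L"
    and expand: "x \<in> span L \<Longrightarrow> (\<Sum>i\<in>I. (U i \<bullet> x) *\<^sub>R v i) = x"
begin

lemma uminus_L: "x \<in> L \<Longrightarrow> - x \<in> L"
  using diff_L[OF zero_L] by simp

lemma add_L: "x \<in> L \<Longrightarrow> x' \<in> L \<Longrightarrow> x + x' \<in> L"
  using diff_L[of x "- x'"] uminus_L by simp

lemma group_closure_subset_L: "S \<subseteq> L \<Longrightarrow> x \<in> group_closure S \<Longrightarrow> x \<in> L"
proof -
  assume "S \<subseteq> L" "x \<in> group_closure S"
  from this(2,1) show "x \<in> L" by induction (auto simp: zero_L intro: diff_L)
qed

lemma coord_sum: "i \<in> I \<Longrightarrow> U i \<bullet> (\<Sum>j\<in>I. c j *\<^sub>R v j) = c i"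
  using finite_I by (simp add: inner_sum_right dual if_distrib[of "\<lambda>x. _ * x"] cong: if_cong)

lemma coord_sum_dual: "i \<in> I \<Longrightarrow> (\<Sum>j\<in>I. c j *\<^sub>R U j) \<bullet> v i = c i"
  using finite_I by (simp add: inner_sum_left dual if_distrib[of "\<lambda>x. _ * x"] cong: if_cong)

lemma inj_v: "inj_on v I"
proof (rule inj_onI)
  fix i j assume "i \<in> I" "j \<in> I" "v i = v j"
  then show "i = j" using dual[of i i] dual[of i j] by (auto split: if_splits)
qed

definition sublattice :: "'a set" where "sublattice = group_closure (v ` I)"

lemma sublattice_iff: "x \<in> sublattice \<longleftrightarrow> x \<in> span L \<and> (\<forall>i\<in>I. U i \<bullet> x \<in> \<int>)"
proof
  assume "x \<in> sublattice"
  then have "x \<in> group_closure (v ` I)" by (simp add: sublattice_def)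
  then show "x \<in> span L \<and> (\<forall>i\<in>I. U i \<bullet> x \<in> \<int>)"
    by induction (auto simp: dual span_base v_in_L span_zero span_diff inner_diff_right)
next
  assume x: "x \<in> span L \<and> (\<forall>i\<in>I. U i \<bullet> x \<in> \<int>)"
  have "(U i \<bullet> x) *\<^sub>R v i \<in> group_closure (v ` I)" if "i \<in> I" for i
  proof -
    have "U i \<bullet> x \<in> \<int>" using x that by blast
    then obtain k where "U i \<bullet> x = of_int k" by (rule Ints_cases)
    then show ?thesis
      by (simp only:) (intro group_closure_scaleR_int group_closure.base, use that in simp)
  qed
  then have "(\<Sum>i\<in>I. (U i \<bullet> x) *\<^sub>R v i) \<in> group_closure (v ` I)"
    by (rule group_closure_sum_in)
  then show "x \<in> sublattice"
    using expand[of x] x by (simp add: sublattice_def)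
qed

lemma sublattice_subset_L: "x \<in> sublattice \<Longrightarrow> x \<in> L"
  unfolding sublattice_def by (rule group_closure_subset_L) (use v_in_L in auto)

lemma sublattice_diff: "x \<in> sublattice \<Longrightarrow> x' \<in> sublattice \<Longrightarrow> x - x' \<in> sublattice"
  unfolding sublattice_def by (rule group_closure.diff)

lemma sublattice_uminus: "x \<in> sublattice \<Longrightarrow> - x \<in> sublattice"
  unfolding sublattice_def by simp

section \<open>Representatives of the lattice modulo the sublattice\<close>

text \<open>A system of representatives of \<open>H_I\<close>. The genus is defined with the
  arbitrary ones of \<open>coset_rep\<close>, whereas Kronecker's formula needs those in
  \<open>box y\<close>; the lemmas below exchange them.\<close>

definition transversal :: "'a set \<Rightarrow> bool" where
  "transversal T \<longleftrightarrow> T \<subseteq> L \<and> (\<forall>x\<in>L. \<exists>!t. t \<in> T \<and> x - t \<in> sublattice)"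

lemma transversal_bij:
  assumes T: "transversal T" and T': "transversal T'"
  obtains \<phi> where "bij_betw \<phi> T T'" "\<forall>t\<in>T. t - \<phi> t \<in> sublattice"
proof -
  define \<phi> where "\<phi> = (\<lambda>x. THE t. t \<in> T' \<and> x - t \<in> sublattice)"
  define \<psi> where "\<psi> = (\<lambda>x. THE t. t \<in> T \<and> x - t \<in> sublattice)"
  have p: "\<phi> x \<in> T' \<and> x - \<phi> x \<in> sublattice" if "x \<in> L" for x
    unfolding \<phi>_def by (rule theI') (use T' that in \<open>auto simp: transversal_def\<close>)
  have s: "\<psi> x \<in> T \<and> x - \<psi> x \<in> sublattice" if "x \<in> L" for x
    unfolding \<psi>_def by (rule theI') (use T that in \<open>auto simp: transversal_def\<close>)
  have TL: "T \<subseteq> L" "T' \<subseteq> L" using T T' by (auto simp: transversal_def)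
  have neg: "b - a \<in> sublattice" if "a - b \<in> sublattice" for a b
    using sublattice_uminus[OF that] by simp
  have zero: "a - a \<in> sublattice" for a by (simp add: sublattice_def)
  have 1: "\<psi> (\<phi> x) = x" if "x \<in> T" for x
  proof -
    have "\<phi> x \<in> L" using p that TL by auto
    moreover have "\<phi> x - x \<in> sublattice" using p that TL neg by auto
    ultimately show ?thesis using T s that unfolding transversal_def by blast
  qed
  have 2: "\<phi> (\<psi> x) = x" if "x \<in> T'" for x
  proof -
    have "\<psi> x \<in> L" using s that TL by auto
    moreover have "\<psi> x - x \<in> sublattice" using s that TL neg by auto
    ultimately show ?thesis using T' p that unfolding transversal_def by blast
  qed
  have "bij_betw \<phi> T T'"
    by (rule bij_betwI[of _ _ _ \<psi>]) (use p s 1 2 TL in auto)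
  moreover have "\<forall>t\<in>T. t - \<phi> t \<in> sublattice" using p TL by blast
  ultimately show ?thesis by (rule that)
qed

lemma transversal_sum:
  assumes T: "transversal T" and T': "transversal T'"
    and G: "\<And>x x'. x \<in> L \<Longrightarrow> x' \<in> L \<Longrightarrow> x - x' \<in> sublattice \<Longrightarrow> G x = G x'"
  shows "sum G T = sum G T'"
proof -
  obtain \<phi> where \<phi>: "bij_betw \<phi> T T'" "\<forall>t\<in>T. t - \<phi> t \<in> sublattice"
    by (rule transversal_bij[OF T T'])
  have "sum G T' = (\<Sum>t\<in>T. G (\<phi> t))" by (rule sum.reindex_bij_betw[OF \<phi>(1), symmetric])
  also have "\<dots> = sum G T"
  proof (rule sum.cong[OF refl])
    fix t assume t: "t \<in> T"
    then have "t \<in> L" "\<phi> t \<in> L" using T T' bij_betwE[OF \<phi>(1)] by (auto simp: transversal_def)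
    then show "G (\<phi> t) = G t" using G[of t "\<phi> t"] \<phi>(2) t by simp
  qed
  finally show ?thesis ..
qed

lemma transversal_card:
  assumes "transversal T" "transversal T'"
  shows "card T = card T'"
proof -
  obtain \<phi> where "bij_betw \<phi> T T'"
    by (rule transversal_bij[OF assms])
  then show ?thesis by (rule bij_betw_same_card)
qed

lemma transversal_translate:
  assumes T: "transversal T" and a: "a \<in> L"
  shows "transversal ((\<lambda>x. x + a) ` T)"
  unfolding transversal_def
proof (intro conjI ballI)
  show "(\<lambda>x. x + a) ` T \<subseteq> L" using T a add_L by (auto simp: transversal_def)
  fix x assume "x \<in> L"
  then have "\<exists>!t. t \<in> T \<and> (x - a) - t \<in> sublattice" using T a diff_L by (auto simp: transversal_def)
  then obtain t where t: "t \<in> T" "(x - a) - t \<in> sublattice"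
      "\<And>s. s \<in> T \<Longrightarrow> (x - a) - s \<in> sublattice \<Longrightarrow> s = t" by blast
  show "\<exists>!s. s \<in> (\<lambda>x. x + a) ` T \<and> x - s \<in> sublattice"
  proof (rule ex1I[of _ "t + a"])
    have e: "x - (s + a) = (x - a) - s" for s by simp
    show "t + a \<in> (\<lambda>x. x + a) ` T \<and> x - (t + a) \<in> sublattice"
      unfolding e using t by blast
    fix s assume "s \<in> (\<lambda>x. x + a) ` T \<and> x - s \<in> sublattice"
    then obtain s' where s': "s' \<in> T" "s = s' + a" "x - s \<in> sublattice" by blast
    then show "s = t + a" using t(3)[of s'] by (simp only: e)
  qed
qed

text \<open>The lattice points of the fundamental parallelepiped of the \<open>v i\<close>,
  translated by \<open>- y\<close>. It is half-open so that every class has exactly one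
  representative, whatever \<open>y\<close> is.\<close>

definition box :: "'a \<Rightarrow> 'a set" where
  "box y = {x \<in> L. \<forall>i\<in>I. 0 \<le> U i \<bullet> (y + x) \<and> U i \<bullet> (y + x) < 1}"

text \<open>Subtracting the integral parts of the coordinates moves a vector into the box. Two
  representatives of one class have coordinates that differ by integers of absolute value below
  1.\<close>

lemma transversal_box: "transversal (box y)"
  unfolding transversal_def
proof (intro conjI ballI)
  show "box y \<subseteq> L" by (auto simp: box_def)
  fix x assume x: "x \<in> L"
  define s where "s = (\<Sum>i\<in>I. of_int \<lfloor>U i \<bullet> (y + x)\<rfloor> *\<^sub>R v i)"
  have s: "s \<in> sublattice"
    unfolding sublattice_def s_def
    by (intro group_closure_sum_in group_closure_scaleR_int group_closure.base) auto
  have Us: "U i \<bullet> s = of_int \<lfloor>U i \<bullet> (y + x)\<rfloor>" if "i \<in> I" for i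
    unfolding s_def using coord_sum[OF that] .
  show "\<exists>!t. t \<in> box y \<and> x - t \<in> sublattice"
  proof (rule ex1I[of _ "x - s"])
    have "U i \<bullet> (y + (x - s)) = frac (U i \<bullet> (y + x))" if "i \<in> I" for i
      using Us[OF that] by (simp add: inner_diff_right inner_add_right frac_def)
    then show "x - s \<in> box y \<and> x - (x - s) \<in> sublattice"
      using s x sublattice_subset_L by (auto simp: box_def diff_L frac_lt_1)
  next
    fix t assume t: "t \<in> box y \<and> x - t \<in> sublattice"
    have d: "(x - s) - t \<in> sublattice"
      using sublattice_diff[of "x - t" s] t s by (simp add: algebra_simps)
    have "U i \<bullet> ((x - s) - t) = 0" if i: "i \<in> I" for i
    proof -
      have f: "U i \<bullet> (y + (x - s)) = frac (U i \<bullet> (y + x))"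
        using Us[OF i] by (simp add: inner_diff_right inner_add_right frac_def)
      have "0 \<le> U i \<bullet> (y + t)" "U i \<bullet> (y + t) < 1" using t i by (auto simp: box_def)
      moreover have e: "U i \<bullet> ((x - s) - t) = frac (U i \<bullet> (y + x)) - U i \<bullet> (y + t)"
        using f by (simp add: inner_diff_right inner_add_right)
      ultimately have "\<bar>U i \<bullet> ((x - s) - t)\<bar> < 1"
        using frac_lt_1[of "U i \<bullet> (y + x)"] frac_ge_0[of "U i \<bullet> (y + x)"] by linarith
      moreover have "U i \<bullet> ((x - s) - t) \<in> \<int>" using d i sublattice_iff by blast
      ultimately show ?thesis using Ints_nonzero_abs_less1 by blast
    qed
    then have "(\<Sum>i\<in>I. (U i \<bullet> ((x - s) - t)) *\<^sub>R v i) = 0" by simp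
    moreover have "(x - s) - t \<in> span L" using d sublattice_iff by blast
    ultimately have "(x - s) - t = 0" using expand[of "(x - s) - t"] by simp
    then show "t = x - s" by simp
  qed
qed

lemma finite_box:
  assumes "y \<in> span L"
  shows "finite (box y)"
proof (rule finite_subset)
  show "box y \<subseteq> L \<inter> cball 0 (norm y + (\<Sum>i\<in>I. norm (v i)))"
  proof
    fix x assume x: "x \<in> box y"
    then have xL: "x \<in> L" by (simp add: box_def)
    then have "y + x \<in> span L" by (intro span_add assms span_base)
    then have "norm (y + x) = norm (\<Sum>i\<in>I. (U i \<bullet> (y + x)) *\<^sub>R v i)" by (simp only: expand)
    also have "\<dots> \<le> (\<Sum>i\<in>I. norm ((U i \<bullet> (y + x)) *\<^sub>R v i))" by (rule norm_sum)
    also have "\<dots> \<le> (\<Sum>i\<in>I. norm (v i))"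
    proof (rule sum_mono)
      fix i assume "i \<in> I"
      then have "\<bar>U i \<bullet> (y + x)\<bar> \<le> 1" using x by (force simp: box_def)
      then show "norm ((U i \<bullet> (y + x)) *\<^sub>R v i) \<le> norm (v i)"
        by (simp add: mult_left_le_one_le)
    qed
    finally have "norm x \<le> norm y + (\<Sum>i\<in>I. norm (v i))"
      using norm_triangle_ineq4[of "y + x" y] by simp
    then show "x \<in> L \<inter> cball 0 (norm y + (\<Sum>i\<in>I. norm (v i)))" using xL by simp
  qed
qed (rule discrete_L)

lemma finite_transversal:
  assumes "transversal T"
  shows "finite T"
proof -
  obtain \<phi> where "bij_betw \<phi> T (box 0)"
    by (rule transversal_bij[OF assms transversal_box])
  then show ?thesis using finite_box[OF span_zero] bij_betw_finite by blast
qed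

lemma transversal_nonempty: "transversal T \<Longrightarrow> T \<noteq> {}"
  using zero_L unfolding transversal_def by blast

lemma transversal_coset_rep:
  "transversal (coset_rep ` quotient_group L v I)"
  "inj_on coset_rep (quotient_group L v I)"
proof -
  define R where "R = {(x, y). x \<in> L \<and> y \<in> L \<and> x - y \<in> sublattice}"
  have Q: "quotient_group L v I = L // R"
    by (simp add: quotient_group_def R_def sublattice_def)
  have eq: "equiv L R"
  proof (rule equivI)
    show "refl_on L R" by (auto simp: refl_on_def R_def sublattice_def)
    show "R \<subseteq> L \<times> L" by (auto simp: R_def)
    show "sym R" using sublattice_uminus by (force simp: sym_def R_def)
    show "trans R"
    proof (rule transI)
      fix x y z assume "(x, y) \<in> R" "(y, z) \<in> R"
      then show "(x, z) \<in> R"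
        using sublattice_diff[of "x - y" "z - y"] sublattice_uminus[of "y - z"] by (auto simp: R_def)
    qed
  qed
  have rep: "coset_rep h \<in> h" if "h \<in> L // R" for h
    unfolding coset_rep_def using equiv_class_self[OF eq] that by (auto intro!: someI elim!: quotientE)
  have repL: "coset_rep h \<in> L" if "h \<in> L // R" for h
    using rep[OF that] that by (auto simp: R_def elim!: quotientE)
  have cls: "R `` {coset_rep h} = h" if h: "h \<in> L // R" for h
  proof -
    obtain x where x: "h = R `` {x}" using h by (rule quotientE)
    then have "(x, coset_rep h) \<in> R" using rep[OF h] by simp
    then have "R `` {x} = R `` {coset_rep h}" by (rule equiv_class_eq[OF eq])
    then show ?thesis by (rule trans[OF sym x[symmetric]])
  qed
  show inj: "inj_on coset_rep (quotient_group L v I)"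
    unfolding Q by (rule inj_on_inverseI[of _ "\<lambda>x. R `` {x}"]) (rule cls)
  show "transversal (coset_rep ` quotient_group L v I)"
    unfolding transversal_def Q
  proof (intro conjI ballI)
    show "coset_rep ` (L // R) \<subseteq> L" using repL by auto
    fix x assume x: "x \<in> L"
    let ?h = "R `` {x}"
    have h: "?h \<in> L // R" using x by (rule quotientI)
    show "\<exists>!t. t \<in> coset_rep ` (L // R) \<and> x - t \<in> sublattice"
    proof (rule ex1I[of _ "coset_rep ?h"])
      show "coset_rep ?h \<in> coset_rep ` (L // R) \<and> x - coset_rep ?h \<in> sublattice"
        using h rep[OF h] by (auto simp: R_def)
      fix t assume "t \<in> coset_rep ` (L // R) \<and> x - t \<in> sublattice"
      then obtain h' where h': "h' \<in> L // R" "t = coset_rep h'" "x - t \<in> sublattice" by blast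
      then have "(x, t) \<in> R" using x repL by (auto simp: R_def)
      then have "R `` {x} = R `` {t}" by (rule equiv_class_eq[OF eq])
      also have "\<dots> = h'" unfolding h'(2) by (rule cls[OF h'(1)])
      finally show "t = coset_rep ?h" by (simp only: h'(2))
    qed
  qed
qed

lemma sum_quotient_group:
  assumes "transversal T"
    and "\<And>x x'. x \<in> L \<Longrightarrow> x' \<in> L \<Longrightarrow> x - x' \<in> sublattice \<Longrightarrow> G x = G x'"
  shows "(\<Sum>h\<in>quotient_group L v I. G (coset_rep h)) = sum G T"
  using transversal_sum[OF transversal_coset_rep(1) assms]
  by (simp add: sum.reindex[OF transversal_coset_rep(2)])

lemma card_quotient_group: "transversal T \<Longrightarrow> card (quotient_group L v I) = card T"
  using transversal_card[OF transversal_coset_rep(1)] card_image[OF transversal_coset_rep(2)] by simp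

text \<open>Integrality on the \<open>v i\<close> makes the summand a character of the finite group
  \<open>H_I\<close>; it is trivial exactly if \<kappa> is integral on \<open>L\<close>.\<close>

lemma character_orthogonality:
  assumes T: "transversal T" and k: "\<And>i. i \<in> I \<Longrightarrow> \<kappa> \<bullet> v i \<in> \<int>"
  shows "(\<Sum>b\<in>T. cexp (- of_real (\<kappa> \<bullet> b))) = (if \<forall>x\<in>L. \<kappa> \<bullet> x \<in> \<int> then of_nat (card T) else 0)"
proof (cases "\<forall>x\<in>L. \<kappa> \<bullet> x \<in> \<int>")
  case True
  have "cexp (- of_real (\<kappa> \<bullet> b)) = 1" if "b \<in> T" for b
  proof -
    have "\<kappa> \<bullet> b \<in> \<int>" using T True that by (auto simp: transversal_def)
    then show ?thesis by (intro cexp_Ints) simp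
  qed
  then show ?thesis using True by simp
next
  case False
  then obtain a where a: "a \<in> L" "\<kappa> \<bullet> a \<notin> \<int>" by blast
  let ?G = "\<lambda>b. cexp (- of_real (\<kappa> \<bullet> b))"
  have Gadd: "?G (x + x') = ?G x * ?G x'" for x x'
    by (simp add: inner_add_right cexp_add[symmetric])
  have Gs: "?G x = 1" if "x \<in> sublattice" for x
  proof -
    have "\<kappa> \<bullet> x = \<kappa> \<bullet> (\<Sum>i\<in>I. (U i \<bullet> x) *\<^sub>R v i)" using that sublattice_iff expand by simp
    also have "\<dots> = (\<Sum>i\<in>I. (U i \<bullet> x) * (\<kappa> \<bullet> v i))"
      by (simp add: inner_sum_right)
    also have "\<dots> \<in> \<int>" using that k sublattice_iff by (intro Ints_sum Ints_mult) auto
    finally show ?thesis by (intro cexp_Ints) simp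
  qed
  \<comment> \<open>Translation by \<open>a\<close> permutes the classes but multiplies the sum by
    the value at \<open>a\<close>, which is not 1.\<close>
  have "sum ?G T = sum ?G ((\<lambda>x. x + a) ` T)"
  proof (rule transversal_sum[OF T transversal_translate[OF T a(1)]])
    fix x x' assume "x - x' \<in> sublattice"
    then have "?G ((x - x') + x') = ?G x'" unfolding Gadd using Gs by simp
    then show "?G x = ?G x'" by simp
  qed
  also have "\<dots> = (\<Sum>b\<in>T. ?G (b + a))" by (subst sum.reindex) (auto simp: inj_on_def)
  also have "\<dots> = sum ?G T * ?G a" unfolding Gadd sum_distrib_right ..
  finally have "sum ?G T * (1 - ?G a) = 0" by (simp add: algebra_simps)
  moreover have "?G a \<noteq> 1"
  proof
    assume "?G a = 1"
    then have "- complex_of_real (\<kappa> \<bullet> a) \<in> \<int>" by (simp only: cexp_eq_1_iff)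
    then show False using a by simp
  qed
  ultimately show ?thesis unfolding if_not_P[OF False] by simp
qed

section \<open>Generating functions of lattice points\<close>

text \<open>Only the lattice points of the translated cone \<open>C(I) - y\<close>, not the cone
  itself.\<close>

definition shifted_cone :: "'a \<Rightarrow> 'a set" where
  "shifted_cone y = {x \<in> L. \<forall>i\<in>I. 0 \<le> U i \<bullet> (y + x)}"

text \<open>The generating function of \<open>shifted_cone y\<close> in closed form. It makes sense
  whenever no denominator vanishes, also where the sum over the lattice points diverges.\<close>

definition cone_series :: "'a \<Rightarrow> ('a \<Rightarrow> complex) \<Rightarrow> complex" where
  "cone_series y g = (\<Sum>x\<in>box y. cexp (g x)) / (\<Prod>i\<in>I. 1 - cexp (g (v i)))"

text \<open>Every point of the shifted cone is, in exactly one way, a point of the box plus a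
  combination of the \<open>v i\<close> with coefficients in the natural numbers. The sum is thus a
  finite sum times a product of geometric series.\<close>

lemma cone_series_has_sum:
  assumes g: "linear g" and pos: "\<And>i. i \<in> I \<Longrightarrow> Im (g (v i)) > 0" and y: "y \<in> span L"
  shows "((\<lambda>x. cexp (g x)) has_sum cone_series y g) (shifted_cone y)"
proof -
  define N where "N = PiE I (\<lambda>_. UNIV :: nat set)"
  define tr where "tr = (\<lambda>k :: 'v \<Rightarrow> nat. \<Sum>i\<in>I. of_nat (k i) *\<^sub>R v i)"
  define P where "P = (\<Prod>i\<in>I. 1 - cexp (g (v i)))"
  have Utr: "U i \<bullet> tr k = of_nat (k i)" if "i \<in> I" for i k
    unfolding tr_def using coord_sum[OF that] .
  have trs: "tr k \<in> sublattice" for k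
  proof -
    have "of_int (int (k i)) *\<^sub>R v i \<in> group_closure (v ` I)" if "i \<in> I" for i
      by (intro group_closure_scaleR_int group_closure.base) (use that in auto)
    then show ?thesis unfolding tr_def sublattice_def by (intro group_closure_sum_in) simp
  qed
  have n1: "norm (cexp (g (v i))) < 1" if "i \<in> I" for i using pos[OF that] by (simp add: norm_cexp)
  have S: "((\<lambda>k. \<Prod>i\<in>I. cexp (g (v i)) ^ k i) has_sum (1 / P)) N"
  proof -
    have "((\<lambda>k. \<Prod>i\<in>I. cexp (g (v i)) ^ k i) has_sum (\<Prod>i\<in>I. infsum (\<lambda>m. cexp (g (v i)) ^ m) UNIV)) N"
      unfolding N_def
    proof (rule has_sum_prod_PiE[OF finite_I])
      fix i assume "i \<in> I"
      then show "(\<lambda>m. norm (cexp (g (v i)) ^ m)) summable_on UNIV"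
        using n1 by (intro norm_summable_imp_summable_on) (simp add: norm_power)
    qed
    moreover have "infsum (\<lambda>m. cexp (g (v i)) ^ m) UNIV = 1 / (1 - cexp (g (v i)))" if "i \<in> I" for i
      using n1[OF that] norm_summable_imp_has_sum[OF _ geometric_sums, of "cexp (g (v i))"]
      by (intro infsumI) (simp add: norm_power summable_geometric)
    ultimately show ?thesis by (simp add: P_def prod_dividef cong: prod.cong)
  qed
  have e: "cexp (g (x + tr k)) = cexp (g x) * (\<Prod>i\<in>I. cexp (g (v i)) ^ k i)" for x k
  proof -
    have "g (x + tr k) = g x + (\<Sum>i\<in>I. of_int (int (k i)) * g (v i))"
      using g by (simp add: tr_def linear_add linear_sum linear_cmul scaleR_conv_of_real)
    then show ?thesis
      using finite_I by (simp only: cexp_add cexp_sum cexp_powi power_int_of_nat)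
  qed
  have each: "((\<lambda>x'. cexp (g x')) has_sum (cexp (g x) * (1 / P))) ((\<lambda>k. x + tr k) ` N)" for x
  proof -
    have "inj_on (\<lambda>k. x + tr k) N"
    proof (rule inj_onI)
      fix k k' assume k: "k \<in> N" "k' \<in> N" "x + tr k = x + tr k'"
      then have "k i = k' i" if "i \<in> I" for i using Utr[OF that, of k] Utr[OF that, of k'] by simp
      with k(1,2) show "k = k'" unfolding N_def by (rule PiE_ext)
    qed
    then show ?thesis
      by (subst has_sum_reindex) (simp_all only: o_def e has_sum_cmult_right[OF S])
  qed
  have "((\<lambda>x'. cexp (g x')) has_sum (\<Sum>x\<in>box y. cexp (g x) * (1 / P))) (\<Union>x\<in>box y. (\<lambda>k. x + tr k) ` N)"
  proof (rule sum_has_sum[OF finite_box[OF y] each])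
    fix x x' assume x: "x \<in> box y" "x' \<in> box y" "x \<noteq> x'"
    show "(\<lambda>k. x + tr k) ` N \<inter> (\<lambda>k. x' + tr k) ` N = {}"
    proof (rule ccontr)
      assume "(\<lambda>k. x + tr k) ` N \<inter> (\<lambda>k. x' + tr k) ` N \<noteq> {}"
      then obtain k k' where "x + tr k = x' + tr k'" by blast
      then have "x - x' = tr k' - tr k" by (simp add: algebra_simps)
      then have "x - x' \<in> sublattice" using trs sublattice_diff by simp
      moreover have "x - x \<in> sublattice" by (simp add: sublattice_def)
      moreover have "x \<in> L" using x by (simp add: box_def)
      ultimately show False using transversal_box[of y] x unfolding transversal_def by blast
    qed
  qed
  moreover have "(\<Union>x\<in>box y. (\<lambda>k. x + tr k) ` N) = shifted_cone y"
  proof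
    show "(\<Union>x\<in>box y. (\<lambda>k. x + tr k) ` N) \<subseteq> shifted_cone y"
      using Utr trs sublattice_subset_L add_L
      by (auto simp: box_def shifted_cone_def inner_add_right add.assoc[symmetric])
    show "shifted_cone y \<subseteq> (\<Union>x\<in>box y. (\<lambda>k. x + tr k) ` N)"
    proof
      fix x assume x: "x \<in> shifted_cone y"
      define k where "k = (\<lambda>i\<in>I. nat \<lfloor>U i \<bullet> (y + x)\<rfloor>)"
      have "x - tr k \<in> box y"
      proof -
        have "U i \<bullet> (y + (x - tr k)) = frac (U i \<bullet> (y + x))" if "i \<in> I" for i
        proof -
          have "0 \<le> U i \<bullet> (y + x)" using x that by (auto simp: shifted_cone_def)
          then have "real (k i) = of_int \<lfloor>U i \<bullet> (y + x)\<rfloor>" using that by (simp add: k_def)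
          then show ?thesis using Utr[OF that, of k] by (simp add: inner_diff_right inner_add_right frac_def)
        qed
        moreover have "x - tr k \<in> L" using x trs sublattice_subset_L diff_L by (auto simp: shifted_cone_def)
        ultimately show ?thesis by (auto simp: box_def frac_lt_1)
      qed
      moreover have "k \<in> N" by (auto simp: k_def N_def)
      ultimately show "x \<in> (\<Union>x\<in>box y. (\<lambda>k. x + tr k) ` N)"
        by (intro UN_I[of "x - tr k"] image_eqI[of _ _ k]) simp_all
    qed
  qed
  moreover have "(\<Sum>x\<in>box y. cexp (g x) * (1 / P)) = cone_series y g"
    by (simp add: cone_series_def P_def sum_divide_distrib)
  ultimately show ?thesis by simp
qed

end

section \<open>The Fourier expansion of a local summand\<close>

lemma has_sum_finite_sum:
  fixes F :: "'i \<Rightarrow> 'b \<Rightarrow> complex"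
  assumes "finite A" "\<And>a. a \<in> A \<Longrightarrow> (F a has_sum s a) B"
  shows "((\<lambda>x. \<Sum>a\<in>A. F a x) has_sum (\<Sum>a\<in>A. s a)) B"
  using assms by (induction A rule: finite_induct) (auto intro!: has_sum_add)

lemma of_real_of_rat: "complex_of_real (of_rat r) = of_rat r"
  by (cases r) (simp add: of_rat_rat)

text \<open>The restriction to \<open>span L\<close> makes this a copy of the group of homomorphisms
  from \<open>L\<close> to the integers, even if the ambient space is larger.\<close>

definition dual_lattice :: "'a::real_inner set \<Rightarrow> 'a set" where
  "dual_lattice L = {m \<in> span L. \<forall>x\<in>L. m \<bullet> x \<in> \<int>}"

text \<open>The vector \<open>y\<close> for which the imaginary part of
  \<open>- w + \<tau> x\<close> equals \<open>Im \<tau>\<close> times \<open>y + x\<close>.\<close>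

definition fourier_shift :: "complex \<Rightarrow> 'a \<times> 'a \<Rightarrow> 'a::real_vector" where
  "fourier_shift \<tau> w = - (1 / Im \<tau>) *\<^sub>R snd w"

context lattice_cone
begin

text \<open>Represents by the inner product the linear function \<ell> with value \<open>d i\<close>
  at \<open>v i\<close>.\<close>

definition divisor_vector :: "('v \<Rightarrow> rat) \<Rightarrow> 'a" where
  "divisor_vector d = (\<Sum>i\<in>I. of_rat (d i) *\<^sub>R U i)"

text \<open>The factor in front is the Fourier mode of \<open>m\<close> at \<open>w\<close>; the
  exponent in the cone series belongs to the character formed from \<ell> and
  \<open>m\<close>.\<close>

definition fourier_coeff :: "complex \<Rightarrow> complex \<Rightarrow> 'a \<times> 'a \<Rightarrow> ('v \<Rightarrow> rat) \<Rightarrow> 'a \<Rightarrow> complex" where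
  "fourier_coeff \<tau> \<sigma> w d m = cexp (- Complex (m \<bullet> fst w) (m \<bullet> snd w)) *
     cone_series (fourier_shift \<tau> w) (\<lambda>x. of_real (divisor_vector d \<bullet> x) * \<sigma> + of_real (m \<bullet> x) * \<tau>)"

definition coordinate :: "'a \<times> 'a \<Rightarrow> 'v \<Rightarrow> complex" where
  "coordinate w i = - Complex (U i \<bullet> fst w) (U i \<bullet> snd w)"

definition local_term :: "complex \<Rightarrow> complex \<Rightarrow> 'a \<times> 'a \<Rightarrow> ('v \<Rightarrow> rat) \<Rightarrow> 'a \<Rightarrow> 'a \<Rightarrow> complex" where
  "local_term \<tau> \<sigma> w d a b = (\<Prod>i\<in>I. cexp (of_rat (d i) * of_real (U i \<bullet> a) * \<sigma>) *
     phi_st (coordinate w i + of_real (U i \<bullet> a) * \<tau> - of_real (U i \<bullet> b)) \<tau> (of_rat (d i) * \<sigma>))"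

lemma independent_v: "independent (v ` I)"
proof (rule independent_if_scalars_zero)
  show "finite (v ` I)" using finite_I by simp
  fix c x assume c: "(\<Sum>x\<in>v ` I. c x *\<^sub>R x) = 0" and "x \<in> v ` I"
  then obtain i where i: "i \<in> I" "x = v i" by blast
  have "(\<Sum>i\<in>I. c (v i) *\<^sub>R v i) = 0" using c by (simp add: sum.reindex[OF inj_v])
  then show "c x = 0" using coord_sum[OF i(1), of "\<lambda>i. c (v i)"] i by simp
qed

lemma dual_basis_eq:
  assumes i: "i \<in> I" and x: "x \<in> span L"
  shows "dual_basis v I i x = U i \<bullet> x"
proof -
  have "dual_basis v I i x = representation (v ` I) (\<Sum>j\<in>I. (U j \<bullet> x) *\<^sub>R v j) (v i)"
    using expand[OF x] by (simp add: dual_basis_def)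
  also have "\<dots> = (\<Sum>j\<in>I. representation (v ` I) ((U j \<bullet> x) *\<^sub>R v j) (v i))"
    by (subst representation_sum[OF independent_v]) (auto intro: span_mul span_base)
  also have "\<dots> = (\<Sum>j\<in>I. (U j \<bullet> x) * (if j = i then 1 else 0))"
  proof (rule sum.cong[OF refl])
    fix j assume j: "j \<in> I"
    have "v j = v i \<longleftrightarrow> j = i" "v i = v j \<longleftrightarrow> j = i" using inj_v i j by (auto simp: inj_on_def)
    then show "representation (v ` I) ((U j \<bullet> x) *\<^sub>R v j) (v i) = (U j \<bullet> x) * (if j = i then 1 else 0)"
      using j by (simp add: representation_scale[OF independent_v] representation_basis[OF independent_v] span_base)
  qed
  also have "\<dots> = U i \<bullet> x" using finite_I i by (simp add: if_distrib[of "\<lambda>x. _ * x"] cong: if_cong)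
  finally show ?thesis .
qed

lemma cpairing_dual_basis:
  assumes w: "fst w \<in> span L" "snd w \<in> span L" and "i \<in> I" "a \<in> L" "b \<in> L"
  shows "cpairing (dual_basis v I i) (- w + ctensor \<tau> a - ctensor 1 b) =
     coordinate w i + of_real (U i \<bullet> a) * \<tau> - of_real (U i \<bullet> b)"
proof -
  have "fst (- w + ctensor \<tau> a - ctensor 1 b) \<in> span L" "snd (- w + ctensor \<tau> a - ctensor 1 b) \<in> span L"
    using assms w by (auto simp: ctensor_def intro!: span_diff span_add span_neg span_mul intro: span_base)
  then show ?thesis
    using \<open>i \<in> I\<close> unfolding cpairing_def
    by (simp add: dual_basis_eq complex_eq_iff ctensor_def inner_add_right inner_diff_right coordinate_def mult.commute)
qed

lemma span_eq_0I:
  assumes "x \<in> span L" and "\<And>i. i \<in> I \<Longrightarrow> x \<bullet> v i = 0"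
  shows "x = 0"
proof -
  have "x \<bullet> x = x \<bullet> (\<Sum>i\<in>I. (U i \<bullet> x) *\<^sub>R v i)" using expand[OF assms(1)] by simp
  also have "\<dots> = 0" using assms(2) by (simp add: inner_sum_right)
  finally show ?thesis by simp
qed

definition from_coords :: "('v \<Rightarrow> int) \<Rightarrow> 'a" where
  "from_coords k = (\<Sum>i\<in>I. of_int (k i) *\<^sub>R U i)"

lemma from_coords_span: "from_coords k \<in> span L"
  unfolding from_coords_def by (intro span_sum span_mul U_span)

lemma from_coords_v: "i \<in> I \<Longrightarrow> from_coords k \<bullet> v i = of_int (k i)"
  unfolding from_coords_def by (rule coord_sum_dual)

lemma from_coords_inner: "from_coords k \<bullet> x = (\<Sum>i\<in>I. of_int (k i) * (U i \<bullet> x))"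
  by (simp add: from_coords_def inner_sum_left)

text \<open>The tuples \<open>k\<close> are the coordinates of the dual of the sublattice, which
  contains the dual of \<open>L\<close>. The remaining tuples are those killed by
  \<open>character_orthogonality\<close>.\<close>

lemma has_sum_dual_lattice:
  assumes "(F has_sum s) (PiE I (\<lambda>_. UNIV))"
    and eq: "\<And>k. F k = (if \<forall>x\<in>L. from_coords k \<bullet> x \<in> \<int> then G (from_coords k) else 0)"
  shows "(G has_sum s) (dual_lattice L)"
proof -
  define K where "K = {k \<in> PiE I (\<lambda>_. UNIV). from_coords k \<in> dual_lattice L}"
  have mem: "from_coords k \<in> dual_lattice L \<longleftrightarrow> (\<forall>x\<in>L. from_coords k \<bullet> x \<in> \<int>)" for k
    using from_coords_span by (simp add: dual_lattice_def)
  have F: "(F has_sum s) K"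
    using assms(1) by (subst has_sum_cong_neutral[of _ _ _ F]) (auto simp: K_def mem eq)
  \<comment> \<open>The inverse of \<open>from_coords\<close>; the floor only converts numbers that
    are already integers on \<open>dual_lattice L\<close>.\<close>
  define j where "j = (\<lambda>m. \<lambda>i\<in>I. \<lfloor>m \<bullet> v i\<rfloor>)"
  have jv: "of_int (j m i) = m \<bullet> v i" if "m \<in> dual_lattice L" "i \<in> I" for m i
  proof -
    have "m \<bullet> v i \<in> \<int>" using that v_in_L by (simp add: dual_lattice_def)
    then show ?thesis using that by (simp add: j_def)
  qed
  have cj: "from_coords (j m) = m" if m: "m \<in> dual_lattice L" for m
  proof -
    have "from_coords (j m) - m = 0"
      by (rule span_eq_0I)
        (use m from_coords_span in \<open>auto simp: dual_lattice_def inner_diff_left from_coords_v jv[OF m] intro: span_diff\<close>)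
    then show ?thesis by simp
  qed
  have jc: "j (from_coords k) = k" if "k \<in> K" for k
    by (rule PiE_ext[of _ I "\<lambda>_. UNIV"]) (use that in \<open>auto simp: K_def j_def from_coords_v\<close>)
  show ?thesis
  proof (subst has_sum_reindex_bij_witness[of "dual_lattice L" from_coords j K F G s s])
    show "j m \<in> K" if "m \<in> dual_lattice L" for m using that cj by (auto simp: K_def j_def)
    show "F (j m) = G m" if "m \<in> dual_lattice L" for m
      unfolding eq cj[OF that] using that by (simp add: dual_lattice_def)
    show "from_coords k \<in> dual_lattice L" if "k \<in> K" for k using that by (simp add: K_def)
  qed (use cj jc F in auto)
qed

context
  fixes \<tau> \<sigma> :: complex and w :: "'a \<times> 'a" and d :: "'v \<Rightarrow> rat"
  assumes tau: "Im \<tau> > 0"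
    and d: "\<And>i. i \<in> I \<Longrightarrow> of_rat (d i) * \<sigma> \<notin> period_lattice \<tau>"
    and w: "fst w \<in> span L" "snd w \<in> span L"
begin

text \<open>If a coordinate of \<open>a\<close> changes by an integer, \<open>phi_st\<close>
  acquires a multiplier that the exponential in front cancels. A change of \<open>b\<close> shifts
  the argument by integers, which are periods.\<close>

lemma local_term_cong:
  assumes "a - a' \<in> sublattice" "b - b' \<in> sublattice"
  shows "local_term \<tau> \<sigma> w d a b = local_term \<tau> \<sigma> w d a' b'"
  unfolding local_term_def
proof (rule prod.cong[OF refl])
  fix i assume i: "i \<in> I"
  have "U i \<bullet> (a - a') \<in> \<int>" using assms(1) i sublattice_iff by blast
  then obtain m where "U i \<bullet> (a - a') = of_int m" by (rule Ints_cases)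
  then have m: "U i \<bullet> a = U i \<bullet> a' + of_int m" by (simp add: inner_diff_right)
  have "U i \<bullet> (b' - b) \<in> \<int>" using sublattice_uminus[OF assms(2)] i sublattice_iff by simp
  then obtain n where "U i \<bullet> (b' - b) = of_int n" by (rule Ints_cases)
  then have n: "U i \<bullet> b = U i \<bullet> b' - of_int n" by (simp add: inner_diff_right)
  let ?z = "coordinate w i + of_real (U i \<bullet> a') * \<tau> - of_real (U i \<bullet> b')"
  have z: "coordinate w i + of_real (U i \<bullet> a) * \<tau> - of_real (U i \<bullet> b) = (?z + of_int m * \<tau>) + of_int n"
    by (simp add: m n algebra_simps)
  have c: "of_rat (d i) * of_real (U i \<bullet> a) * \<sigma> =
      of_rat (d i) * of_real (U i \<bullet> a') * \<sigma> + of_int m * (of_rat (d i) * \<sigma>)"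
    by (simp add: m algebra_simps)
  show "cexp (of_rat (d i) * of_real (U i \<bullet> a) * \<sigma>) *
     phi_st (coordinate w i + of_real (U i \<bullet> a) * \<tau> - of_real (U i \<bullet> b)) \<tau> (of_rat (d i) * \<sigma>) =
     cexp (of_rat (d i) * of_real (U i \<bullet> a') * \<sigma>) * phi_st ?z \<tau> (of_rat (d i) * \<sigma>)"
    unfolding z c phi_st_add_int[OF tau] phi_st_add_tau_int[OF tau] cexp_add
    by (simp add: cexp_minus)
qed

lemma sum_quotient_local_term:
  assumes T: "transversal T"
  shows "(\<Sum>(h1, h2)\<in>quotient_group L v I \<times> quotient_group L v I.
      \<Prod>i\<in>I. cexp (of_rat (d i) * of_real (dual_basis v I i (coset_rep h1)) * \<sigma>) *
        phi_st (cpairing (dual_basis v I i) (- w + ctensor \<tau> (coset_rep h1) - ctensor 1 (coset_rep h2))) \<tau>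
          (of_rat (d i) * \<sigma>)) = (\<Sum>a\<in>T. \<Sum>b\<in>T. local_term \<tau> \<sigma> w d a b)"
proof -
  let ?Q = "quotient_group L v I"
  have QL: "coset_rep h \<in> L" if "h \<in> ?Q" for h
    using transversal_coset_rep(1) that by (auto simp: transversal_def)
  have zero: "x - x \<in> sublattice" for x by (simp add: sublattice_def)
  have "(\<Sum>(h1, h2)\<in>?Q \<times> ?Q.
      \<Prod>i\<in>I. cexp (of_rat (d i) * of_real (dual_basis v I i (coset_rep h1)) * \<sigma>) *
        phi_st (cpairing (dual_basis v I i) (- w + ctensor \<tau> (coset_rep h1) - ctensor 1 (coset_rep h2))) \<tau>
          (of_rat (d i) * \<sigma>)) = (\<Sum>(h1, h2)\<in>?Q \<times> ?Q. local_term \<tau> \<sigma> w d (coset_rep h1) (coset_rep h2))"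
  proof (rule sum.cong[OF refl], clarify)
    fix h1 h2 assume "h1 \<in> ?Q" "h2 \<in> ?Q"
    then show "(\<Prod>i\<in>I. cexp (of_rat (d i) * of_real (dual_basis v I i (coset_rep h1)) * \<sigma>) *
        phi_st (cpairing (dual_basis v I i) (- w + ctensor \<tau> (coset_rep h1) - ctensor 1 (coset_rep h2))) \<tau>
          (of_rat (d i) * \<sigma>)) = local_term \<tau> \<sigma> w d (coset_rep h1) (coset_rep h2)"
      unfolding local_term_def
      by (intro prod.cong refl) (simp only: cpairing_dual_basis[OF w] QL dual_basis_eq span_base)
  qed
  also have "\<dots> = (\<Sum>h1\<in>?Q. \<Sum>h2\<in>?Q. local_term \<tau> \<sigma> w d (coset_rep h1) (coset_rep h2))"
    by (simp add: sum.cartesian_product)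
  also have "\<dots> = (\<Sum>h1\<in>?Q. \<Sum>b\<in>T. local_term \<tau> \<sigma> w d (coset_rep h1) b)"
    by (intro sum.cong refl sum_quotient_group[OF T] local_term_cong zero)
  also have "\<dots> = (\<Sum>a\<in>T. \<Sum>b\<in>T. local_term \<tau> \<sigma> w d a b)"
    by (rule sum_quotient_group[OF T, of "\<lambda>a. \<Sum>b\<in>T. local_term \<tau> \<sigma> w d a b"])
      (intro sum.cong refl local_term_cong zero)
  finally show ?thesis .
qed

text \<open>The product over \<open>i\<close> of the Kronecker series is a series over integer
  tuples \<open>k\<close>. Summed over \<open>b\<close>, its terms vanish unless
  \<open>from_coords k\<close> is integral on \<open>L\<close>, and summed over \<open>a\<close>
  they become cone series.\<close>

lemma local_genus_has_sum:
  assumes generic: "\<And>a i. a \<in> L \<Longrightarrow> i \<in> I \<Longrightarrow> U i \<bullet> (fourier_shift \<tau> w + a) \<noteq> 0"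
  shows "(fourier_coeff \<tau> \<sigma> w d has_sum
    (1 / of_nat (card (quotient_group L v I)) *
    (\<Sum>(h1, h2)\<in>quotient_group L v I \<times> quotient_group L v I.
      \<Prod>i\<in>I. cexp (of_rat (d i) * of_real (dual_basis v I i (coset_rep h1)) * \<sigma>) *
        phi_st (cpairing (dual_basis v I i) (- w + ctensor \<tau> (coset_rep h1) - ctensor 1 (coset_rep h2))) \<tau>
          (of_rat (d i) * \<sigma>)))) (dual_lattice L)"
proof -
  define T where "T = box (fourier_shift \<tau> w)"
  have shift_span: "fourier_shift \<tau> w \<in> span L" unfolding fourier_shift_def by (intro span_mul w)
  have T: "transversal T" unfolding T_def by (rule transversal_box)
  have finT: "finite T" and T0: "T \<noteq> {}" using finite_transversal[OF T] transversal_nonempty[OF T] .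
  define arg where "arg = (\<lambda>a b i. coordinate w i + of_real (U i \<bullet> a) * \<tau> - of_real (U i \<bullet> b))"
  define h where "h = (\<lambda>a b i k. cexp (of_rat (d i) * of_real (U i \<bullet> a) * \<sigma>) *
     (cexp (of_int k * arg a b i) / (1 - cexp (of_rat (d i) * \<sigma> + of_int k * \<tau>))))"
  have hs: "((\<lambda>k. \<Prod>i\<in>I. h a b i (k i)) has_sum local_term \<tau> \<sigma> w d a b) (PiE I (\<lambda>_. UNIV))"
    if a: "a \<in> T" for a b
  proof -
    have "Im (arg a b i) = Im \<tau> * (U i \<bullet> (fourier_shift \<tau> w + a))" for i
      using tau by (simp add: arg_def coordinate_def fourier_shift_def inner_add_right algebra_simps)
    \<comment> \<open>The box admits the coordinate 0, which lies on the boundary of the strip;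
      genericity excludes it.\<close>
    moreover have "0 < U i \<bullet> (fourier_shift \<tau> w + a)" "U i \<bullet> (fourier_shift \<tau> w + a) < 1" if "i \<in> I" for i
      using a generic[of a i] that by (force simp: T_def box_def)+
    ultimately have im: "0 < Im (arg a b i)" "Im (arg a b i) < Im \<tau>" if "i \<in> I" for i
      using tau that by simp_all
    have "((\<lambda>k. \<Prod>i\<in>I. h a b i (k i)) has_sum (\<Prod>i\<in>I. infsum (h a b i) UNIV)) (PiE I (\<lambda>_. UNIV))"
    proof (rule has_sum_prod_PiE[OF finite_I])
      fix i assume i: "i \<in> I"
      show "(\<lambda>k. norm (h a b i k)) summable_on UNIV"
        unfolding h_def norm_mult
        by (intro summable_on_cmult_right) (use phi_st_kronecker(1)[OF tau d[OF i] im[OF i]] in \<open>simp add: norm_divide norm_mult\<close>)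
    qed
    moreover have "infsum (h a b i) UNIV = cexp (of_rat (d i) * of_real (U i \<bullet> a) * \<sigma>) * phi_st (arg a b i) \<tau> (of_rat (d i) * \<sigma>)"
      if i: "i \<in> I" for i
      unfolding h_def infsum_cmult_right' phi_st_kronecker(2)[OF tau d[OF i] im[OF i]] ..
    ultimately show ?thesis by (simp add: local_term_def arg_def cong: prod.cong)
  qed
  have "((\<lambda>k. (1 / of_nat (card T)) * (\<Sum>a\<in>T. \<Sum>b\<in>T. \<Prod>i\<in>I. h a b i (k i))) has_sum
      (1 / of_nat (card T)) * (\<Sum>a\<in>T. \<Sum>b\<in>T. local_term \<tau> \<sigma> w d a b)) (PiE I (\<lambda>_. UNIV))"
    by (intro has_sum_cmult_right has_sum_finite_sum finT hs)
  then have "(fourier_coeff \<tau> \<sigma> w d has_sum (1 / of_nat (card T)) * (\<Sum>a\<in>T. \<Sum>b\<in>T. local_term \<tau> \<sigma> w d a b)) (dual_lattice L)"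
  proof (rule has_sum_dual_lattice)
    fix k :: "'v \<Rightarrow> int"
    define m where "m = from_coords k"
    let ?g = "\<lambda>x. of_real (divisor_vector d \<bullet> x) * \<sigma> + of_real (m \<bullet> x) * \<tau>"
    define P where "P = (\<Prod>i\<in>I. 1 - cexp (?g (v i)))"
    have gv: "?g (v i) = of_rat (d i) * \<sigma> + of_int (k i) * \<tau>" if "i \<in> I" for i
      using that unfolding m_def divisor_vector_def by (simp add: coord_sum_dual from_coords_v of_real_of_rat)
    have hprod: "(\<Prod>i\<in>I. h a b i (k i)) =
       cexp (- Complex (m \<bullet> fst w) (m \<bullet> snd w)) * (cexp (?g a) / P) * cexp (- of_real (m \<bullet> b))" for a b
    proof -
      have "h a b i (k i) = cexp (of_rat (d i) * of_real (U i \<bullet> a) * \<sigma> + of_int (k i) * arg a b i) / (1 - cexp (?g (v i)))"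
        if "i \<in> I" for i unfolding h_def gv[OF that] by (simp add: cexp_add)
      then have "(\<Prod>i\<in>I. h a b i (k i)) =
         cexp (\<Sum>i\<in>I. of_rat (d i) * of_real (U i \<bullet> a) * \<sigma> + of_int (k i) * arg a b i) / P"
        using finite_I by (simp add: P_def cexp_sum prod_dividef)
      also have "(\<Sum>i\<in>I. of_rat (d i) * of_real (U i \<bullet> a) * \<sigma> + of_int (k i) * arg a b i) =
         - Complex (m \<bullet> fst w) (m \<bullet> snd w) + ?g a + (- of_real (m \<bullet> b))"
      proof -
        have 1: "of_real (divisor_vector d \<bullet> a) * \<sigma> = (\<Sum>i\<in>I. of_rat (d i) * of_real (U i \<bullet> a) * \<sigma>)"
          by (simp add: divisor_vector_def inner_sum_left sum_distrib_right of_real_of_rat)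
        have 2: "of_real (m \<bullet> x) = (\<Sum>i\<in>I. of_int (k i) * complex_of_real (U i \<bullet> x))" for x
          by (simp add: m_def from_coords_inner)
        have 3: "Complex (m \<bullet> fst w) (m \<bullet> snd w) = of_real (m \<bullet> fst w) + \<i> * of_real (m \<bullet> snd w)"
          by (simp add: complex_eq_iff)
        have 4: "coordinate w i = - (of_real (U i \<bullet> fst w) + \<i> * of_real (U i \<bullet> snd w))" for i
          by (simp add: coordinate_def complex_eq_iff)
        show ?thesis
          unfolding 1 2 3 arg_def 4
          by (simp add: sum.distrib sum_distrib_left sum_distrib_right sum_subtractf sum_negf algebra_simps)
      qed
      finally show ?thesis unfolding cexp_add by simp
    qed
    \<comment> \<open>The sum over \<open>a\<close> is the numerator of \<open>cone_series\<close>.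
      The sum over \<open>b\<close> is a character sum, whose value \<open>card T\<close> cancels
      the factor in front.\<close>
    have "(\<Sum>a\<in>T. \<Sum>b\<in>T. \<Prod>i\<in>I. h a b i (k i)) =
        cexp (- Complex (m \<bullet> fst w) (m \<bullet> snd w)) * ((\<Sum>a\<in>T. cexp (?g a)) / P) * (\<Sum>b\<in>T. cexp (- of_real (m \<bullet> b)))"
      unfolding hprod by (simp only: sum_divide_distrib mult.assoc sum_product) (simp only: sum_distrib_left)
    also have "\<dots> = fourier_coeff \<tau> \<sigma> w d m * (\<Sum>b\<in>T. cexp (- of_real (m \<bullet> b)))"
      by (simp add: fourier_coeff_def cone_series_def T_def P_def)
    also have "(\<Sum>b\<in>T. cexp (- of_real (m \<bullet> b))) = (if \<forall>x\<in>L. m \<bullet> x \<in> \<int> then of_nat (card T) else 0)"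
      by (rule character_orthogonality[OF T]) (simp add: m_def from_coords_v)
    finally show "(1 / of_nat (card T)) * (\<Sum>a\<in>T. \<Sum>b\<in>T. \<Prod>i\<in>I. h a b i (k i)) =
        (if \<forall>x\<in>L. from_coords k \<bullet> x \<in> \<int> then fourier_coeff \<tau> \<sigma> w d (from_coords k) else 0)"
      using finT T0 unfolding m_def by simp
  qed
  then show ?thesis
    unfolding sum_quotient_local_term[OF T] card_quotient_group[OF T] .
qed

end

end

section \<open>Additivity of the generating function under subdivision\<close>

text \<open>Both sides are replaced by their values at \<open>g + s p\<close>, where \<open>p\<close> is positive on the cone. For large
  \<open>Im s\<close> they are convergent sums over lattice points; the identity theorem leads back to \<open>s = 0\<close>.\<close>

lemma cone_series_additive:
  assumes cone: "lattice_cone L I v U"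
    and fin: "finite J" and cones: "\<And>K. K \<in> J \<Longrightarrow> lattice_cone L K v' (U' K)"
    and nonneg: "\<And>K i j. K \<in> J \<Longrightarrow> i \<in> I \<Longrightarrow> j \<in> K \<Longrightarrow> 0 \<le> U i \<bullet> v' j"
    and y: "y \<in> span L"
    and un: "(\<Union>K\<in>J. lattice_cone.shifted_cone L K (U' K) y) = lattice_cone.shifted_cone L I U y"
    and disj: "\<And>K K'. K \<in> J \<Longrightarrow> K' \<in> J \<Longrightarrow> K \<noteq> K' \<Longrightarrow>
      lattice_cone.shifted_cone L K (U' K) y \<inter> lattice_cone.shifted_cone L K' (U' K') y = {}"
    and g: "linear g" and nz: "\<And>i. i \<in> I \<Longrightarrow> cexp (g (v i)) \<noteq> 1"
    and nz': "\<And>K i. K \<in> J \<Longrightarrow> i \<in> K \<Longrightarrow> cexp (g (v' i)) \<noteq> 1"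
  shows "(\<Sum>K\<in>J. lattice_cone.cone_series L K v' (U' K) y g) = lattice_cone.cone_series L I v U y g"
proof -
  interpret lattice_cone L I v U by (rule cone)
  \<comment> \<open>Sum of the coordinates: 1 at each \<open>v i\<close>, and positive at each
    \<open>v' j\<close> because the coordinates of this nonzero vector are nonnegative.\<close>
  define p where "p = (\<Sum>i\<in>I. U i)"
  have pv: "p \<bullet> v i = 1" if "i \<in> I" for i
    using coord_sum_dual[OF that, of "\<lambda>_. 1"] by (simp add: p_def)
  have pv': "p \<bullet> v' j > 0" if K: "K \<in> J" and j: "j \<in> K" for K j
  proof -
    interpret K: lattice_cone L K v' "U' K" by (rule cones[OF K])
    have "v' j \<noteq> 0" using K.dual[OF j j] by auto
    have "\<exists>i\<in>I. U i \<bullet> v' j \<noteq> 0"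
    proof (rule ccontr)
      assume "\<not> (\<exists>i\<in>I. U i \<bullet> v' j \<noteq> 0)"
      then have "(\<Sum>i\<in>I. (U i \<bullet> v' j) *\<^sub>R v i) = 0" by simp
      then show False using expand[of "v' j"] K.v_in_L[OF j] span_base \<open>v' j \<noteq> 0\<close> by metis
    qed
    then obtain i where "i \<in> I" "U i \<bullet> v' j \<noteq> 0" by blast
    then have "0 < (\<Sum>i\<in>I. U i \<bullet> v' j)"
      using nonneg[OF K _ j] finite_I by (intro sum_pos2[of I i]) (auto simp: less_le)
    then show ?thesis by (simp add: p_def inner_sum_left)
  qed
  define V where "V = v ` I \<union> (\<Union>K\<in>J. v' ` K)"
  have finV: "finite V"
    using finite_I fin lattice_cone.finite_I[OF cones] by (auto simp: V_def)
  have pV: "p \<bullet> x > 0" if "x \<in> V" for x using that pv pv' by (auto simp: V_def)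
  define G where "G = (\<lambda>s x. g x + s * of_real (p \<bullet> x))"
  have linG: "linear (G s)" for s
    by (rule linearI) (simp_all add: G_def linear_add[OF g] linear_cmul[OF g] inner_add_right
        distrib_left scaleR_conv_of_real)
  \<comment> \<open>The parameters at which no denominator of either side vanishes.\<close>
  define S where "S = {s. \<forall>x\<in>V. cexp (G s x) \<noteq> 1}"
  define A where "A = (\<lambda>s. (\<Sum>K\<in>J. lattice_cone.cone_series L K v' (U' K) y (G s)) - cone_series y (G s))"
  \<comment> \<open>Beyond this height the term \<open>s * (p \<bullet> x)\<close> outweighs
    \<open>Im (g x)\<close> at every generator, so all the geometric series converge.\<close>
  define R where "R = (\<Sum>x\<in>V. \<bar>Im (g x)\<bar> / (p \<bullet> x))"
  have Rpos: "Im (G s x) > 0" if s: "Im s > R" and x: "x \<in> V" for s x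
  proof -
    have "\<bar>Im (g x)\<bar> / (p \<bullet> x) \<le> R"
      unfolding R_def using finV x pV by (intro member_le_sum) (auto intro!: divide_nonneg_pos)
    then have "\<bar>Im (g x)\<bar> < Im s * (p \<bullet> x)" using s pV[OF x] by (simp add: pos_divide_le_eq[symmetric] pos_divide_less_eq[symmetric])
    then show ?thesis by (simp add: G_def)
  qed
  have US: "{s. Im s > R} \<subseteq> S"
  proof
    fix s assume s: "s \<in> {s. Im s > R}"
    have "cexp (G s x) \<noteq> 1" if x: "x \<in> V" for x
    proof -
      have "norm (cexp (G s x)) < 1" using Rpos[OF _ x] s by (simp add: norm_cexp)
      then show ?thesis by auto
    qed
    then show "s \<in> S" by (simp add: S_def)
  qed
  have zero: "A s = 0" if s: "Im s > R" for s
  proof -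
    have "((\<lambda>x. cexp (G s x)) has_sum cone_series y (G s)) (shifted_cone y)"
      by (rule cone_series_has_sum[OF linG _ y]) (use Rpos[OF s] in \<open>auto simp: V_def\<close>)
    moreover have "((\<lambda>x. cexp (G s x)) has_sum (\<Sum>K\<in>J. lattice_cone.cone_series L K v' (U' K) y (G s)))
        (\<Union>K\<in>J. lattice_cone.shifted_cone L K (U' K) y)"
    proof (rule sum_has_sum[OF fin _ disj])
      fix K assume K: "K \<in> J"
      interpret K: lattice_cone L K v' "U' K" by (rule cones[OF K])
      show "((\<lambda>x. cexp (G s x)) has_sum K.cone_series y (G s)) (K.shifted_cone y)"
        by (rule K.cone_series_has_sum[OF linG _ y]) (use Rpos[OF s] K in \<open>auto simp: V_def\<close>)
    qed
    ultimately show ?thesis unfolding A_def un using has_sum_unique by auto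
  qed
  have openS: "open S"
  proof -
    have "open {s. cexp (G s x) \<noteq> 1}" for x
    proof -
      have "continuous_on UNIV (\<lambda>s. cexp (G s x))"
        unfolding cexp_def G_def by (intro continuous_intros)
      then have "open ((\<lambda>s. cexp (G s x)) -` (- {1}))" by (intro open_vimage) auto
      then show ?thesis by (simp add: vimage_def)
    qed
    moreover have "S = (\<Inter>x\<in>V. {s. cexp (G s x) \<noteq> 1})" by (auto simp: S_def)
    ultimately show ?thesis using finV by auto
  qed
  have connS: "connected S"
  proof -
    \<comment> \<open>For given \<open>x\<close> and \<open>n\<close> the equation is affine in
      \<open>s\<close> with nonzero slope \<open>p \<bullet> x\<close>, so it has at most one
      solution. A plane minus a countable set is connected.\<close>
    have "countable (\<Union>x\<in>V. \<Union>n. {s. G s x = of_int n})"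
    proof (intro countable_UN countable_finite[OF finV] countableI_type)
      fix x and n :: int assume x: "x \<in> V"
      have "{s. G s x = of_int n} \<subseteq> {(of_int n - g x) / of_real (p \<bullet> x)}"
        using pV[OF x] by (auto simp: G_def field_simps)
      then show "countable {s. G s x = of_int n}" using countable_subset by blast
    qed
    then have "connected (UNIV - (\<Union>x\<in>V. \<Union>n. {s. G s x = of_int n}))"
      by (intro connected_open_diff_countable) auto
    moreover have "UNIV - (\<Union>x\<in>V. \<Union>n. {s. G s x = of_int n}) = S"
      by (auto simp: S_def cexp_eq_1_iff elim!: Ints_cases)
    ultimately show ?thesis by simp
  qed
  have holA: "A holomorphic_on S"
  proof -
    have hG: "(\<lambda>s. cexp (G s x)) holomorphic_on S" for x
      unfolding cexp_def G_def by (intro holomorphic_intros)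
    have "(\<lambda>s. cone_series y (G s)) holomorphic_on S"
      unfolding cone_series_def using finite_I
      by (intro holomorphic_intros hG) (auto simp: S_def V_def)
    moreover have "(\<lambda>s. lattice_cone.cone_series L K v' (U' K) y (G s)) holomorphic_on S" if K: "K \<in> J" for K
    proof -
      interpret K: lattice_cone L K v' "U' K" by (rule cones[OF K])
      show ?thesis
        unfolding K.cone_series_def using K.finite_I K
        by (intro holomorphic_intros hG) (auto simp: S_def V_def)
    qed
    ultimately show ?thesis unfolding A_def by (intro holomorphic_intros)
  qed
  have "A 0 = 0"
  proof (rule analytic_continuation[OF holA openS connS US])
    show "\<i> * of_real (R + 1) \<in> S" using US by auto
    have "open {s. Im s > R}" by (rule open_halfspace_Im_gt)
    then show "\<i> * of_real (R + 1) islimpt {s. Im s > R}"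
      by (intro interior_limit_point) (simp add: interior_open)
    show "0 \<in> S" using nz nz' by (auto simp: S_def G_def V_def)
  qed (use zero in auto)
  moreover have "G 0 = g" by (simp add: G_def fun_eq_iff)
  ultimately show ?thesis by (simp add: A_def)
qed

section \<open>Cones of a simplicial multi-fan\<close>

lemma convex_cone_hull_finite:
  fixes S :: "'a::real_vector set"
  assumes "finite S"
  shows "convex_cone hull S = {x. \<exists>c. (\<forall>s\<in>S. 0 \<le> c s) \<and> x = (\<Sum>s\<in>S. c s *\<^sub>R s)}" (is "_ = ?R")
proof
  have cc: "convex_cone ?R"
    unfolding convex_cone_iff
  proof (intro conjI ballI allI impI)
    show "0 \<in> ?R" by (auto intro!: exI[of _ "\<lambda>_. 0"])
    fix x y assume "x \<in> ?R" "y \<in> ?R"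
    then obtain c d where "\<forall>s\<in>S. 0 \<le> c s" "x = (\<Sum>s\<in>S. c s *\<^sub>R s)"
      "\<forall>s\<in>S. 0 \<le> d s" "y = (\<Sum>s\<in>S. d s *\<^sub>R s)" by auto
    then show "x + y \<in> ?R"
      by (auto intro!: exI[of _ "\<lambda>s. c s + d s"] simp: scaleR_add_left sum.distrib)
  next
    fix x and e :: real assume "x \<in> ?R" "0 \<le> e"
    then obtain c where "\<forall>s\<in>S. 0 \<le> c s" "x = (\<Sum>s\<in>S. c s *\<^sub>R s)" by auto
    then show "e *\<^sub>R x \<in> ?R"
      using \<open>0 \<le> e\<close> by (auto intro!: exI[of _ "\<lambda>s. e * c s"] simp: scaleR_sum_right)
  qed
  have "S \<subseteq> ?R"
  proof
    fix s assume s: "s \<in> S"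
    have "(\<Sum>r\<in>S. (if r = s then 1 else 0) *\<^sub>R r) = (\<Sum>r\<in>S. if r = s then r else 0)"
      by (rule sum.cong) auto
    also have "\<dots> = s" using assms s by simp
    finally show "s \<in> ?R" by (auto intro!: exI[of _ "\<lambda>r. if r = s then 1 else 0"])
  qed
  then show "convex_cone hull S \<subseteq> ?R" using cc by (rule hull_minimal)
  show "?R \<subseteq> convex_cone hull S"
  proof
    fix x assume "x \<in> ?R"
    then obtain c where c: "\<forall>s\<in>S. 0 \<le> c s" "x = (\<Sum>s\<in>S. c s *\<^sub>R s)" by auto
    have "(\<Sum>s\<in>S'. c s *\<^sub>R s) \<in> convex_cone hull S" if "S' \<subseteq> S" for S'
      using finite_subset[OF that assms] that
    proof (induction S' rule: finite_induct)
      case (insert s F)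
      then have "c s *\<^sub>R s \<in> convex_cone hull S"
        using c by (intro convex_cone_hull_mul hull_inc) auto
      then show ?case using insert by (simp add: convex_cone_hull_add)
    qed (simp add: convex_cone_hull_contains_0)
    then show "x \<in> convex_cone hull S" using c by auto
  qed
qed

lemma convex_cone_hull_image:
  fixes v :: "'v \<Rightarrow> 'a::real_vector"
  assumes "finite T" "inj_on v T"
  shows "x \<in> convex_cone hull (v ` T) \<longleftrightarrow> (\<exists>c. (\<forall>t\<in>T. 0 \<le> c t) \<and> x = (\<Sum>t\<in>T. c t *\<^sub>R v t))"
proof -
  have "x \<in> convex_cone hull (v ` T) \<longleftrightarrow> (\<exists>c. (\<forall>t\<in>T. 0 \<le> c (v t)) \<and> x = (\<Sum>t\<in>T. c (v t) *\<^sub>R v t))"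
    using assms by (simp add: convex_cone_hull_finite sum.reindex)
  also have "\<dots> \<longleftrightarrow> (\<exists>c. (\<forall>t\<in>T. 0 \<le> c t) \<and> x = (\<Sum>t\<in>T. c t *\<^sub>R v t))"
  proof
    assume "\<exists>c. (\<forall>t\<in>T. 0 \<le> c (v t)) \<and> x = (\<Sum>t\<in>T. c (v t) *\<^sub>R v t)"
    then obtain c where "\<forall>t\<in>T. 0 \<le> c (v t)" "x = (\<Sum>t\<in>T. c (v t) *\<^sub>R v t)" by blast
    then show "\<exists>c. (\<forall>t\<in>T. 0 \<le> c t) \<and> x = (\<Sum>t\<in>T. c t *\<^sub>R v t)"
      by (intro exI[of _ "\<lambda>t. c (v t)"] conjI)
  next
    assume "\<exists>c. (\<forall>t\<in>T. 0 \<le> c t) \<and> x = (\<Sum>t\<in>T. c t *\<^sub>R v t)"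
    then obtain c where "\<forall>t\<in>T. 0 \<le> c t" "x = (\<Sum>t\<in>T. c t *\<^sub>R v t)" by blast
    then show "\<exists>c. (\<forall>t\<in>T. 0 \<le> c (v t)) \<and> x = (\<Sum>t\<in>T. c (v t) *\<^sub>R v t)"
      by (intro exI[of _ "\<lambda>s. c (the_inv_into T v s)"] conjI)
        (simp_all add: the_inv_into_f_f[OF assms(2)])
  qed
  finally show ?thesis .
qed

text \<open>Supplies generators whose rays are faces, since the axioms of a multi-fan describe the
  cones only through their faces.\<close>

lemma pointed_cone_extremal_generators:
  fixes K :: "'a::euclidean_space set"
  assumes S: "finite S" "K = convex_cone hull S" and pointed: "strongly_convex K"
  obtains T where "finite T" "K = convex_cone hull T"
    "\<And>s. s \<in> T \<Longrightarrow> s \<noteq> 0" "\<And>s. s \<in> T \<Longrightarrow> {c *\<^sub>R s |c. 0 \<le> c} face_of K"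
proof -
  define P where "P = (\<lambda>T. finite T \<and> K = convex_cone hull T)"
  \<comment> \<open>In a set of generators of minimal cardinality every element spans an extremal ray.\<close>
  define T where "T = arg_min card P"
  have PT: "P T" and minT: "\<And>T'. P T' \<Longrightarrow> card T \<le> card T'"
    using arg_min_nat_lemma[of P S card] S unfolding P_def T_def by auto
  have finT: "finite T" and KT: "K = convex_cone hull T" using PT by (auto simp: P_def)
  have cc: "convex_cone K" unfolding KT by (rule convex_cone_convex_cone_hull)
  have TK: "T \<subseteq> K" unfolding KT by (rule hull_subset)
  have Kadd: "x + y \<in> K" if "x \<in> K" "y \<in> K" for x y using cc that by (rule convex_cone_add)
  have Kmul: "c *\<^sub>R x \<in> K" if "x \<in> K" "0 \<le> c" for x c using cc that by (intro convex_cone_scaleR)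
  have K0: "0 \<in> K" using cc by (rule convex_cone_contains_0)
  have point: "x = 0" if "x \<in> K" "- x \<in> K" for x
  proof -
    have "x \<in> K \<inter> uminus ` K" using that by (auto intro!: image_eqI[of _ _ "- x"])
    then show ?thesis using pointed unfolding strongly_convex_def by blast
  qed
  have minimal: "s \<notin> convex_cone hull (T - {s})" if s: "s \<in> T" for s
  proof
    assume a: "s \<in> convex_cone hull (T - {s})"
    have "T \<subseteq> convex_cone hull (T - {s})" using a hull_subset[of "T - {s}" convex_cone] by auto
    then have "convex_cone hull T \<subseteq> convex_cone hull (T - {s})"
      by (rule hull_minimal) (rule convex_cone_convex_cone_hull)
    moreover have "convex_cone hull (T - {s}) \<subseteq> convex_cone hull T" by (rule hull_mono) auto
    ultimately have "P (T - {s})" using finT KT by (simp add: P_def)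
    then have "card T \<le> card (T - {s})" by (rule minT)
    then show False using card_Diff1_less[OF finT s] by simp
  qed
  have nz: "s \<noteq> 0" if "s \<in> T" for s
    using minimal[OF that] convex_cone_hull_contains_0 by metis
  have ray: "\<exists>e\<ge>0. a = e *\<^sub>R s" if s: "s \<in> T" and ab: "a \<in> K" "b \<in> K" "a + b = c *\<^sub>R s" "c \<ge> 0" for s a b c
  proof -
    obtain \<alpha> where \<alpha>: "\<forall>t\<in>T. 0 \<le> \<alpha> t" "a = (\<Sum>t\<in>T. \<alpha> t *\<^sub>R t)"
      using ab(1) unfolding KT convex_cone_hull_finite[OF finT] by blast
    obtain \<beta> where \<beta>: "\<forall>t\<in>T. 0 \<le> \<beta> t" "b = (\<Sum>t\<in>T. \<beta> t *\<^sub>R t)"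
      using ab(2) unfolding KT convex_cone_hull_finite[OF finT] by blast
    define a' where "a' = (\<Sum>t\<in>T-{s}. \<alpha> t *\<^sub>R t)"
    define b' where "b' = (\<Sum>t\<in>T-{s}. \<beta> t *\<^sub>R t)"
    have a: "a = \<alpha> s *\<^sub>R s + a'" unfolding \<alpha>(2) a'_def by (rule sum.remove[OF finT s])
    have b: "b = \<beta> s *\<^sub>R s + b'" unfolding \<beta>(2) b'_def by (rule sum.remove[OF finT s])
    have a'H: "a' \<in> convex_cone hull (T - {s})" and b'H: "b' \<in> convex_cone hull (T - {s})"
      using finT \<alpha>(1) \<beta>(1) by (auto simp: convex_cone_hull_finite a'_def b'_def)
    have HK: "convex_cone hull (T - {s}) \<subseteq> K" unfolding KT by (rule hull_mono) auto
    \<comment> \<open>The coefficients of \<open>s\<close> are compared. A positive \<open>r\<close>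
      would express \<open>s\<close> by the other generators, against minimality; otherwise
      \<open>- a'\<close> lies in \<open>K\<close>, and pointedness gives
      \<open>a' = 0\<close>.\<close>
    define r where "r = c - \<alpha> s - \<beta> s"
    have r: "r *\<^sub>R s = a' + b'" using ab(3) unfolding a b r_def by (simp add: algebra_simps)
    have "r \<le> 0"
    proof (rule ccontr)
      assume "\<not> r \<le> 0"
      then have "s = (1 / r) *\<^sub>R (a' + b')" using r[symmetric] by simp
      also have "\<dots> \<in> convex_cone hull (T - {s})"
        using \<open>\<not> r \<le> 0\<close> by (intro convex_cone_hull_mul convex_cone_hull_add a'H b'H) auto
      finally show False using minimal[OF s] by simp
    qed
    have "- r *\<^sub>R s \<in> K" using s TK \<open>r \<le> 0\<close> by (intro Kmul) auto
    then have "b' + (- r) *\<^sub>R s \<in> K" using b'H HK by (intro Kadd) auto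
    moreover have "b' + (- r) *\<^sub>R s = - a'" using r by (simp add: algebra_simps)
    ultimately have "a' = 0" using a'H HK point by auto
    then show ?thesis using a \<alpha>(1) s by auto
  qed
  have face: "{c *\<^sub>R s |c. 0 \<le> c} face_of K" if s: "s \<in> T" for s
    unfolding face_of_def
  proof (intro conjI ballI impI)
    show "{c *\<^sub>R s |c. 0 \<le> c} \<subseteq> K" using s TK Kmul by auto
    show "convex {c *\<^sub>R s |c. 0 \<le> c}"
    proof (rule convexI)
      fix x y and u w :: real
      assume "x \<in> {c *\<^sub>R s |c. 0 \<le> c}" "y \<in> {c *\<^sub>R s |c. 0 \<le> c}" and uw: "0 \<le> u" "0 \<le> w"
      then obtain c d where "x = c *\<^sub>R s" "0 \<le> c" "y = d *\<^sub>R s" "0 \<le> d" by blast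
      then have "u *\<^sub>R x + w *\<^sub>R y = (u * c + w * d) *\<^sub>R s" "0 \<le> u * c + w * d"
        using uw by (auto simp: scaleR_add_left)
      then show "u *\<^sub>R x + w *\<^sub>R y \<in> {c *\<^sub>R s |c. 0 \<le> c}" by blast
    qed
    fix a b x assume ab: "a \<in> K" "b \<in> K" and "x \<in> {c *\<^sub>R s |c. 0 \<le> c}" "x \<in> open_segment a b"
    then obtain c where c: "x = c *\<^sub>R s" "0 \<le> c" by blast
    obtain u where u: "0 < u" "u < 1" "x = (1 - u) *\<^sub>R a + u *\<^sub>R b"
      using \<open>x \<in> open_segment a b\<close> unfolding in_segment by blast
    note cu = c u
    have aK: "(1 - u) *\<^sub>R a \<in> K" and bK: "u *\<^sub>R b \<in> K" using ab cu by (auto intro!: Kmul)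
    obtain e where e: "e \<ge> 0" "(1 - u) *\<^sub>R a = e *\<^sub>R s"
      using ray[OF s aK bK _ cu(2)] cu by metis
    obtain e' where e': "e' \<ge> 0" "u *\<^sub>R b = e' *\<^sub>R s"
      using ray[OF s bK aK _ cu(2)] cu by (metis add.commute)
    have "a = (1 / (1 - u)) *\<^sub>R ((1 - u) *\<^sub>R a)" using cu by simp
    also have "\<dots> = (e / (1 - u)) *\<^sub>R s" unfolding e by simp
    finally show "a \<in> {c *\<^sub>R s |c. 0 \<le> c}" using e(1) cu by force
    have "b = (1 / u) *\<^sub>R (u *\<^sub>R b)" using cu by simp
    also have "\<dots> = (e' / u) *\<^sub>R s" unfolding e' by simp
    finally show "b \<in> {c *\<^sub>R s |c. 0 \<le> c}" using e'(1) cu by force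
  qed
  show ?thesis using that[OF finT KT nz face] .
qed

lemma dual_family_exists:
  fixes v :: "'v \<Rightarrow> 'a::euclidean_space"
  assumes ind: "independent (v ` I)" and inj: "inj_on v I"
  obtains U where "\<And>i j. i \<in> I \<Longrightarrow> j \<in> I \<Longrightarrow> U i \<bullet> v j = (if i = j then 1 else 0)"
    "\<And>i. i \<in> I \<Longrightarrow> U i \<in> span (v ` I)"
proof -
  have "\<exists>u. u \<in> span (v ` I) \<and> (\<forall>j\<in>I. u \<bullet> v j = (if i = j then 1 else 0))" if i: "i \<in> I" for i
  proof -
    obtain g :: "'a \<Rightarrow> real" where g: "linear g" "\<forall>x\<in>v ` I. g x = (if x = v i then 1 else 0)"
      using linear_independent_extend[OF ind, of "\<lambda>x. if x = v i then 1 else 0"] by blast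
    \<comment> \<open>The Riesz vector of the functional \<open>g\<close>.\<close>
    define p where "p = adjoint g 1"
    have p: "x \<bullet> p = g x" for x unfolding p_def using adjoint_works[OF g(1), of x 1] by simp
    \<comment> \<open>The orthogonal projection \<open>a\<close> keeps the products with all
      \<open>v j\<close> and lies in their span.\<close>
    obtain a b where ab: "a \<in> span (v ` I)" "\<And>w. w \<in> span (v ` I) \<Longrightarrow> orthogonal b w" "p = a + b"
      using orthogonal_subspace_decomp_exists[of "v ` I" p] by metis
    have "a \<bullet> v j = (if i = j then 1 else 0)" if j: "j \<in> I" for j
    proof -
      have "b \<bullet> v j = 0" using ab(2)[of "v j"] j by (simp add: orthogonal_def span_base)
      then have "a \<bullet> v j = v j \<bullet> p" unfolding ab(3) by (simp add: inner_add_right inner_commute)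
      also have "\<dots> = (if i = j then 1 else 0)" unfolding p using g(2) i j inj by (auto simp: inj_on_def)
      finally show ?thesis .
    qed
    then show ?thesis using ab(1) by blast
  qed
  then obtain U where "\<And>i. i \<in> I \<Longrightarrow> U i \<in> span (v ` I) \<and> (\<forall>j\<in>I. U i \<bullet> v j = (if i = j then 1 else 0))"
    by metis
  then show ?thesis using that[of U] by blast
qed

text \<open>Lattice vectors are determined by their integral coordinates, which on a ball are
  bounded by the Cauchy-Schwarz inequality.\<close>

lemma group_closure_discrete:
  fixes B :: "'a::euclidean_space set"
  assumes ind: "independent B"
  shows "finite (group_closure B \<inter> cball 0 r)"
proof -
  have finB: "finite B" using ind by (rule independent_imp_finite)
  obtain U where U: "\<And>b c. b \<in> B \<Longrightarrow> c \<in> B \<Longrightarrow> U b \<bullet> c = (if b = c then 1 else 0)"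
    by (rule dual_family_exists[of "\<lambda>x. x" B]) (use ind in auto)
  define C where "C = (\<Sum>b\<in>B. norm (U b) * \<bar>r\<bar>)"
  define Z where "Z = PiE B (\<lambda>_. {x::real. x \<in> \<int> \<and> \<bar>x\<bar> \<le> C})"
  have coord: "x \<in> span B \<and> (\<forall>b\<in>B. U b \<bullet> x \<in> \<int>)" if "x \<in> group_closure B" for x
    using that by induction (auto simp: U span_base span_zero span_diff inner_diff_right)
  have expand: "x = (\<Sum>b\<in>B. (U b \<bullet> x) *\<^sub>R b)" if x: "x \<in> span B" for x
  proof -
    obtain c where c: "x = (\<Sum>b\<in>B. c b *\<^sub>R b)" using x unfolding span_finite[OF finB] by auto
    have "U b \<bullet> x = c b" if "b \<in> B" for b
      unfolding c using that finB by (simp add: inner_sum_right U if_distrib[of "\<lambda>x. _ * x"] cong: if_cong)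
    then show ?thesis using c by simp
  qed
  let ?f = "\<lambda>x. \<lambda>b\<in>B. U b \<bullet> x"
  have "inj_on ?f (group_closure B \<inter> cball 0 r)"
  proof (rule inj_onI)
    fix x y assume xy: "x \<in> group_closure B \<inter> cball 0 r" "y \<in> group_closure B \<inter> cball 0 r" "?f x = ?f y"
    then have "U b \<bullet> x = U b \<bullet> y" if "b \<in> B" for b using that by (metis restrict_apply')
    then have "(\<Sum>b\<in>B. (U b \<bullet> x) *\<^sub>R b) = (\<Sum>b\<in>B. (U b \<bullet> y) *\<^sub>R b)" by simp
    then show "x = y" using expand coord xy by (metis IntD1)
  qed
  moreover have "?f ` (group_closure B \<inter> cball 0 r) \<subseteq> Z"
  proof clarify
    fix x assume x: "x \<in> group_closure B" "x \<in> cball 0 r"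
    have "\<bar>U b \<bullet> x\<bar> \<le> C" if b: "b \<in> B" for b
    proof -
      have "\<bar>U b \<bullet> x\<bar> \<le> norm (U b) * norm x" by (rule Cauchy_Schwarz_ineq2)
      also have "\<dots> \<le> norm (U b) * \<bar>r\<bar>" using x by (intro mult_left_mono) auto
      also have "\<dots> \<le> C" unfolding C_def using finB b by (intro member_le_sum) auto
      finally show ?thesis .
    qed
    then show "?f x \<in> Z" using coord[OF x(1)] by (auto simp: Z_def)
  qed
  moreover have "finite Z"
    unfolding Z_def
  proof (rule finite_PiE[OF finB])
    have "{x::real. x \<in> \<int> \<and> \<bar>x\<bar> \<le> C} \<subseteq> of_int ` {\<lfloor>- C\<rfloor>..\<lceil>C\<rceil>}"
    proof
      fix x assume "x \<in> {x::real. x \<in> \<int> \<and> \<bar>x\<bar> \<le> C}"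
      then obtain n where "x = of_int n" "\<bar>x\<bar> \<le> C" by (auto elim: Ints_cases)
      then show "x \<in> of_int ` {\<lfloor>- C\<rfloor>..\<lceil>C\<rceil>}"
        by (intro image_eqI[of _ _ n]) (auto simp: floor_le_iff le_ceiling_iff)
    qed
    then show "finite {x::real. x \<in> \<int> \<and> \<bar>x\<bar> \<le> C}" using finite_subset by blast
  qed
  ultimately show ?thesis using finite_imageD finite_subset by metis
qed

lemma mf_faceD:
  assumes "simplicial_multifan L n \<Delta>" "I \<in> mf_simplices \<Delta>"
  shows "finite I" "J \<subseteq> I \<Longrightarrow> J \<in> mf_simplices \<Delta>"
    "cone_faces (mf_cone \<Delta> I) = mf_cone \<Delta> ` Pow I" "inj_on (mf_cone \<Delta>) (Pow I)"
    "J \<subseteq> I \<Longrightarrow> mf_cone \<Delta> J \<subseteq> mf_cone \<Delta> I" "dim (mf_cone \<Delta> I) = card I"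
    "rational_polyhedral_cone L (mf_cone \<Delta> I)" "strongly_convex (mf_cone \<Delta> I)"
    "card I \<le> n" "\<exists>K\<in>simplices_of_card \<Delta> n. I \<subseteq> K" "finite (mf_simplices \<Delta>)"
proof -
  from assms(1)[unfolded simplicial_multifan_def]
  have fin0: "finite (mf_simplices \<Delta>)"
    and fin: "\<forall>J\<in>mf_simplices \<Delta>. finite J \<and> card J \<le> n"
    and top: "\<forall>J\<in>mf_simplices \<Delta>. \<exists>I\<in>simplices_of_card \<Delta> n. J \<subseteq> I"
    and sub: "\<forall>J\<in>mf_simplices \<Delta>. \<forall>K. K \<subseteq> J \<longrightarrow> K \<in> mf_simplices \<Delta>"
    and cone: "\<forall>J\<in>mf_simplices \<Delta>. rational_polyhedral_cone L (mf_cone \<Delta> J) \<and>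
        strongly_convex (mf_cone \<Delta> J) \<and> dim (mf_cone \<Delta> J) = card J"
    and face: "\<forall>I\<in>mf_simplices \<Delta>.
        bij_betw (mf_cone \<Delta>) (Pow I) (cone_faces (mf_cone \<Delta> I)) \<and>
        (\<forall>J\<in>Pow I. \<forall>K\<in>Pow I. J \<subseteq> K \<longleftrightarrow> mf_cone \<Delta> J \<subseteq> mf_cone \<Delta> K)"
    by - (elim conjE, assumption)+
  show "finite I" "card I \<le> n" using bspec[OF fin assms(2)] by simp_all
  show "finite (mf_simplices \<Delta>)" by (rule fin0)
  show "\<exists>K\<in>simplices_of_card \<Delta> n. I \<subseteq> K" using bspec[OF top assms(2)] .
  show "J \<subseteq> I \<Longrightarrow> J \<in> mf_simplices \<Delta>" using bspec[OF sub assms(2)] by simp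
  show "cone_faces (mf_cone \<Delta> I) = mf_cone \<Delta> ` Pow I" "inj_on (mf_cone \<Delta>) (Pow I)"
    using bspec[OF face assms(2)] by (simp_all add: bij_betw_def)
  show "J \<subseteq> I \<Longrightarrow> mf_cone \<Delta> J \<subseteq> mf_cone \<Delta> I"
    using conjunct2[OF bspec[OF face assms(2)]] by (meson PowI subset_refl)
  show "dim (mf_cone \<Delta> I) = card I" "rational_polyhedral_cone L (mf_cone \<Delta> I)"
    "strongly_convex (mf_cone \<Delta> I)" using bspec[OF cone assms(2)] by simp_all
qed

lemma dim_ray:
  fixes s :: "'a::euclidean_space"
  assumes "s \<noteq> 0"
  shows "dim {c *\<^sub>R s |c. 0 \<le> c} = 1"
proof (rule antisym)
  have "{c *\<^sub>R s |c. 0 \<le> c} \<subseteq> span {s}" by (auto intro: span_mul span_base)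
  then show "dim {c *\<^sub>R s |c. 0 \<le> c} \<le> 1" using dim_le_card[of _ "{s}"] by simp
  have "{s} \<subseteq> {c *\<^sub>R s |c. 0 \<le> c}" by (auto intro!: exI[of _ 1])
  then have "dim {s} \<le> dim {c *\<^sub>R s |c. 0 \<le> c}" by (rule dim_subset)
  then show "1 \<le> dim {c *\<^sub>R s |c. 0 \<le> c}" using assms by simp
qed

text \<open>An extremal ray of the cone is a face, hence the cone of some
  \<open>F \<subseteq> J\<close>; its dimension makes \<open>F\<close> a vertex. So every extremal
  generator is a positive multiple of an edge vector.\<close>

lemma mf_cone_generators:
  assumes mf: "simplicial_multifan L n \<Delta>" and ev: "edge_vectors L \<Delta> v" and J: "J \<in> mf_simplices \<Delta>"
  shows "mf_cone \<Delta> J = convex_cone hull (v ` J)"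
proof
  let ?K = "mf_cone \<Delta> J"
  obtain S where S: "finite S" "?K = convex_cone hull S"
    using mf_faceD(7)[OF mf J] unfolding rational_polyhedral_cone_def by blast
  have v: "v j \<noteq> 0" "v j \<in> mf_cone \<Delta> {j}" if "j \<in> J" for j
    using ev that mf_faceD(2)[OF mf J, of "{j}"] by (auto simp: edge_vectors_def mf_vertices_def)
  have "v ` J \<subseteq> ?K" using v mf_faceD(5)[OF mf J] by blast
  moreover have "convex_cone ?K" unfolding S(2) by (rule convex_cone_convex_cone_hull)
  ultimately show "convex_cone hull (v ` J) \<subseteq> ?K" by (rule hull_minimal)
  obtain T where T: "finite T" "?K = convex_cone hull T" "\<And>s. s \<in> T \<Longrightarrow> s \<noteq> 0"
    "\<And>s. s \<in> T \<Longrightarrow> {c *\<^sub>R s |c. 0 \<le> c} face_of ?K"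
    using pointed_cone_extremal_generators[OF S mf_faceD(8)[OF mf J]] by blast
  have "T \<subseteq> convex_cone hull (v ` J)"
  proof
    fix s assume s: "s \<in> T"
    let ?r = "{c *\<^sub>R s |c. 0 \<le> c}"
    have "?r \<in> cone_faces ?K" using T(4)[OF s] by (auto simp: cone_faces_def intro!: exI[of _ 0])
    then obtain F where F: "F \<subseteq> J" "?r = mf_cone \<Delta> F" using mf_faceD(3)[OF mf J] by auto
    have FS: "F \<in> mf_simplices \<Delta>" using mf_faceD(2)[OF mf J F(1)] .
    have "card F = 1" using mf_faceD(6)[OF mf FS] dim_ray[OF T(3)[OF s]] F(2) by simp
    then obtain j where j: "F = {j}" using card_1_singletonE by blast
    then have jJ: "j \<in> J" using F by simp
    have "v j \<in> ?r" using v(2)[OF jJ] j F(2) by simp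
    then obtain c where c: "v j = c *\<^sub>R s" "0 \<le> c" by blast
    then have "c > 0" using v(1)[OF jJ] by (cases "c = 0") auto
    then have "s = (1 / c) *\<^sub>R v j" using c by simp
    moreover have "(1 / c) *\<^sub>R v j \<in> convex_cone hull (v ` J)"
      using \<open>c > 0\<close> jJ by (intro convex_cone_hull_mul hull_inc) auto
    ultimately show "s \<in> convex_cone hull (v ` J)" by simp
  qed
  then show "?K \<subseteq> convex_cone hull (v ` J)"
    unfolding T(2) by (rule hull_minimal) (rule convex_cone_convex_cone_hull)
qed

text \<open>The vectors span a space containing a cone of dimension \<open>card J\<close>, so they
  must be distinct and independent.\<close>

lemma edge_vectors_independent:
  assumes mf: "simplicial_multifan L n \<Delta>" and ev: "edge_vectors L \<Delta> v" and J: "J \<in> mf_simplices \<Delta>"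
  shows "inj_on v J" "independent (v ` J)"
proof -
  have fin: "finite J" using mf_faceD(1)[OF mf J] .
  have sub: "mf_cone \<Delta> J \<subseteq> span (v ` J)"
    unfolding mf_cone_generators[OF assms]
    by (rule hull_minimal) (auto simp: span_superset convex_cone_span)
  then have le: "card J \<le> dim (span (v ` J))"
    using dim_subset[OF sub] mf_faceD(6)[OF mf J] by simp
  also have "\<dots> \<le> card (v ` J)" using dim_le_card[of "v ` J" "v ` J"] fin by (simp add: span_superset)
  finally have "card (v ` J) = card J" using card_image_le[OF fin, of v] by simp
  then show "inj_on v J" using fin by (simp add: eq_card_imp_inj_on)
  show "independent (v ` J)"
    by (rule card_le_dim_spanning[of _ "span (v ` J)"])
      (use le \<open>card (v ` J) = card J\<close> fin in \<open>auto simp: span_superset\<close>)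
qed

lemma lattice_cone_exists:
  assumes lat: "lattice_of_rank L n" and mf: "simplicial_multifan L n \<Delta>" and ev: "edge_vectors L \<Delta> v"
    and I: "I \<in> simplices_of_card \<Delta> n"
  shows "\<exists>U. lattice_cone L I v U"
proof -
  have IS: "I \<in> mf_simplices \<Delta>" and cI: "card I = n" using I by (auto simp: simplices_of_card_def)
  note ind = edge_vectors_independent[OF mf ev IS]
  have finI: "finite I" using mf_faceD(1)[OF mf IS] .
  obtain B where B: "independent B" "card B = n" "L = group_closure B"
    using lat unfolding lattice_of_rank_def by blast
  have vL: "v i \<in> L" if "i \<in> I" for i
    using ev that mf_faceD(2)[OF mf IS, of "{i}"] by (auto simp: edge_vectors_def mf_vertices_def)
  have "L \<subseteq> span B"
  proof
    fix x assume "x \<in> L"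
    then have "x \<in> group_closure B" using B by simp
    then show "x \<in> span B" by induction (auto simp: span_base span_zero span_diff)
  qed
  moreover have "B \<subseteq> L" using B by (auto intro: group_closure.base)
  ultimately have spanLB: "span L = span B"
    by (simp add: span_minimal span_mono subset_antisym)
  have vsub: "v ` I \<subseteq> span L" using vL by (auto intro: span_base)
  have "span L \<subseteq> span (v ` I)"
  proof (rule card_ge_dim_independent[OF vsub ind(2)])
    have "dim (span L) = n" unfolding spanLB using dim_span_eq_card_independent[OF B(1)] B(2) by simp
    then show "dim (span L) \<le> card (v ` I)" using card_image[OF ind(1)] cI by simp
  qed
  then have spanL: "span L = span (v ` I)" using vsub by (simp add: span_minimal subset_antisym)
  obtain U where U: "\<And>i j. i \<in> I \<Longrightarrow> j \<in> I \<Longrightarrow> U i \<bullet> v j = (if i = j then 1 else 0)"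
    "\<And>i. i \<in> I \<Longrightarrow> U i \<in> span (v ` I)"
    using dual_family_exists[OF ind(2,1)] by blast
  have "lattice_cone L I v U"
  proof
    show "x - x' \<in> L" if "x \<in> L" "x' \<in> L" for x x'
      using that unfolding B(3) by (rule group_closure.diff)
    show "finite (L \<inter> cball 0 r)" for r unfolding B(3) by (rule group_closure_discrete[OF B(1)])
    show "(\<Sum>i\<in>I. (U i \<bullet> x) *\<^sub>R v i) = x" if "x \<in> span L" for x
    proof -
      have "x \<in> span (v ` I)" using that spanL by simp
      then obtain c where c: "x = (\<Sum>b\<in>v ` I. c b *\<^sub>R b)"
        unfolding span_finite[OF finite_imageI[OF finI]] by auto
      then have c: "x = (\<Sum>i\<in>I. c (v i) *\<^sub>R v i)" by (simp add: sum.reindex[OF ind(1)])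
      have "U i \<bullet> x = c (v i)" if "i \<in> I" for i
        unfolding c using that finI by (simp add: inner_sum_right U(1) if_distrib[of "\<lambda>x. _ * x"] cong: if_cong)
      then show ?thesis using c by simp
    qed
  qed (use B(3) finI vL U spanL in auto)
  then show ?thesis by blast
qed

text \<open>The \<open>v i\<close> form a basis of \<open>span L\<close>, so the coefficients of a
  conic combination of edge vectors are the coordinates \<open>U i \<bullet> x\<close>.\<close>

lemma mf_cone_iff:
  assumes mf: "simplicial_multifan L n \<Delta>" and ev: "edge_vectors L \<Delta> v"
    and I: "I \<in> mf_simplices \<Delta>" and lc: "lattice_cone L I v U" and J: "J \<subseteq> I"
  shows "x \<in> mf_cone \<Delta> J \<longleftrightarrow> x \<in> span L \<and> (\<forall>i\<in>I. 0 \<le> U i \<bullet> x) \<and> (\<forall>i\<in>I - J. U i \<bullet> x = 0)"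
proof -
  interpret lattice_cone L I v U by (rule lc)
  have finJ: "finite J" using J finite_I finite_subset by blast
  have ext: "(\<Sum>j\<in>J. c j *\<^sub>R v j) = (\<Sum>i\<in>I. (if i \<in> J then c i else 0) *\<^sub>R v i)" for c
    using J finite_I by (intro sum.mono_neutral_cong_left) auto
  have "x \<in> mf_cone \<Delta> J \<longleftrightarrow> (\<exists>c. (\<forall>j\<in>J. 0 \<le> c j) \<and> x = (\<Sum>j\<in>J. c j *\<^sub>R v j))"
    unfolding mf_cone_generators[OF mf ev mf_faceD(2)[OF mf I J]]
    by (rule convex_cone_hull_image[OF finJ inj_on_subset[OF inj_v J]])
  also have "\<dots> \<longleftrightarrow> x \<in> span L \<and> (\<forall>i\<in>I. 0 \<le> U i \<bullet> x) \<and> (\<forall>i\<in>I - J. U i \<bullet> x = 0)"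
  proof
    assume "\<exists>c. (\<forall>j\<in>J. 0 \<le> c j) \<and> x = (\<Sum>j\<in>J. c j *\<^sub>R v j)"
    then obtain c where c: "\<forall>j\<in>J. 0 \<le> c j" "x = (\<Sum>j\<in>J. c j *\<^sub>R v j)" by blast
    have "x \<in> span L" unfolding c(2) using J v_in_L by (intro span_sum span_mul span_base) auto
    moreover have "U i \<bullet> x = (if i \<in> J then c i else 0)" if "i \<in> I" for i
      unfolding c(2) ext by (rule coord_sum[OF that])
    ultimately show "x \<in> span L \<and> (\<forall>i\<in>I. 0 \<le> U i \<bullet> x) \<and> (\<forall>i\<in>I - J. U i \<bullet> x = 0)"
      using c by auto
  next
    assume a: "x \<in> span L \<and> (\<forall>i\<in>I. 0 \<le> U i \<bullet> x) \<and> (\<forall>i\<in>I - J. U i \<bullet> x = 0)"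
    have "(\<Sum>i\<in>I. (U i \<bullet> x) *\<^sub>R v i) = (\<Sum>j\<in>J. (U j \<bullet> x) *\<^sub>R v j)"
      using a J finite_I by (intro sum.mono_neutral_right) auto
    then have e: "x = (\<Sum>j\<in>J. (U j \<bullet> x) *\<^sub>R v j)" using expand a by simp
    have "\<forall>j\<in>J. 0 \<le> U j \<bullet> x" using a J by blast
    then show "\<exists>c. (\<forall>j\<in>J. 0 \<le> c j) \<and> x = (\<Sum>j\<in>J. c j *\<^sub>R v j)"
      by (intro exI[of _ "\<lambda>j. U j \<bullet> x"] conjI e)
  qed
  finally show ?thesis .
qed

section \<open>Birational morphisms and generic arguments\<close>

text \<open>Pigeonhole: the multiples of \<open>x\<close> have representatives in a finite box, so
  some nonzero integral multiple of \<open>x\<close> lies in the sublattice.\<close>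

lemma (in lattice_cone) coord_Rats:
  assumes x: "x \<in> L" and i: "i \<in> I"
  shows "U i \<bullet> x \<in> \<rat>"
proof -
  have mult: "of_nat k *\<^sub>R x \<in> L" for k
    by (induction k) (auto simp: scaleR_add_left zero_L intro: add_L x)
  have "\<exists>t\<in>box 0. of_nat k *\<^sub>R x - t \<in> sublattice" for k
    using transversal_box[of 0] mult[of k] unfolding transversal_def by blast
  then obtain t where t: "\<And>k. t k \<in> box 0" "\<And>k. of_nat k *\<^sub>R x - t k \<in> sublattice" by metis
  have "finite (range t)" using finite_box[OF span_zero] t(1) by (meson finite_subset image_subsetI)
  then have "\<not> inj t" using finite_imageD infinite_UNIV_nat by blast
  then obtain k l where kl: "t k = t l" "k < l" unfolding inj_on_def by (metis linorder_neqE_nat)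
  have "(of_nat l *\<^sub>R x - t l) - (of_nat k *\<^sub>R x - t k) \<in> sublattice" by (rule sublattice_diff; rule t)
  then have "(of_nat l - of_nat k) *\<^sub>R x \<in> sublattice" using kl by (simp add: scaleR_diff_left)
  then have "U i \<bullet> ((of_nat l - of_nat k) *\<^sub>R x) \<in> \<int>" using i sublattice_iff by blast
  then obtain m where "U i \<bullet> ((of_nat l - of_nat k) *\<^sub>R x) = of_int m" by (rule Ints_cases)
  then have "U i \<bullet> x = of_int m / (of_nat l - of_nat k)" using kl(2)
    by (simp add: inner_diff_right scaleR_diff_left field_simps)
  then show ?thesis by simp
qed

lemma finite_simplices_of_card:
  assumes "simplicial_multifan L n \<Delta>"
  shows "finite (simplices_of_card \<Delta> n)"
proof (cases "mf_simplices \<Delta> = {}")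
  case False
  then show ?thesis using mf_faceD(11)[OF assms] by (auto simp: simplices_of_card_def)
qed (simp add: simplices_of_card_def)

definition dual_vectors :: "'a::euclidean_space set \<Rightarrow> ('v \<Rightarrow> 'a) \<Rightarrow> 'v set \<Rightarrow> 'v \<Rightarrow> 'a" where
  "dual_vectors L v I = (SOME U. lattice_cone L I v U)"

lemma lattice_cone_dual_vectors:
  assumes "lattice_of_rank L n" "simplicial_multifan L n \<Delta>" "edge_vectors L \<Delta> v"
    "I \<in> simplices_of_card \<Delta> n"
  shows "lattice_cone L I v (dual_vectors L v I)"
  unfolding dual_vectors_def by (rule someI_ex[OF lattice_cone_exists[OF assms]])

text \<open>The walls are the full hyperplanes spanned by the facets of maximal cones, not just the
  facets: the strip of Kronecker's formula requires that no coordinate of \<open>y + a\<close>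
  vanishes.\<close>

definition generic_shift :: "'a::euclidean_space set \<Rightarrow> nat \<Rightarrow> ('v, 'a) multifan \<Rightarrow> ('v \<Rightarrow> 'a) \<Rightarrow> 'a \<Rightarrow> bool" where
  "generic_shift L n \<Delta> v y \<longleftrightarrow> (\<forall>I\<in>simplices_of_card \<Delta> n. \<forall>i\<in>I. \<forall>a\<in>L. dual_vectors L v I i \<bullet> (y + a) \<noteq> 0)"

context
  fixes L :: "'a::euclidean_space set" and n :: nat
    and \<Delta> :: "('v, 'a) multifan" and v :: "'v \<Rightarrow> 'a"
    and \<Delta>' :: "('u, 'a) multifan" and v' :: "'u \<Rightarrow> 'a"
    and \<kappa> :: "'v \<Rightarrow> 'u" and f :: "'u set \<Rightarrow> 'v set"
  assumes lat: "lattice_of_rank L n"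
    and mf: "simplicial_multifan L n \<Delta>" and ev: "edge_vectors L \<Delta> v"
    and mf': "simplicial_multifan L n \<Delta>'" and ev': "edge_vectors L \<Delta>' v'"
    and bir: "birational_morphism n \<Delta>' \<Delta> \<kappa> f"
begin

lemma birationalD:
  shows "J' \<in> mf_simplices \<Delta>' \<Longrightarrow> f J' \<in> mf_simplices \<Delta>"
    and "J' \<in> mf_simplices \<Delta>' \<Longrightarrow> mf_cone \<Delta>' J' \<subseteq> mf_cone \<Delta> (f J')"
    and "J' \<in> mf_simplices \<Delta>' \<Longrightarrow> J \<in> mf_simplices \<Delta> \<Longrightarrow> mf_cone \<Delta>' J' \<subseteq> mf_cone \<Delta> J \<Longrightarrow> f J' \<subseteq> J"
    and "J \<in> mf_simplices \<Delta> \<Longrightarrow>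
      subdivides (mf_cone \<Delta>') {J' \<in> mf_simplices \<Delta>'. mf_cone \<Delta>' J' \<subseteq> mf_cone \<Delta> J} (mf_cone \<Delta> J)"
    and "I' \<in> simplices_of_card \<Delta>' n \<Longrightarrow> mf_weight \<Delta>' I' = mf_weight \<Delta> (f I')"
  using bir unfolding birational_morphism_def mf_weight_def by simp_all

lemma top_simplex: "I \<in> simplices_of_card D n \<Longrightarrow> I \<in> mf_simplices D \<and> card I = n"
  by (simp add: simplices_of_card_def)

text \<open>A cone of dimension \<open>n\<close> only fits into a cone of dimension
  \<open>n\<close>.\<close>

lemma f_top:
  assumes I': "I' \<in> simplices_of_card \<Delta>' n"
  shows "f I' \<in> simplices_of_card \<Delta> n"
proof -
  note t = top_simplex[OF I']
  have s: "f I' \<in> mf_simplices \<Delta>" using birationalD(1) t by blast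
  have "dim (mf_cone \<Delta>' I') \<le> dim (mf_cone \<Delta> (f I'))" using birationalD(2) t by (intro dim_subset) blast
  then have "n \<le> card (f I')" using mf_faceD(6)[OF mf s] mf_faceD(6)[OF mf', of I'] t by simp
  then show ?thesis using mf_faceD(9)[OF mf s] s by (simp add: simplices_of_card_def)
qed

lemma f_eq_iff:
  assumes I': "I' \<in> simplices_of_card \<Delta>' n" and I: "I \<in> simplices_of_card \<Delta> n"
  shows "f I' = I \<longleftrightarrow> mf_cone \<Delta>' I' \<subseteq> mf_cone \<Delta> I"
proof
  assume "mf_cone \<Delta>' I' \<subseteq> mf_cone \<Delta> I"
  then have "f I' \<subseteq> I" using birationalD(3) top_simplex[OF I'] top_simplex[OF I] by blast
  then show "f I' = I"
    using top_simplex[OF f_top[OF I']] top_simplex[OF I] mf_faceD(1)[OF mf, of I]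
    by (intro card_subset_eq) auto
qed (use birationalD(2) top_simplex[OF I'] in blast)

lemma shifted_cone_eq:
  assumes mf: "simplicial_multifan L n D" and ev: "edge_vectors L D e"
    and I: "I \<in> simplices_of_card D n" and y: "y \<in> span L"
  shows "lattice_cone.shifted_cone L I (dual_vectors L e I) y = {x \<in> L. y + x \<in> mf_cone D I}"
proof -
  interpret lattice_cone L I e "dual_vectors L e I" by (rule lattice_cone_dual_vectors[OF lat mf ev I])
  have "I \<in> mf_simplices D" using top_simplex[OF I] by blast
  note iff = mf_cone_iff[OF mf ev this lattice_cone_axioms subset_refl]
  have "y + x \<in> span L" if "x \<in> L" for x by (rule span_add[OF y span_base[OF that]])
  then show ?thesis
    unfolding shifted_cone_def iff by auto
qed

text \<open>In a proper face some coordinate with respect to \<open>I\<close> vanishes, which a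
  generic shift forbids.\<close>

lemma generic_face:
  assumes mf: "simplicial_multifan L n D" and ev: "edge_vectors L D e" and gen: "generic_shift L n D e y"
    and I: "I \<in> simplices_of_card D n" and J: "J \<subseteq> I" and x: "x \<in> L" "y + x \<in> mf_cone D J"
  shows "J = I"
proof (rule ccontr)
  assume "J \<noteq> I"
  then obtain i where i: "i \<in> I" "i \<notin> J" using J by blast
  have "I \<in> mf_simplices D" using top_simplex[OF I] by blast
  from mf_cone_iff[OF mf ev this lattice_cone_dual_vectors[OF lat mf ev I] J, of "y + x"]
  have "dual_vectors L e I i \<bullet> (y + x) = 0" using i x by blast
  then show False using gen I i x unfolding generic_shift_def by blast
qed

section \<open>The maximal simplices above a given one, and the pull-back of divisors\<close>

definition fiber :: "'v set \<Rightarrow> 'u set set" where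
  "fiber I = {I' \<in> simplices_of_card \<Delta>' n. f I' = I}"

text \<open>The subdivision puts \<open>y + x\<close> into the cone of some simplex inside the cone
  of \<open>I\<close>. By \<open>generic_face\<close> that simplex is maximal, hence in the
  fibre.\<close>

lemma fiber_union:
  assumes gen: "generic_shift L n \<Delta>' v' y" and y: "y \<in> span L" and I: "I \<in> simplices_of_card \<Delta> n"
  shows "(\<Union>K\<in>fiber I. lattice_cone.shifted_cone L K (dual_vectors L v' K) y) =
    lattice_cone.shifted_cone L I (dual_vectors L v I) y"
proof -
  have IS: "I \<in> mf_simplices \<Delta>" using top_simplex[OF I] by blast
  have "(\<Union>K\<in>fiber I. lattice_cone.shifted_cone L K (dual_vectors L v' K) y) =
      (\<Union>K\<in>fiber I. {x \<in> L. y + x \<in> mf_cone \<Delta>' K})"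
    by (intro SUP_cong refl shifted_cone_eq[OF mf' ev' _ y]) (simp add: fiber_def)
  also have "\<dots> = {x \<in> L. y + x \<in> mf_cone \<Delta> I}"
  proof
    show "(\<Union>K\<in>fiber I. {x \<in> L. y + x \<in> mf_cone \<Delta>' K}) \<subseteq> {x \<in> L. y + x \<in> mf_cone \<Delta> I}"
      using f_eq_iff[OF _ I] by (auto simp: fiber_def)
    show "{x \<in> L. y + x \<in> mf_cone \<Delta> I} \<subseteq> (\<Union>K\<in>fiber I. {x \<in> L. y + x \<in> mf_cone \<Delta>' K})"
    proof clarify
      fix x assume x: "x \<in> L" "y + x \<in> mf_cone \<Delta> I"
      have "(\<Union>J\<in>{J' \<in> mf_simplices \<Delta>'. mf_cone \<Delta>' J' \<subseteq> mf_cone \<Delta> I}. mf_cone \<Delta>' J) = mf_cone \<Delta> I"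
        using birationalD(4)[OF IS] unfolding subdivides_def by blast
      then obtain J where J: "J \<in> mf_simplices \<Delta>'" "mf_cone \<Delta>' J \<subseteq> mf_cone \<Delta> I" "y + x \<in> mf_cone \<Delta>' J"
        using x(2) by blast
      obtain K where K: "K \<in> simplices_of_card \<Delta>' n" "J \<subseteq> K" using mf_faceD(10)[OF mf' J(1)] by blast
      have "J = K" by (rule generic_face[OF mf' ev' gen K x(1) J(3)])
      then have "K \<in> fiber I" using f_eq_iff[OF K(1) I] J(2) K(1) by (simp add: fiber_def)
      then show "x \<in> (\<Union>K\<in>fiber I. {x \<in> L. y + x \<in> mf_cone \<Delta>' K})"
        using x(1) J(3) \<open>J = K\<close> by blast
    qed
  qed
  also have "\<dots> = lattice_cone.shifted_cone L I (dual_vectors L v I) y"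
    by (rule shifted_cone_eq[OF mf ev I y, symmetric])
  finally show ?thesis .
qed

text \<open>A common point would lie in the intersection of the two cones, which is a face of both;
  by genericity it is all of both, so the cones are equal.\<close>

lemma fiber_disjoint:
  assumes gen: "generic_shift L n \<Delta>' v' y" and y: "y \<in> span L" and I: "I \<in> simplices_of_card \<Delta> n"
    and K: "K1 \<in> fiber I" "K2 \<in> fiber I" "K1 \<noteq> K2"
  shows "lattice_cone.shifted_cone L K1 (dual_vectors L v' K1) y \<inter>
    lattice_cone.shifted_cone L K2 (dual_vectors L v' K2) y = {}"
proof (rule ccontr)
  have IS: "I \<in> mf_simplices \<Delta>" using top_simplex[OF I] by blast
  have top: "K1 \<in> simplices_of_card \<Delta>' n" "K2 \<in> simplices_of_card \<Delta>' n" using K by (auto simp: fiber_def)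
  let ?S = "{J' \<in> mf_simplices \<Delta>'. mf_cone \<Delta>' J' \<subseteq> mf_cone \<Delta> I}"
  have S: "K1 \<in> ?S" "K2 \<in> ?S" using K top top_simplex f_eq_iff[OF _ I] by (auto simp: fiber_def)
  assume "\<not> ?thesis"
  then obtain x where x: "x \<in> L" "y + x \<in> mf_cone \<Delta>' K1" "y + x \<in> mf_cone \<Delta>' K2"
    unfolding shifted_cone_eq[OF mf' ev' top(1) y] shifted_cone_eq[OF mf' ev' top(2) y] by blast
  have sub: "subdivides (mf_cone \<Delta>') ?S (mf_cone \<Delta> I)" by (rule birationalD(4)[OF IS])
  then have int: "mf_cone \<Delta>' K1 \<inter> mf_cone \<Delta>' K2 \<in> cone_faces (mf_cone \<Delta>' K1) \<inter> cone_faces (mf_cone \<Delta>' K2)"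
    using S unfolding subdivides_def by blast
  have "mf_cone \<Delta>' K1 \<inter> mf_cone \<Delta>' K2 = mf_cone \<Delta>' K" if K: "K \<in> simplices_of_card \<Delta>' n"
    and c: "mf_cone \<Delta>' K1 \<inter> mf_cone \<Delta>' K2 \<in> cone_faces (mf_cone \<Delta>' K)" for K
  proof -
    have "K \<in> mf_simplices \<Delta>'" using top_simplex[OF K] by blast
    then obtain T where T: "T \<subseteq> K" "mf_cone \<Delta>' K1 \<inter> mf_cone \<Delta>' K2 = mf_cone \<Delta>' T"
      using c mf_faceD(3)[OF mf'] by auto
    then have "y + x \<in> mf_cone \<Delta>' T" using x by blast
    then have "T = K" by (rule generic_face[OF mf' ev' gen K T(1) x(1)])
    then show ?thesis using T by simp
  qed
  then have "mf_cone \<Delta>' K1 = mf_cone \<Delta>' K2" using int top by blast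
  \<comment> \<open>Here the injectivity of the cone map in \<open>subdivides\<close> enters: equal
    cones belong to equal simplices.\<close>
  then have "K1 = K2" using sub S unfolding subdivides_def inj_on_def by blast
  then show False using K by simp
qed

text \<open>The coordinates of \<open>v' i'\<close> with respect to the basis belonging to
  \<open>I\<close> are positive rationals on \<open>f {i'}\<close> and 0 on the rest of
  \<open>I\<close>, so they meet the definite description; independence of the basis makes it
  unique.\<close>

lemma pullback_coeffs_eq:
  assumes I: "I \<in> simplices_of_card \<Delta> n" and I': "I' \<in> fiber I" and i': "i' \<in> I'"
  shows "f {i'} \<subseteq> I"
    and "i \<in> I \<Longrightarrow> of_rat (pullback_coeffs f v v' i' i) = dual_vectors L v I i \<bullet> v' i'"
    and "i \<notin> I \<Longrightarrow> pullback_coeffs f v v' i' i = 0"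
proof -
  interpret lattice_cone L I v "dual_vectors L v I" by (rule lattice_cone_dual_vectors[OF lat mf ev I])
  let ?U = "dual_vectors L v I"
  have I'top: "I' \<in> simplices_of_card \<Delta>' n" using I' by (simp add: fiber_def)
  then have I'S: "I' \<in> mf_simplices \<Delta>'" using top_simplex by blast
  have IS: "I \<in> mf_simplices \<Delta>" using top_simplex[OF I] by blast
  have iS: "{i'} \<in> mf_simplices \<Delta>'" using mf_faceD(2)[OF mf' I'S] i' by simp
  have v'i: "v' i' \<noteq> 0" "v' i' \<in> L" "v' i' \<in> mf_cone \<Delta>' {i'}"
    using ev' iS by (auto simp: edge_vectors_def mf_vertices_def)
  have "mf_cone \<Delta>' {i'} \<subseteq> mf_cone \<Delta>' I'" using mf_faceD(5)[OF mf' I'S] i' by simp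
  also have "\<dots> \<subseteq> mf_cone \<Delta> I" using f_eq_iff[OF I'top I] I' by (simp add: fiber_def)
  finally show T: "f {i'} \<subseteq> I" using birationalD(3)[OF iS IS] by blast
  note cone_iff = mf_cone_iff[OF mf ev IS lattice_cone_axioms]
  have vT: "v' i' \<in> mf_cone \<Delta> (f {i'})" using birationalD(2)[OF iS] v'i(3) by blast
  have nonneg: "0 \<le> ?U i \<bullet> v' i'" if "i \<in> I" for i using cone_iff[OF T, of "v' i'"] vT that by blast
  have zero: "?U i \<bullet> v' i' = 0" if "i \<in> I" "i \<notin> f {i'}" for i using cone_iff[OF T, of "v' i'"] vT that by blast
  \<comment> \<open>Minimality of \<open>f {i'}\<close>: if a coordinate were 0, the whole ray of
    \<open>i'\<close> would lie in the cone of a smaller simplex.\<close>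
  have pos: "0 < ?U i \<bullet> v' i'" if i: "i \<in> f {i'}" for i
  proof (rule ccontr)
    assume "\<not> 0 < ?U i \<bullet> v' i'"
    then have z: "?U i \<bullet> v' i' = 0" using nonneg i T by force
    have sub: "f {i'} - {i} \<subseteq> I" using T by blast
    have "v' i' \<in> mf_cone \<Delta> (f {i'} - {i})"
      unfolding cone_iff[OF sub] using nonneg zero z v'i(2) span_base by blast
    moreover have "mf_cone \<Delta>' {i'} = {c *\<^sub>R v' i' |c. 0 \<le> c}"
      using mf_cone_generators[OF mf' ev' iS] convex_cone_hull_finite[of "{v' i'}"] by auto
    moreover have "f {i'} - {i} \<in> mf_simplices \<Delta>" using mf_faceD(2)[OF mf IS sub] .
    moreover from this have "convex_cone (mf_cone \<Delta> (f {i'} - {i}))"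
      using mf_cone_generators[OF mf ev] convex_cone_convex_cone_hull by metis
    ultimately have "mf_cone \<Delta>' {i'} \<subseteq> mf_cone \<Delta> (f {i'} - {i})"
      by (auto intro: convex_cone_scaleR)
    then have "f {i'} \<subseteq> f {i'} - {i}"
      by (rule birationalD(3)[OF iS \<open>f {i'} - {i} \<in> mf_simplices \<Delta>\<close>])
    then show False using i by blast
  qed
  have "\<exists>r. ?U i \<bullet> v' i' = of_rat r" if "i \<in> I" for i
    using coord_Rats[OF v'i(2) that] by (auto elim: Rats_cases)
  then obtain r where r: "\<And>i. i \<in> I \<Longrightarrow> ?U i \<bullet> v' i' = of_rat (r i)" by metis
  define a where "a = (\<lambda>i. if i \<in> f {i'} then r i else 0)"
  have aI: "of_rat (a i) = ?U i \<bullet> v' i'" if "i \<in> I" for i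
    using r[OF that] zero[OF that] by (auto simp: a_def)
  have ext: "(\<Sum>i\<in>f {i'}. of_rat (b i) *\<^sub>R v i) = (\<Sum>i\<in>I. of_rat (b i) *\<^sub>R v i)"
    if "\<forall>i. i \<notin> f {i'} \<longrightarrow> b i = 0" for b
    using T finite_I that by (intro sum.mono_neutral_left) auto
  have "pullback_coeffs f v v' i' = a"
    unfolding pullback_coeffs_def
  proof (rule the_equality, intro conjI)
    show z: "\<forall>i. i \<notin> f {i'} \<longrightarrow> a i = 0" by (simp add: a_def)
    have "(\<Sum>i\<in>I. of_rat (a i) *\<^sub>R v i) = v' i'"
      using expand[of "v' i'"] v'i(2) by (simp add: aI span_base)
    then show "v' i' = (\<Sum>i\<in>f {i'}. of_rat (a i) *\<^sub>R v i)" using ext[OF z] by simp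
    show "\<forall>i\<in>f {i'}. 0 < a i"
    proof
      fix i assume i: "i \<in> f {i'}"
      then have "i \<in> I" using T by blast
      have "0 < (of_rat (a i) :: real)" unfolding aI[OF \<open>i \<in> I\<close>] by (rule pos[OF i])
      then show "0 < a i" by simp
    qed
  next
    fix b assume b: "v' i' = (\<Sum>i\<in>f {i'}. of_rat (b i) *\<^sub>R v i) \<and> (\<forall>i\<in>f {i'}. 0 < b i) \<and>
      (\<forall>i. i \<notin> f {i'} \<longrightarrow> b i = 0)"
    then have "v' i' = (\<Sum>i\<in>I. of_rat (b i) *\<^sub>R v i)" using ext by simp
    then have "of_rat (b i) = ?U i \<bullet> v' i'" if "i \<in> I" for i using coord_sum[OF that] by simp
    then have "b i = a i" if "i \<in> I" for i using aI[OF that] that by (metis of_rat_eq_iff)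
    then show "b = a" using b T by (auto simp: a_def fun_eq_iff)
  qed
  then show "i \<in> I \<Longrightarrow> of_rat (pullback_coeffs f v v' i' i) = ?U i \<bullet> v' i'"
    and "i \<notin> I \<Longrightarrow> pullback_coeffs f v v' i' i = 0"
    using aI T by (auto simp: a_def)
qed

text \<open>The invariance of \<ell>: the coefficient of the pulled-back divisor at
  \<open>i'\<close> is the value at \<open>v' i'\<close> of the linear function that belongs to
  \<open>I\<close>.\<close>

lemma pullback_divisor_eq:
  assumes I: "I \<in> simplices_of_card \<Delta> n" and I': "I' \<in> fiber I" and i': "i' \<in> I'"
  shows "of_rat (pullback_divisor \<Delta> f v v' d i') = (\<Sum>i\<in>I. of_rat (d i) *\<^sub>R dual_vectors L v I i) \<bullet> v' i'"
proof -
  note pc = pullback_coeffs_eq[OF assms]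
  have IS: "I \<in> mf_simplices \<Delta>" using top_simplex[OF I] by blast
  have "mf_vertices \<Delta> \<subseteq> \<Union> (mf_simplices \<Delta>)" by (auto simp: mf_vertices_def)
  then have finV: "finite (mf_vertices \<Delta>)"
    using mf_faceD(1,11)[OF mf] IS by (meson finite_Union finite_subset)
  have IV: "I \<subseteq> mf_vertices \<Delta>" using mf_faceD(2)[OF mf IS] by (auto simp: mf_vertices_def)
  have "pullback_divisor \<Delta> f v v' d i' = (\<Sum>i\<in>I. d i * pullback_coeffs f v v' i' i)"
    unfolding pullback_divisor_def using finV IV pc(3) by (intro sum.mono_neutral_right) auto
  then have "of_rat (pullback_divisor \<Delta> f v v' d i') = (\<Sum>i\<in>I. of_rat (d i) * of_rat (pullback_coeffs f v v' i' i) :: real)"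
    by (simp add: of_rat_sum of_rat_mult)
  also have "\<dots> = (\<Sum>i\<in>I. of_rat (d i) * (dual_vectors L v I i \<bullet> v' i'))"
    by (intro sum.cong refl) (simp add: pc(2))
  finally show ?thesis by (simp add: inner_sum_left)
qed

section \<open>Comparison of the Fourier series\<close>

text \<open>All simplices of the fibre have the divisor vector of \<open>I\<close>, so every cone
  series is evaluated at the same linear function, and \<open>cone_series_additive\<close>
  applies.\<close>

lemma fourier_coeff_eq:
  fixes d :: "'v \<Rightarrow> rat"
  assumes tau: "Im \<tau> > 0"
    and d: "\<forall>i\<in>mf_vertices \<Delta>. of_rat (d i) * \<sigma> \<notin> period_lattice \<tau>"
    and d': "\<forall>i'\<in>mf_vertices \<Delta>'. of_rat (pullback_divisor \<Delta> f v v' d i') * \<sigma> \<notin> period_lattice \<tau>"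
    and w: "fst w \<in> span L" "snd w \<in> span L"
    and gen': "generic_shift L n \<Delta>' v' (fourier_shift \<tau> w)"
    and I: "I \<in> simplices_of_card \<Delta> n" and m: "m \<in> dual_lattice L"
  shows "lattice_cone.fourier_coeff L I v (dual_vectors L v I) \<tau> \<sigma> w d m =
    (\<Sum>K\<in>fiber I. lattice_cone.fourier_coeff L K v' (dual_vectors L v' K) \<tau> \<sigma> w (pullback_divisor \<Delta> f v v' d) m)"
proof -
  let ?d' = "pullback_divisor \<Delta> f v v' d"
  have lcI: "lattice_cone L I v (dual_vectors L v I)" by (rule lattice_cone_dual_vectors[OF lat mf ev I])
  interpret lattice_cone L I v "dual_vectors L v I" by (rule lcI)
  let ?U = "dual_vectors L v I"
  have IS: "I \<in> mf_simplices \<Delta>" using top_simplex[OF I] by blast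
  have fib: "K \<in> simplices_of_card \<Delta>' n" "K \<in> mf_simplices \<Delta>'" if "K \<in> fiber I" for K
    using that top_simplex by (auto simp: fiber_def)
  have lcK: "lattice_cone L K v' (dual_vectors L v' K)" if "K \<in> fiber I" for K
    by (rule lattice_cone_dual_vectors[OF lat mf' ev' fib(1)[OF that]])
  have span_shift: "fourier_shift \<tau> w \<in> span L" unfolding fourier_shift_def by (intro span_mul w)
  define D where "D = divisor_vector d"
  have D: "D = (\<Sum>i\<in>I. of_rat (d i) *\<^sub>R ?U i)" by (simp add: D_def divisor_vector_def)
  have DK: "lattice_cone.divisor_vector K (dual_vectors L v' K) ?d' = D" if K: "K \<in> fiber I" for K
  proof -
    interpret K: lattice_cone L K v' "dual_vectors L v' K" by (rule lcK[OF K])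
    have "K.divisor_vector ?d' - D = 0"
    proof (rule K.span_eq_0I)
      show "K.divisor_vector ?d' - D \<in> span L"
        unfolding K.divisor_vector_def D by (intro span_diff span_sum span_mul U_span K.U_span)
      fix i assume i: "i \<in> K"
      have "K.divisor_vector ?d' \<bullet> v' i = of_rat (?d' i)"
        unfolding K.divisor_vector_def by (rule K.coord_sum_dual[OF i])
      then show "(K.divisor_vector ?d' - D) \<bullet> v' i = 0"
        unfolding inner_diff_left D using pullback_divisor_eq[OF I K i] by simp
    qed
    then show ?thesis by simp
  qed
  define g where "g = (\<lambda>x. of_real (D \<bullet> x) * \<sigma> + of_real (m \<bullet> x) * \<tau>)"
  have lin: "linear g"
    by (rule linearI) (simp_all add: g_def inner_add_right distrib_left distrib_right scaleR_conv_of_real)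
  \<comment> \<open>At an edge vector \<open>g\<close> is a divisor coefficient times \<sigma> plus
    an integral multiple of \<tau>; the assumptions on both divisors keep the denominators away from
    0.\<close>
  have ne: "cexp (g x) \<noteq> 1"
    if x: "x \<in> L" and r: "D \<bullet> x = of_rat r" "of_rat r * \<sigma> \<notin> period_lattice \<tau>" for x r
  proof -
    have "m \<bullet> x \<in> \<int>" using m x by (simp add: dual_lattice_def)
    then obtain k where k: "m \<bullet> x = of_int k" by (rule Ints_cases)
    have "g x = of_rat r * \<sigma> + of_int k * \<tau>" by (simp add: g_def k r(1) of_real_of_rat)
    then show ?thesis using cexp_period_lattice[OF tau r(2), of k] by (simp add: cexp_add cexp_powi)
  qed
  have "(\<Sum>K\<in>fiber I. lattice_cone.cone_series L K v' (dual_vectors L v' K) (fourier_shift \<tau> w) g) = cone_series (fourier_shift \<tau> w) g"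
  proof (rule cone_series_additive[OF lcI _ lcK _ span_shift fiber_union[OF gen' span_shift I]
        fiber_disjoint[OF gen' span_shift I] lin])
    show "finite (fiber I)" using finite_simplices_of_card[OF mf'] by (auto simp: fiber_def)
  next
    fix K i j assume K: "K \<in> fiber I" and i: "i \<in> I" and j: "j \<in> K"
    have "v' j \<in> mf_cone \<Delta>' K"
      unfolding mf_cone_generators[OF mf' ev' fib(2)[OF K]] using j by (intro hull_inc) auto
    then have "v' j \<in> mf_cone \<Delta> I" using f_eq_iff[OF fib(1)[OF K] I] K by (auto simp: fiber_def)
    then show "0 \<le> ?U i \<bullet> v' j" using mf_cone_iff[OF mf ev IS lcI subset_refl] i by blast
  next
    fix i assume i: "i \<in> I"
    then have "i \<in> mf_vertices \<Delta>" using mf_faceD(2)[OF mf IS] by (auto simp: mf_vertices_def)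
    then show "cexp (g (v i)) \<noteq> 1"
      using ne[OF v_in_L[OF i], of "d i"] d i coord_sum_dual[OF i] by (simp add: D)
  next
    fix K i assume K: "K \<in> fiber I" and i: "i \<in> K"
    then have "i \<in> mf_vertices \<Delta>'" using mf_faceD(2)[OF mf' fib(2)[OF K]] by (auto simp: mf_vertices_def)
    moreover have "v' i \<in> L" using lattice_cone.v_in_L[OF lcK[OF K] i] .
    ultimately show "cexp (g (v' i)) \<noteq> 1"
      using ne[of "v' i" "?d' i"] d' pullback_divisor_eq[OF I K i] by (simp add: D)
  qed
  then have "cexp (- Complex (m \<bullet> fst w) (m \<bullet> snd w)) * cone_series (fourier_shift \<tau> w) g =
    (\<Sum>K\<in>fiber I. cexp (- Complex (m \<bullet> fst w) (m \<bullet> snd w)) *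
      lattice_cone.cone_series L K v' (dual_vectors L v' K) (fourier_shift \<tau> w) g)"
    by (simp add: sum_distrib_left[symmetric])
  also have "\<dots> = (\<Sum>K\<in>fiber I. lattice_cone.fourier_coeff L K v' (dual_vectors L v' K) \<tau> \<sigma> w ?d' m)"
  proof (rule sum.cong[OF refl])
    fix K assume K: "K \<in> fiber I"
    interpret K: lattice_cone L K v' "dual_vectors L v' K" by (rule lcK[OF K])
    show "cexp (- Complex (m \<bullet> fst w) (m \<bullet> snd w)) * K.cone_series (fourier_shift \<tau> w) g = K.fourier_coeff \<tau> \<sigma> w ?d' m"
      unfolding K.fourier_coeff_def g_def DK[OF K] ..
  qed
  finally show ?thesis by (simp add: fourier_coeff_def g_def D_def)
qed

definition local_genus ::
  "('w \<Rightarrow> 'a) \<Rightarrow> ('w \<Rightarrow> rat) \<Rightarrow> complex \<Rightarrow> complex \<Rightarrow> 'a \<times> 'a \<Rightarrow> 'w set \<Rightarrow> complex" where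
  "local_genus e d \<tau> \<sigma> w I = 1 / of_nat (card (quotient_group L e I)) *
    (\<Sum>(h1, h2)\<in>quotient_group L e I \<times> quotient_group L e I.
      \<Prod>i\<in>I. cexp (of_rat (d i) * of_real (dual_basis e I i (coset_rep h1)) * \<sigma>) *
        phi_st (cpairing (dual_basis e I i) (- w + ctensor \<tau> (coset_rep h1) - ctensor 1 (coset_rep h2))) \<tau>
          (of_rat (d i) * \<sigma>))"

lemma orbifold_elliptic_genus_local:
  "orbifold_elliptic_genus L n D e d \<tau> \<sigma> w =
    (\<Sum>I\<in>simplices_of_card D n. of_int (mf_weight D I) * local_genus e d \<tau> \<sigma> w I)"
  by (simp add: orbifold_elliptic_genus_def local_genus_def)

lemma local_genus_has_sum_fourier:
  assumes "simplicial_multifan L n D" "edge_vectors L D e" and I: "I \<in> simplices_of_card D n"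
    and "Im \<tau> > 0" and d: "\<forall>i\<in>mf_vertices D. of_rat (d i) * \<sigma> \<notin> period_lattice \<tau>"
    and "fst w \<in> span L" "snd w \<in> span L" and gen: "generic_shift L n D e (fourier_shift \<tau> w)"
  shows "(lattice_cone.fourier_coeff L I e (dual_vectors L e I) \<tau> \<sigma> w d has_sum local_genus e d \<tau> \<sigma> w I)
    (dual_lattice L)"
  unfolding local_genus_def
proof (rule lattice_cone.local_genus_has_sum[OF lattice_cone_dual_vectors[OF lat assms(1-3)] assms(4) _ assms(6,7)])
  fix i assume "i \<in> I"
  then have "i \<in> mf_vertices D"
    using mf_faceD(2)[OF assms(1), of I] top_simplex[OF I] by (auto simp: mf_vertices_def)
  then show "of_rat (d i) * \<sigma> \<notin> period_lattice \<tau>" using d by blast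
qed (use gen I in \<open>auto simp: generic_shift_def\<close>)

text \<open>The summand of \<open>I\<close> and the sum over its fibre have the same Fourier series.
  Weights are constant on fibres, so the maximal simplices can be grouped by
  \<open>f\<close>.\<close>

lemma genus_eq_generic:
  fixes d :: "'v \<Rightarrow> rat"
  assumes tau: "Im \<tau> > 0"
    and d: "\<forall>i\<in>mf_vertices \<Delta>. of_rat (d i) * \<sigma> \<notin> period_lattice \<tau>"
    and d': "\<forall>i'\<in>mf_vertices \<Delta>'. of_rat (pullback_divisor \<Delta> f v v' d i') * \<sigma> \<notin> period_lattice \<tau>"
    and w: "fst w \<in> span L" "snd w \<in> span L"
    and gen: "generic_shift L n \<Delta> v (fourier_shift \<tau> w)"
    and gen': "generic_shift L n \<Delta>' v' (fourier_shift \<tau> w)"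
  shows "orbifold_elliptic_genus L n \<Delta>' v' (pullback_divisor \<Delta> f v v' d) \<tau> \<sigma> w =
    orbifold_elliptic_genus L n \<Delta> v d \<tau> \<sigma> w"
proof -
  let ?d' = "pullback_divisor \<Delta> f v v' d"
  have F: "local_genus v d \<tau> \<sigma> w I = (\<Sum>K\<in>fiber I. local_genus v' ?d' \<tau> \<sigma> w K)"
    if I: "I \<in> simplices_of_card \<Delta> n" for I
  proof -
    have finI: "finite (fiber I)" using finite_simplices_of_card[OF mf'] by (auto simp: fiber_def)
    have "((\<lambda>m. \<Sum>K\<in>fiber I. lattice_cone.fourier_coeff L K v' (dual_vectors L v' K) \<tau> \<sigma> w ?d' m) has_sum
        (\<Sum>K\<in>fiber I. local_genus v' ?d' \<tau> \<sigma> w K)) (dual_lattice L)"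
      by (intro has_sum_finite_sum finI local_genus_has_sum_fourier[OF mf' ev' _ tau d' w gen']) (simp add: fiber_def)
    then have "(lattice_cone.fourier_coeff L I v (dual_vectors L v I) \<tau> \<sigma> w d has_sum
        (\<Sum>K\<in>fiber I. local_genus v' ?d' \<tau> \<sigma> w K)) (dual_lattice L)"
      using fourier_coeff_eq[OF tau d d' w gen' I] by (simp cong: has_sum_cong)
    with local_genus_has_sum_fourier[OF mf ev I tau d w gen] show ?thesis by (rule has_sum_unique)
  qed
  have "orbifold_elliptic_genus L n \<Delta>' v' ?d' \<tau> \<sigma> w =
      (\<Sum>K\<in>simplices_of_card \<Delta>' n. of_int (mf_weight \<Delta> (f K)) * local_genus v' ?d' \<tau> \<sigma> w K)"
    unfolding orbifold_elliptic_genus_local by (intro sum.cong refl) (simp add: birationalD(5))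
  also have "\<dots> = (\<Sum>I\<in>simplices_of_card \<Delta> n. \<Sum>K\<in>{K \<in> simplices_of_card \<Delta>' n. f K = I}.
      of_int (mf_weight \<Delta> (f K)) * local_genus v' ?d' \<tau> \<sigma> w K)"
    by (rule sum.group[symmetric, OF finite_simplices_of_card[OF mf'] finite_simplices_of_card[OF mf]]) (use f_top in auto)
  also have "\<dots> = (\<Sum>I\<in>simplices_of_card \<Delta> n. of_int (mf_weight \<Delta> I) * local_genus v d \<tau> \<sigma> w I)"
  proof (rule sum.cong[OF refl])
    fix I assume I: "I \<in> simplices_of_card \<Delta> n"
    have "(\<Sum>K\<in>{K \<in> simplices_of_card \<Delta>' n. f K = I}.
        of_int (mf_weight \<Delta> (f K)) * local_genus v' ?d' \<tau> \<sigma> w K) =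
      (\<Sum>K\<in>fiber I. of_int (mf_weight \<Delta> I) * local_genus v' ?d' \<tau> \<sigma> w K)"
      by (rule sum.cong) (auto simp: fiber_def)
    then show "(\<Sum>K\<in>{K \<in> simplices_of_card \<Delta>' n. f K = I}.
        of_int (mf_weight \<Delta> (f K)) * local_genus v' ?d' \<tau> \<sigma> w K) =
      of_int (mf_weight \<Delta> I) * local_genus v d \<tau> \<sigma> w I"
      unfolding F[OF I] by (simp add: sum_distrib_left)
  qed
  finally show ?thesis unfolding orbifold_elliptic_genus_local .
qed

end

section \<open>Non-generic arguments\<close>

text \<open>Finitely many hyperplanes do not cover \<open>V\<close>: a vector that works for
  \<open>A\<close> is moved along \<open>u\<close>, avoiding finitely many parameters.\<close>

lemma exists_nonorthogonal:
  fixes V :: "'a::real_inner set"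
  assumes "finite A" "subspace V" "A \<subseteq> V - {0}"
  shows "\<exists>r\<in>V. \<forall>a\<in>A. a \<bullet> r \<noteq> 0"
  using assms
proof (induction A rule: finite_induct)
  case empty
  then show ?case using subspace_0 by blast
next
  case (insert u A)
  then obtain r where r: "r \<in> V" "\<forall>a\<in>A. a \<bullet> r \<noteq> 0" by blast
  have u: "u \<in> V" "u \<bullet> u \<noteq> 0" using insert.prems by auto
  \<comment> \<open>For \<open>a\<close> not orthogonal to \<open>u\<close> this is the only
    \<open>s\<close> with \<open>a \<bullet> (r + s *\<^sub>R u) = 0\<close>. For \<open>a\<close>
    orthogonal to \<open>u\<close>, adding a multiple of \<open>u\<close> changes nothing.\<close>
  define Bad where "Bad = (\<lambda>a. - (a \<bullet> r) / (a \<bullet> u)) ` insert u A"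
  have "finite Bad" using insert.hyps by (simp add: Bad_def)
  then have "infinite (- (insert 0 Bad))" by (simp add: infinite_UNIV_char_0 finite_compl)
  then obtain s where s: "s \<noteq> 0" "s \<notin> Bad" by (metis Compl_iff finite.emptyI equals0I insert_iff)
  have "a \<bullet> (r + s *\<^sub>R u) \<noteq> 0" if a: "a \<in> insert u A" for a
  proof (cases "a \<bullet> u = 0")
    case True
    then show ?thesis using r u a by (auto simp: inner_add_right)
  next
    case False
    have "s \<noteq> - (a \<bullet> r) / (a \<bullet> u)" using s(2) a unfolding Bad_def by blast
    then show ?thesis using False by (auto simp: inner_add_right field_simps)
  qed
  moreover have "r + s *\<^sub>R u \<in> V" using r u insert.prems by (intro subspace_add subspace_mul)
  ultimately show ?case by blast
qed

text \<open>A nonzero value at 0 would persist on an interval, which is uncountable.\<close>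

lemma isCont_zero_off_countable:
  fixes D :: "real \<Rightarrow> complex"
  assumes cont: "isCont D 0" and bad: "countable B" and zero: "\<And>s. s \<notin> B \<Longrightarrow> D s = 0"
  shows "D 0 = 0"
proof (rule ccontr)
  assume "D 0 \<noteq> 0"
  then obtain e where e: "e > 0" "\<And>s. \<bar>s\<bar> < e \<Longrightarrow> D s \<noteq> 0"
    using continuous_at_avoid[OF cont, of 0] by (force simp: dist_real_def)
  then have "{-e<..<e} \<subseteq> B" using zero by force
  then have "countable {-e<..<e}" using bad countable_subset by blast
  then show False using e(1) uncountable_open_interval[of "-e" e] by simp
qed

lemma lattice_countable:
  assumes "lattice_of_rank L n"
  shows "countable L"
proof -
  obtain B where B: "independent B" "L = group_closure B"
    using assms unfolding lattice_of_rank_def by blast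
  have "x \<in> (\<Union>m::nat. L \<inter> cball 0 (real m))" if "x \<in> L" for x
  proof -
    obtain m where "norm x \<le> real m" using real_arch_simple by blast
    then show ?thesis using that by auto
  qed
  then have "L \<subseteq> (\<Union>m::nat. L \<inter> cball 0 (real m))" by blast
  moreover have "countable (\<Union>m::nat. L \<inter> cball 0 (real m))"
    unfolding B(2) by (rule countable_UN) (simp_all add: countable_finite group_closure_discrete[OF B(1)])
  ultimately show ?thesis by (rule countable_subset)
qed

context
  fixes L :: "'a::euclidean_space set" and n :: nat and D :: "('v, 'a) multifan" and e :: "'v \<Rightarrow> 'a"
    and \<tau> \<sigma> :: complex and w :: "'a \<times> 'a" and r :: 'a
  assumes lat: "lattice_of_rank L n"
    and mf: "simplicial_multifan L n D" and ev: "edge_vectors L D e"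
    and tau: "Im \<tau> > 0" and w: "fst w \<in> span L" "snd w \<in> span L" and r: "r \<in> span L"
begin

text \<open>Each wall and each lattice vector exclude a single \<open>s\<close>, since the line in
  direction \<open>r\<close> is not parallel to any wall.\<close>

lemma non_generic_countable:
  assumes nz: "\<And>I i. I \<in> simplices_of_card D n \<Longrightarrow> i \<in> I \<Longrightarrow> dual_vectors L e I i \<bullet> r \<noteq> 0"
  shows "countable {s. \<not> generic_shift L n D e (fourier_shift \<tau> (fst w, snd w + s *\<^sub>R r))}"
proof -
  let ?U = "dual_vectors L e"
  let ?y = "fourier_shift \<tau> w"
  have "{s. \<not> generic_shift L n D e (fourier_shift \<tau> (fst w, snd w + s *\<^sub>R r))} \<subseteq>
    (\<Union>I\<in>simplices_of_card D n. \<Union>i\<in>I. (\<lambda>a. Im \<tau> * (?U I i \<bullet> (?y + a)) / (?U I i \<bullet> r)) ` L)"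
  proof
    fix s assume "s \<in> {s. \<not> generic_shift L n D e (fourier_shift \<tau> (fst w, snd w + s *\<^sub>R r))}"
    then obtain I i a where I: "I \<in> simplices_of_card D n" "i \<in> I" "a \<in> L"
      and z: "?U I i \<bullet> (fourier_shift \<tau> (fst w, snd w + s *\<^sub>R r) + a) = 0"
      by (auto simp: generic_shift_def)
    have "fourier_shift \<tau> (fst w, snd w + s *\<^sub>R r) + a = (?y + a) - (s / Im \<tau>) *\<^sub>R r"
      by (simp add: fourier_shift_def scaleR_add_right)
    then have "?U I i \<bullet> (?y + a) = (s / Im \<tau>) * (?U I i \<bullet> r)" using z
      by (simp add: inner_diff_right inner_add_right)
    then have "s = Im \<tau> * (?U I i \<bullet> (?y + a)) / (?U I i \<bullet> r)"
      using tau nz[OF I(1,2)] by (simp add: field_simps)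
    then show "s \<in> (\<Union>I\<in>simplices_of_card D n. \<Union>i\<in>I. (\<lambda>a. Im \<tau> * (?U I i \<bullet> (?y + a)) / (?U I i \<bullet> r)) ` L)"
      using I by blast
  qed
  moreover have "countable (\<Union>I\<in>simplices_of_card D n. \<Union>i\<in>I. (\<lambda>a. Im \<tau> * (?U I i \<bullet> (?y + a)) / (?U I i \<bullet> r)) ` L)"
  proof (intro countable_UN countable_image lattice_countable[OF lat] countable_finite)
    show "finite I" if "I \<in> simplices_of_card D n" for I
      using that mf_faceD(1)[OF mf] by (simp add: simplices_of_card_def)
  qed (rule finite_simplices_of_card[OF mf])
  ultimately show ?thesis by (rule countable_subset)
qed

text \<open>All arguments of \<open>phi_st\<close> are affine in \<open>s\<close>, and at
  \<open>s = 0\<close> regularity keeps them off the poles.\<close>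

lemma isCont_genus:
  assumes reg: "genus_regular_at L n D e \<tau> w"
  shows "isCont (\<lambda>s. orbifold_elliptic_genus L n D e d \<tau> \<sigma> (fst w, snd w + s *\<^sub>R r)) 0"
proof -
  have arg: "isCont (\<lambda>s. phi_st (cpairing (dual_basis e I i)
      (- (fst w, snd w + s *\<^sub>R r) + ctensor \<tau> (coset_rep h1) - ctensor 1 (coset_rep h2))) \<tau> \<sigma>') 0"
    if I: "I \<in> simplices_of_card D n" and i: "i \<in> I"
      and h: "h1 \<in> quotient_group L e I" "h2 \<in> quotient_group L e I" for I i h1 h2 \<sigma>'
  proof -
    interpret lattice_cone L I e "dual_vectors L e I" by (rule lattice_cone_dual_vectors[OF lat mf ev I])
    let ?p = "\<lambda>s. cpairing (dual_basis e I i)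
      (- (fst w, snd w + s *\<^sub>R r) + ctensor \<tau> (coset_rep h1) - ctensor 1 (coset_rep h2))"
    let ?u = "dual_vectors L e I i"
    have hL: "coset_rep h1 \<in> L" "coset_rep h2 \<in> L"
      using transversal_coset_rep(1) h by (auto simp: transversal_def)
    \<comment> \<open>Only the imaginary part of \<open>w\<close> moves, so the argument moves along
      a vertical line.\<close>
    have p: "?p s = ?p 0 - \<i> * of_real (s * (?u \<bullet> r))" for s
    proof -
      have s: "snd w + s *\<^sub>R r \<in> span L" by (intro span_add span_mul w r)
      have "?p s = coordinate (fst w, snd w + s *\<^sub>R r) i + of_real (?u \<bullet> coset_rep h1) * \<tau> - of_real (?u \<bullet> coset_rep h2)"
        if "snd w + s *\<^sub>R r \<in> span L" for s
        using cpairing_dual_basis[of "(fst w, snd w + s *\<^sub>R r)", OF _ _ i hL] w that by simp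
      from this[OF s] this[of 0] show ?thesis
        using w by (simp add: coordinate_def complex_eq_iff inner_add_right)
    qed
    have "?p 0 = cpairing (dual_basis e I i) (- w + ctensor \<tau> (coset_rep h1) - ctensor 1 (coset_rep h2))"
      by simp
    also have "\<dots> \<notin> period_lattice \<tau>" using reg I i hL unfolding genus_regular_at_def by blast
    finally have "isCont (\<lambda>z. phi_st z \<tau> \<sigma>') (?p 0)" by (rule isCont_phi_st[OF tau])
    moreover have "isCont ?p 0"
    proof -
      define c where "c = ?p 0"
      have "?p = (\<lambda>s. c - \<i> * of_real (s * (?u \<bullet> r)))"
        unfolding c_def by (rule ext) (rule p)
      moreover have "isCont (\<lambda>s. c - \<i> * of_real (s * (?u \<bullet> r))) 0"
        by (intro continuous_intros)
      ultimately show ?thesis by (simp only:)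
    qed
    ultimately show ?thesis by (rule isCont_o2[rotated])
  qed
  show ?thesis
    unfolding orbifold_elliptic_genus_def case_prod_unfold
    by (intro continuous_sum continuous_mult continuous_prod continuous_const arg) auto
qed

end

lemma dual_vectors_nonzero:
  assumes "lattice_of_rank L n" "simplicial_multifan L n D" "edge_vectors L D e"
    and I: "I \<in> simplices_of_card D n" and i: "i \<in> I"
  shows "dual_vectors L e I i \<in> span L - {0}"
proof -
  interpret lattice_cone L I e "dual_vectors L e I"
    by (rule lattice_cone_dual_vectors[OF assms(1-3) I])
  show ?thesis using U_span[OF i] dual[OF i i] by auto
qed

theorem corollary1:
  fixes L :: "'a::euclidean_space set" and n :: nat
    and \<Delta> :: "('v, 'a) multifan" and v :: "'v \<Rightarrow> 'a" and d :: "'v \<Rightarrow> rat"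
    and \<Delta>' :: "('u, 'a) multifan" and v' :: "'u \<Rightarrow> 'a"
    and \<kappa> :: "'v \<Rightarrow> 'u" and f :: "'u set \<Rightarrow> 'v set"
    and \<tau> \<sigma> :: complex and w :: "'a \<times> 'a"
  assumes "lattice_of_rank L n"
    and "simplicial_multifan L n \<Delta>" and "edge_vectors L \<Delta> v"
    and "simplicial_multifan L n \<Delta>'" and "edge_vectors L \<Delta>' v'"
    and "birational_morphism n \<Delta>' \<Delta> \<kappa> f"
    and "Im \<tau> > 0"
    and "\<forall>i\<in>mf_vertices \<Delta>. of_rat (d i) * \<sigma> \<notin> period_lattice \<tau>"
    and "\<forall>i'\<in>mf_vertices \<Delta>'. of_rat (pullback_divisor \<Delta> f v v' d i') * \<sigma> \<notin> period_lattice \<tau>"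
    and "fst w \<in> span L" and "snd w \<in> span L"
    and "genus_regular_at L n \<Delta> v \<tau> w" and "genus_regular_at L n \<Delta>' v' \<tau> w"
  shows "orbifold_elliptic_genus L n \<Delta>' v' (pullback_divisor \<Delta> f v v' d) \<tau> \<sigma> w =
         orbifold_elliptic_genus L n \<Delta> v d \<tau> \<sigma> w"
proof -
  let ?d' = "pullback_divisor \<Delta> f v v' d"
  \<comment> \<open>The normals of all walls of both multi-fans, so that one direction
    \<open>r\<close> is transversal to all of them.\<close>
  define A where "A = (\<Union>I\<in>simplices_of_card \<Delta> n. dual_vectors L v I ` I) \<union>
    (\<Union>I\<in>simplices_of_card \<Delta>' n. dual_vectors L v' I ` I)"
  have finA: "finite A"
    unfolding A_def using finite_simplices_of_card[OF assms(2)] finite_simplices_of_card[OF assms(4)]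
      mf_faceD(1)[OF assms(2)] mf_faceD(1)[OF assms(4)]
    by (intro finite_UnI finite_UN_I finite_imageI) (simp_all add: simplices_of_card_def)
  have AL: "A \<subseteq> span L - {0}"
    unfolding A_def
    by (intro Un_least UN_least image_subsetI dual_vectors_nonzero[OF assms(1-3)] dual_vectors_nonzero[OF assms(1,4,5)])
  obtain r where r: "r \<in> span L" "\<forall>a\<in>A. a \<bullet> r \<noteq> 0"
    using exists_nonorthogonal[OF finA subspace_span AL] by blast
  define W where "W = (\<lambda>s. (fst w, snd w + s *\<^sub>R r))"
  define B where "B = {s. \<not> generic_shift L n \<Delta> v (fourier_shift \<tau> (W s))} \<union>
    {s. \<not> generic_shift L n \<Delta>' v' (fourier_shift \<tau> (W s))}"
  have nz: "dual_vectors L v I i \<bullet> r \<noteq> 0" if "I \<in> simplices_of_card \<Delta> n" "i \<in> I" for I i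
    by (rule r(2)[THEN bspec]) (unfold A_def, use that in blast)
  have nz': "dual_vectors L v' I i \<bullet> r \<noteq> 0" if "I \<in> simplices_of_card \<Delta>' n" "i \<in> I" for I i
    by (rule r(2)[THEN bspec]) (unfold A_def, use that in blast)
  have "countable B"
    unfolding B_def W_def
    by (intro countable_Un non_generic_countable[OF assms(1-3,7,10,11) r(1) nz]
        non_generic_countable[OF assms(1,4,5,7,10,11) r(1) nz'])
  moreover have "orbifold_elliptic_genus L n \<Delta>' v' ?d' \<tau> \<sigma> (W s) - orbifold_elliptic_genus L n \<Delta> v d \<tau> \<sigma> (W s) = 0"
    if s: "s \<notin> B" for s
  proof -
    have "fst (W s) \<in> span L" "snd (W s) \<in> span L"
      using assms(10,11) r(1) by (simp_all add: W_def span_add span_mul)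
    moreover have "generic_shift L n \<Delta> v (fourier_shift \<tau> (W s))" "generic_shift L n \<Delta>' v' (fourier_shift \<tau> (W s))"
      using s by (auto simp: B_def)
    ultimately show ?thesis using genus_eq_generic[OF assms(1-9)] by simp
  qed
  moreover have "isCont (\<lambda>s. orbifold_elliptic_genus L n \<Delta>' v' ?d' \<tau> \<sigma> (W s) - orbifold_elliptic_genus L n \<Delta> v d \<tau> \<sigma> (W s)) 0"
    unfolding W_def
    by (intro continuous_diff isCont_genus[OF assms(1,4,5,7,10,11) r(1) assms(13)]
        isCont_genus[OF assms(1-3,7,10,11) r(1) assms(12)])
  ultimately have "orbifold_elliptic_genus L n \<Delta>' v' ?d' \<tau> \<sigma> (W 0) - orbifold_elliptic_genus L n \<Delta> v d \<tau> \<sigma> (W 0) = 0"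
    using isCont_zero_off_countable[of "\<lambda>s. orbifold_elliptic_genus L n \<Delta>' v' ?d' \<tau> \<sigma> (W s) - orbifold_elliptic_genus L n \<Delta> v d \<tau> \<sigma> (W s)" B]
    by simp
  then show ?thesis by (simp add: W_def)
qed

end
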